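(* The following problem is decidable: given regular languages $S,T\subseteq(\Sigma\cup\Gamma)^*$ of finite shiftlag, where $T=U\Sigma^*\Gamma^*$ for a regular $(\Sigma\Gamma)^*$-prefix closed set $U\subseteq(\Sigma\Gamma)^*$, decide whether $\llbracket S\rrbracket\in\textsc{Rel}(T)$.
   Context: $\Sigma,\Gamma$ are disjoint finite alphabets. A set $U\subseteq(\Sigma\Gamma)^*$ is $(\Sigma\Gamma)^*$-prefix closed if $uab\in U$ implies $u\in U$ for all $u\in(\Sigma\Gamma)^*$, $a\in\Sigma$, $b\in\Gamma$. For $w\in(\Sigma\cup\Gamma)^*$, $\llbracket w\rrbracket=(\pi_{\mathtt i}(w),\pi_{\mathtt o}(w))$ where $\pi_{\mathtt i}$ (resp. $\pi_{\mathtt o}$) deletes all letters of $\Gamma$ (resp. $\Sigma$), and $\llbracket L\rrbracket=\{\llbracket w\rrbracket:w\in L\}$. $\textsc{Rel}(T)=\{\llbracket T'\rrbracket: T'\subseteq T,\ T'\text{ regular}\}$. A position $i$ of $w$ is $\geq k$-lagged if the absolute difference between the numbers of $\Sigma$-letters and $\Gamma$-letters in $w[1..i]$ is at least $k$. A shift of $w$ is a position $i\in\{1,\dots,|w|-1\}$ with exactly one of $w[i],w[i+1]$ in $\Sigma$; shifts $i<j$ are consecutive if no shift lies strictly between them. $\mathit{shiftlag}(w)$ is the maximal $n$ such that $w$ contains $n$ consecutive shifts all $\geq n$-lagged; a language has finite shiftlag if the supremum over its words is finite. *)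

theory Defs
  imports Main "HOL-Library.Nat_Bijection"
begin

datatype recf = Zr | Sc | Pj nat | Cn recf "recf list" | Pr recf recf | Mn recf

inductive eval_recf :: "recf \<Rightarrow> nat list \<Rightarrow> nat \<Rightarrow> bool" where
  ev_Zr: "eval_recf Zr xs 0"
| ev_Sc: "eval_recf Sc (x # xs) (Suc x)"
| ev_Pj: "i < length xs \<Longrightarrow> eval_recf (Pj i) xs (xs ! i)"
| ev_Cn: "list_all2 (\<lambda>g y. eval_recf g xs y) gs ys \<Longrightarrow> eval_recf f ys z
           \<Longrightarrow> eval_recf (Cn f gs) xs z"
| ev_Pr0: "eval_recf g xs z \<Longrightarrow> eval_recf (Pr g h) (0 # xs) z"
| ev_PrS: "eval_recf (Pr g h) (n # xs) y \<Longrightarrow> eval_recf h (n # y # xs) z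
           \<Longrightarrow> eval_recf (Pr g h) (Suc n # xs) z"
| ev_Mn: "eval_recf f (n # xs) 0 \<Longrightarrow> (\<forall>m<n. \<exists>y. eval_recf f (m # xs) y \<and> y > 0)
           \<Longrightarrow> eval_recf (Mn f) xs n"

type_synonym nfa = "(nat \<times> nat \<times> nat) list \<times> nat list \<times> nat list"
  (* transitions (p, a, q), initial states, final states *)

inductive steps :: "(nat \<times> nat \<times> nat) list \<Rightarrow> nat \<Rightarrow> nat list \<Rightarrow> nat \<Rightarrow> bool" where
  steps_nil: "steps tr p [] p"
| steps_cons: "(p, a, q') \<in> set tr \<Longrightarrow> steps tr q' w q \<Longrightarrow> steps tr p (a # w) q"

definition nfa_lang :: "nfa \<Rightarrow> nat list set" where
  "nfa_lang A = (case A of (tr, I, F) \<Rightarrow>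
      {w. \<exists>p \<in> set I. \<exists>q \<in> set F. steps tr p w q})"

definition regular :: "nat list set \<Rightarrow> bool" where
  "regular L \<longleftrightarrow> (\<exists>A. L = nfa_lang A)"

definition enc_nfa :: "nfa \<Rightarrow> nat" where
  "enc_nfa A = (case A of (tr, I, F) \<Rightarrow>
     list_encode [list_encode (map (\<lambda>(p, a, q). list_encode [p, a, q]) tr),
                  list_encode I, list_encode F])"

definition enc_input :: "nat list \<Rightarrow> nat list \<Rightarrow> nfa \<Rightarrow> nfa \<Rightarrow> nat" where
  "enc_input Sig Gam AS AT =
     list_encode [list_encode Sig, list_encode Gam, enc_nfa AS, enc_nfa AT]"

definition alt_words :: "nat set \<Rightarrow> nat set \<Rightarrow> nat list set" where
  "alt_words Sig Gam = {concat (map (\<lambda>(a, b). [a, b]) ps) | ps.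
                          \<forall>(a, b) \<in> set ps. a \<in> Sig \<and> b \<in> Gam}"

definition alt_prefix_closed :: "nat set \<Rightarrow> nat set \<Rightarrow> nat list set \<Rightarrow> bool" where
  "alt_prefix_closed Sig Gam U \<longleftrightarrow>
     (\<forall>u a b. u \<in> alt_words Sig Gam \<longrightarrow> a \<in> Sig \<longrightarrow> b \<in> Gam \<longrightarrow>
        u @ [a, b] \<in> U \<longrightarrow> u \<in> U)"

definition sem :: "nat set \<Rightarrow> nat set \<Rightarrow> nat list \<Rightarrow> nat list \<times> nat list" where
  "sem Sig Gam w = (filter (\<lambda>x. x \<in> Sig) w, filter (\<lambda>x. x \<in> Gam) w)"

definition Rel :: "nat set \<Rightarrow> nat set \<Rightarrow> nat list set \<Rightarrow> (nat list \<times> nat list) set set" where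
  "Rel Sig Gam T = {sem Sig Gam ` T' | T'. T' \<subseteq> T \<and> regular T'}"

text \<open>Lag at (1-indexed) position i: |#Sigma - #Gamma| in w[1..i].\<close>
definition lag :: "nat set \<Rightarrow> nat set \<Rightarrow> nat list \<Rightarrow> nat \<Rightarrow> int" where
  "lag Sig Gam w i = \<bar>int (length (filter (\<lambda>x. x \<in> Sig) (take i w)))
                     - int (length (filter (\<lambda>x. x \<in> Gam) (take i w)))\<bar>"

text \<open>Shift at 1-indexed position i: exactly one of w[i], w[i+1] is in Sigma.\<close>
definition is_shift :: "nat set \<Rightarrow> nat list \<Rightarrow> nat \<Rightarrow> bool" where
  "is_shift Sig w i \<longleftrightarrow> 1 \<le> i \<and> i + 1 \<le> length w \<and>
     ((w ! (i - 1) \<in> Sig) \<noteq> (w ! i \<in> Sig))"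

definition has_consec_lagged_shifts :: "nat set \<Rightarrow> nat set \<Rightarrow> nat list \<Rightarrow> nat \<Rightarrow> bool" where
  "has_consec_lagged_shifts Sig Gam w n \<longleftrightarrow>
     (\<exists>s :: nat \<Rightarrow> nat.
        (\<forall>j < n. is_shift Sig w (s j) \<and> lag Sig Gam w (s j) \<ge> int n) \<and>
        (\<forall>j. Suc j < n \<longrightarrow> s j < s (Suc j) \<and>
              (\<forall>k. s j < k \<and> k < s (Suc j) \<longrightarrow> \<not> is_shift Sig w k)))"

definition shiftlag :: "nat set \<Rightarrow> nat set \<Rightarrow> nat list \<Rightarrow> nat" where
  "shiftlag Sig Gam w = Max {n. has_consec_lagged_shifts Sig Gam w n}"

definition finite_shiftlag :: "nat set \<Rightarrow> nat set \<Rightarrow> nat list set \<Rightarrow> bool" where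
  "finite_shiftlag Sig Gam L \<longleftrightarrow> (\<exists>B. \<forall>w \<in> L. shiftlag Sig Gam w \<le> B)"

definition admissible_input :: "nat list \<Rightarrow> nat list \<Rightarrow> nfa \<Rightarrow> nfa \<Rightarrow> bool" where
  "admissible_input Sig Gam AS AT \<longleftrightarrow>
     (let \<Sigma> = set Sig; \<Gamma> = set Gam; S = nfa_lang AS; T = nfa_lang AT in
       \<Sigma> \<inter> \<Gamma> = {} \<and>
       S \<subseteq> lists (\<Sigma> \<union> \<Gamma>) \<and> T \<subseteq> lists (\<Sigma> \<union> \<Gamma>) \<and>
       finite_shiftlag \<Sigma> \<Gamma> S \<and> finite_shiftlag \<Sigma> \<Gamma> T \<and>
       (\<exists>U. regular U \<and> U \<subseteq> alt_words \<Sigma> \<Gamma> \<and> alt_prefix_closed \<Sigma> \<Gamma> U \<and>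
            T = {u @ v @ x | u v x. u \<in> U \<and> v \<in> lists \<Sigma> \<and> x \<in> lists \<Gamma>}))"

end

theory Submission
  imports Defs
begin

text \<open>Let \<open>R = \<lbrakk>S\<rbrakk>\<close>. Since every pair has a longest common prefix \<open>u \<in> U\<close>, and \<open>U\<close> is prefix closed,
  \<open>R \<in> Rel T\<close> holds iff \<open>R\<close> is empty or \<open>U\<close> is not, and for every \<open>u \<in> U\<close> the relation \<open>R\<^sub>u\<close>, consisting
  of the rests \<open>(x, y)\<close> of the pairs in \<open>R\<close> whose longest prefix in \<open>U\<close> is \<open>u\<close>, is a finite union of
  products of regular languages. For the latter it is enough that \<open>R\<^sub>u\<close> has finitely many rows
  \<open>{y. (x, y) \<in> R\<^sub>u}\<close>.

  In an automaton for a language of finite shiftlag no cycle containing letters of both alphabets is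
  reachable from an unbalanced cycle. Hence each word of \<open>S\<close> splits into a part of bounded lag followed by
  boundedly many blocks over one alphabet, with bounds given by the number of states. It follows that \<open>R\<close> has
  at most \<open>K\<close> residuals for a computable \<open>K\<close>. By pigeonhole arguments, \<open>K\<close> bounds the lengths of the words
  that matter: the prefixes \<open>u\<close>, the representatives \<open>x\<close> of the rows, and the contexts that tell rows
  apart. So the problem becomes a brute-force test over bounded words.\<close>

section \<open>Computable functions on encodable types\<close>

text \<open>The obstacle is that having finitely many rows is not visibly a bounded condition. It is
  replaced by a reduction property: every word of one critical length can be exchanged for a shorter
  one in all contexts. The contexts can then be bounded too, because relations with few residuals
  that agree on short pairs agree everywhere. Hence no automaton for \<open>R\<close> is ever built;
  only a bound on its number of residuals is computed, and membership in \<open>R\<close> is tested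
  by search. Finitely many rows suffice because the words \<open>x\<close> with a given row then
  form a regular language and each row is regular, so the products of row classes and rows can be
  attached to the regular set of all \<open>u\<close> that behave alike. Conversely, let a regular
  subset of \<open>T\<close> represent \<open>R\<close>. A word in it for a pair with longest prefix
  \<open>u\<close> must begin with some prefix of \<open>u\<close> in \<open>U\<close>, since a
  longer element of \<open>U\<close> would contradict maximality. So a row is determined by finitely
  many left quotients of that subset and the first letter of \<open>x\<close>. A further difficulty
  is that the input describes \<open>T\<close> but not \<open>U\<close>, which has to be recovered
  from \<open>T\<close>.\<close>

class encodable =
  fixes enc :: "'a \<Rightarrow> nat"
  assumes enc_inj: "enc x = enc y \<Longrightarrow> x = y"

instantiation nat :: encodable
begin
definition enc_nat :: "nat \<Rightarrow> nat" where [simp]: "enc_nat x = x"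
instance by standard simp
end

instantiation bool :: encodable
begin
definition enc_bool :: "bool \<Rightarrow> nat" where [simp]: "enc_bool b = (if b then 1 else 0)"
instance by standard (simp split: if_splits)
end

instantiation prod :: (encodable, encodable) encodable
begin
definition enc_prod :: "'a \<times> 'b \<Rightarrow> nat" where "enc_prod p = prod_encode (enc (fst p), enc (snd p))"
instance by standard (auto simp: enc_prod_def prod_encode_eq prod_eq_iff dest: enc_inj)
end

instantiation list :: (encodable) encodable
begin
definition enc_list :: "'a list \<Rightarrow> nat" where "enc_list xs = list_encode (map enc xs)"
instance
proof
  fix x y :: "'a list"
  assume "enc x = enc y"
  then have "map enc x = map enc y" by (simp add: enc_list_def list_encode_eq)
  then show "x = y" by (rule map_injective) (auto simp: inj_def dest: enc_inj)
qed
end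

text \<open>Total functions of one argument; several arguments are packed into nested pairs. The
  closure rules share one environment \<open>x\<close>, so that \<open>intro\<close> can follow the
  syntax of a term.\<close>

definition computable :: "('a::encodable \<Rightarrow> 'b::encodable) \<Rightarrow> bool" where
  "computable f \<longleftrightarrow> (\<exists>r. \<forall>x. eval_recf r [enc x] (enc (f x)))"

lemma eval_Cn1: "eval_recf g xs y \<Longrightarrow> eval_recf f [y] z \<Longrightarrow> eval_recf (Cn f [g]) xs z"
  by (rule ev_Cn[where ys="[y]"]) auto

lemma eval_Cn2:
  "eval_recf g xs y \<Longrightarrow> eval_recf g' xs y' \<Longrightarrow> eval_recf f [y, y'] z
    \<Longrightarrow> eval_recf (Cn f [g, g']) xs z"
  by (rule ev_Cn[where ys="[y, y']"]) auto

lemma eval_Pj: "i < length xs \<Longrightarrow> y = xs ! i \<Longrightarrow> eval_recf (Pj i) xs y"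
  by (simp add: ev_Pj)

section \<open>Arithmetic and Cantor pairing by recursive functions\<close>

primrec rf_const :: "nat \<Rightarrow> recf" where
  "rf_const 0 = Zr"
| "rf_const (Suc n) = Cn Sc [rf_const n]"

lemma eval_rf_const: "eval_recf (rf_const n) xs n"
  by (induction n) (auto intro: ev_Zr ev_Sc eval_Cn1)

definition "rf_add = Pr (Pj 0) (Cn Sc [Pj 1])"
definition "rf_pred = Pr Zr (Pj 0)"
text \<open>Recursion runs on the first argument, so the subtrahend comes first: the value at
  \<open>[n, x]\<close> is \<open>x - n\<close>.\<close>

definition "rf_sub = Pr (Pj 0) (Cn rf_pred [Pj 1])"
definition "rf_tri = Pr Zr (Cn Sc [Cn rf_add [Pj 0, Pj 1]])"
definition "rf_pair = Cn rf_add [Cn rf_tri [rf_add], Pj 0]"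
text \<open>A Cantor code is \<open>triangle (a + b) + a\<close>. The diagonal \<open>a + b\<close>
  is the least \<open>s\<close> whose \<open>triangle (Suc s)\<close> exceeds the code. This is the
  only unbounded search; both projections follow from it by subtraction.\<close>

definition "rf_root = Mn (Cn rf_sub [Cn rf_tri [Cn Sc [Pj 0]], Cn Sc [Pj 1]])"
definition "rf_fst = Cn rf_sub [Cn rf_tri [rf_root], Pj 0]"
definition "rf_snd = Cn rf_sub [rf_fst, rf_root]"

lemma eval_rf_add: "eval_recf rf_add [n, x] (n + x)"
  unfolding rf_add_def
proof (induction n)
  case 0
  show ?case by (rule ev_Pr0, rule eval_Pj) auto
next
  case (Suc n)
  show ?case by (rule ev_PrS[OF Suc], rule eval_Cn1[OF eval_Pj], simp, rule refl) (simp add: ev_Sc)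
qed

lemma eval_rf_pred: "eval_recf rf_pred [n] (n - 1)"
  unfolding rf_pred_def
proof (induction n)
  case 0
  show ?case by (rule ev_Pr0) (simp add: ev_Zr)
next
  case (Suc n)
  show ?case by (rule ev_PrS[OF Suc], rule eval_Pj) auto
qed

lemma eval_rf_sub: "eval_recf rf_sub [n, x] (x - n)"
  unfolding rf_sub_def
proof (induction n)
  case 0
  show ?case by (rule ev_Pr0, rule eval_Pj) auto
next
  case (Suc n)
  have "eval_recf rf_pred [x - n] (x - Suc n)" using eval_rf_pred[of "x - n"] by simp
  then show ?case by (intro ev_PrS[OF Suc] eval_Cn1[OF eval_Pj[OF _ refl]]) auto
qed

lemma eval_rf_tri: "eval_recf rf_tri [n] (triangle n)"
  unfolding rf_tri_def
proof (induction n)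
  case 0
  show ?case by (rule ev_Pr0) (simp add: ev_Zr)
next
  case (Suc n)
  have "eval_recf (Cn Sc [Cn rf_add [Pj 0, Pj 1]]) [n, triangle n] (Suc (n + triangle n))"
    by (rule eval_Cn1[OF eval_Cn2[OF eval_Pj[OF _ refl] eval_Pj[OF _ refl]]])
      (auto intro: ev_Sc eval_rf_add)
  then show ?case by (intro ev_PrS[OF Suc]) (simp add: add.commute)
qed

lemma eval_rf_pair: "eval_recf rf_pair [a, b] (prod_encode (a, b))"
  unfolding rf_pair_def prod_encode_def case_prod_conv
  by (rule eval_Cn2[OF eval_Cn1[OF eval_rf_add eval_rf_tri] eval_Pj eval_rf_add]) auto

lemma triangle_mono: "m \<le> n \<Longrightarrow> triangle m \<le> triangle n"
  by (induction n) (auto simp: le_Suc_eq)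

lemma eval_rf_root: "eval_recf rf_root [prod_encode (a, b)] (a + b)"
proof -
  let ?n = "prod_encode (a, b)"
  let ?f = "Cn rf_sub [Cn rf_tri [Cn Sc [Pj 0]], Cn Sc [Pj 1]]"
  have f: "eval_recf ?f (s # [?n]) (Suc ?n - triangle (Suc s))" for s
    by (rule eval_Cn2[OF eval_Cn1[OF eval_Cn1 eval_rf_tri] eval_Cn1 eval_rf_sub])
      (auto intro!: eval_Pj ev_Sc)
  have "Suc ?n - triangle (Suc (a + b)) = 0"
    by (simp add: prod_encode_def)
  moreover have "Suc ?n - triangle (Suc m) > 0" if "m < a + b" for m
    using triangle_mono[of "Suc m" "a + b"] that by (simp add: prod_encode_def)
  ultimately show ?thesis
    unfolding rf_root_def using f by (intro ev_Mn) metis+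
qed

lemma eval_rf_fst: "eval_recf rf_fst [prod_encode (a, b)] a"
proof -
  have "eval_recf rf_fst [prod_encode (a, b)] (prod_encode (a, b) - triangle (a + b))"
    unfolding rf_fst_def
    by (rule eval_Cn2[OF eval_Cn1[OF eval_rf_root eval_rf_tri] eval_Pj eval_rf_sub]) auto
  then show ?thesis by (simp add: prod_encode_def)
qed

lemma eval_rf_snd: "eval_recf rf_snd [prod_encode (a, b)] b"
proof -
  have "eval_recf rf_snd [prod_encode (a, b)] (a + b - a)"
    unfolding rf_snd_def by (rule eval_Cn2[OF eval_rf_fst eval_rf_root eval_rf_sub])
  then show ?thesis by simp
qed

section \<open>Closure properties of computable functions\<close>

named_theorems computable_intros

lemma computable_comp: "computable f \<Longrightarrow> computable g \<Longrightarrow> computable (\<lambda>x. f (g x))"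
  unfolding computable_def by (meson eval_Cn1)

lemma computable_code:
  assumes "computable h" and "\<And>x. enc (f x) = h (enc x)"
  shows "computable f"
  using assms unfolding computable_def by (metis enc_nat_def)

lemma computable_id[computable_intros]: "computable (\<lambda>x. x)"
  unfolding computable_def by (rule exI[of _ "Pj 0"]) (auto intro: eval_Pj)

lemma computable_const[computable_intros]: "computable (\<lambda>x. c)"
  unfolding computable_def by (metis eval_rf_const)

lemma computable_cast: "(\<And>x. enc (f x) = enc x) \<Longrightarrow> computable f"
  by (rule computable_code[OF computable_id]) auto

lemma computable_Pair[computable_intros]: "computable f \<Longrightarrow> computable g \<Longrightarrow> computable (\<lambda>x. (f x, g x))"
  unfolding computable_def enc_prod_def fst_conv snd_conv by (meson eval_Cn2 eval_rf_pair)

lemma computable_fst[computable_intros]: "computable f \<Longrightarrow> computable (\<lambda>x. fst (f x))"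
  unfolding computable_def enc_prod_def by (meson eval_Cn1 eval_rf_fst)

lemma computable_snd[computable_intros]: "computable f \<Longrightarrow> computable (\<lambda>x. snd (f x))"
  unfolding computable_def enc_prod_def by (meson eval_Cn1 eval_rf_snd)

lemma computable_comp2:
  assumes "computable (\<lambda>p. f (fst p) (snd p))" "computable a" "computable b"
  shows "computable (\<lambda>x. f (a x) (b x))"
  using computable_comp[OF assms(1) computable_Pair[OF assms(2,3)]] by (simp only: fst_conv snd_conv)

lemma computable_comp3:
  assumes "computable (\<lambda>p. f (fst p) (fst (snd p)) (snd (snd p)))" "computable a" "computable b" "computable c"
  shows "computable (\<lambda>x. f (a x) (b x) (c x))"
  using computable_comp[OF assms(1) computable_Pair[OF assms(2) computable_Pair[OF assms(3,4)]]]
  by (simp only: fst_conv snd_conv)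

lemma computable_Suc[computable_intros]: "computable f \<Longrightarrow> computable (\<lambda>x. Suc (f x))"
  unfolding computable_def enc_nat_def by (meson eval_Cn1 ev_Sc)

lemma computable_enc[computable_intros]: "computable f \<Longrightarrow> computable (\<lambda>x. enc (f x))"
  by (rule computable_comp[of enc]) (auto intro: computable_cast)

lemma computable_list_decode[computable_intros]: "computable f \<Longrightarrow> computable (\<lambda>x. list_decode (f x) :: nat list)"
proof (rule computable_comp[of list_decode])
  have "map enc (xs :: nat list) = xs" for xs by (induction xs) auto
  then show "computable (list_decode :: nat \<Rightarrow> nat list)"
    by (intro computable_cast) (simp add: enc_list_def)
qed

lemma computable_prod_decode[computable_intros]: "computable f \<Longrightarrow> computable (\<lambda>x. prod_decode (f x))"
  by (rule computable_comp[of prod_decode]) (auto intro: computable_cast simp: enc_prod_def)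

text \<open>\<open>Pr\<close> passes counter, accumulator and parameter as three arguments, whereas
  \<open>h\<close> is computable on a nested pair; \<open>?H\<close> does the repacking. Later loops
  are instances of this rule.\<close>

lemma computable_rec_nat[computable_intros]:
  assumes "computable g" and "computable (\<lambda>p. h (fst p) (fst (snd p)) (snd (snd p)))" and "computable k"
  shows "computable (\<lambda>x. rec_nat (g x) (\<lambda>n r. h n r x) (k x))"
proof -
  obtain G H N where
    G: "\<And>x. eval_recf G [enc x] (enc (g x))" and
    H: "\<And>p. eval_recf H [enc p] (enc (h (fst p) (fst (snd p)) (snd (snd p))))" and
    N: "\<And>x. eval_recf N [enc x] (k x)"
    using assms unfolding computable_def enc_nat_def by metis
  let ?H = "Cn H [Cn rf_pair [Pj 0, Cn rf_pair [Pj 1, Pj 2]]]"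
  have H': "eval_recf ?H [n, enc r, enc x] (enc (h n r x))" for n r x
    using H[of "(n, r, x)"] by (auto simp: enc_prod_def
      intro!: eval_Cn1[OF eval_Cn2[OF eval_Pj eval_Cn2[OF eval_Pj eval_Pj eval_rf_pair] eval_rf_pair]])
  have P: "eval_recf (Pr G ?H) [n, enc x] (enc (rec_nat (g x) (\<lambda>n r. h n r x) n))" for n x
  proof (induction n)
    case 0
    show ?case by (simp add: ev_Pr0 G)
  next
    case (Suc n)
    from ev_PrS[OF Suc H'] show ?case by (simp only: old.nat.simps)
  qed
  have "eval_recf (Cn (Pr G ?H) [N, Pj 0]) [enc x] (enc (rec_nat (g x) (\<lambda>n r. h n r x) (k x)))" for x
    by (rule eval_Cn2[OF N eval_Pj P]) auto
  then show ?thesis unfolding computable_def by blast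
qed

text \<open>A Boolean has code 0 or 1, so a conditional is a recursion of at most one round that
  starts from the else-branch.\<close>

lemma computable_if[computable_intros]:
  assumes "computable b" "computable f" "computable g"
  shows "computable (\<lambda>x. if b x then f x else g x)"
proof -
  have "computable (\<lambda>x. rec_nat (g x) (\<lambda>n r. f x) (enc (b x)))"
    by (intro computable_intros assms computable_comp[OF assms(2)])
  moreover have "(\<lambda>x. rec_nat (g x) (\<lambda>n r. f x) (enc (b x))) = (\<lambda>x. if b x then f x else g x)"
    by auto
  ultimately show ?thesis by simp
qed

lemma computable_not[computable_intros]:
  assumes "computable b" shows "computable (\<lambda>x. \<not> b x)"
proof -
  have "(\<lambda>x. if b x then False else True) = (\<lambda>x. \<not> b x)" by auto
  then show ?thesis using computable_if[OF assms computable_const[of False] computable_const[of True]] by argo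
qed

lemma computable_conj[computable_intros]:
  assumes "computable b" "computable c" shows "computable (\<lambda>x. b x \<and> c x)"
proof -
  have "(\<lambda>x. if b x then c x else False) = (\<lambda>x. b x \<and> c x)" by auto
  then show ?thesis using computable_if[OF assms computable_const[of False]] by argo
qed

lemma computable_disj[computable_intros]:
  assumes "computable b" "computable c" shows "computable (\<lambda>x. b x \<or> c x)"
  using computable_not[OF computable_conj[OF computable_not[OF assms(1)] computable_not[OF assms(2)]]]
  by (simp only: de_Morgan_conj not_not)

lemma computable_imp[computable_intros]:
  assumes "computable b" "computable c" shows "computable (\<lambda>x. b x \<longrightarrow> c x)"
  using computable_disj[OF computable_not[OF assms(1)] assms(2)] by (simp only: imp_conv_disj)

lemma computable_plus[computable_intros]:
  fixes f g :: "_ \<Rightarrow> nat"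
  assumes "computable f" "computable g" shows "computable (\<lambda>x. f x + g x)"
proof -
  have "rec_nat m (\<lambda>_ r. Suc r) n = m + n" for m n by (induction n) auto
  moreover have "computable (\<lambda>x. rec_nat (f x) (\<lambda>n r. Suc r) (g x))" by (intro computable_intros assms)
  ultimately show ?thesis by simp
qed

lemma computable_minus[computable_intros]:
  fixes f g :: "_ \<Rightarrow> nat"
  assumes "computable f" "computable g" shows "computable (\<lambda>x. f x - g x)"
proof -
  have p: "computable (\<lambda>x. rec_nat 0 (\<lambda>n r. n) (h x))" if "computable h" for h :: "'c::encodable \<Rightarrow> nat"
    by (intro computable_intros that)
  have "rec_nat 0 (\<lambda>n r. n) m = m - 1" for m by (cases m) auto
  then have "rec_nat m (\<lambda>_ r. rec_nat 0 (\<lambda>n r. n) r) n = m - n" for m n by (induction n) auto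
  moreover have "computable (\<lambda>x. rec_nat (f x) (\<lambda>n r. rec_nat 0 (\<lambda>n r. n) r) (g x))"
    by (intro computable_rec_nat[of f] p computable_intros assms)
  ultimately show ?thesis by simp
qed

lemma computable_times[computable_intros]:
  fixes f g :: "_ \<Rightarrow> nat"
  assumes "computable f" "computable g" shows "computable (\<lambda>x. f x * g x)"
proof -
  have "rec_nat 0 (\<lambda>_ r. m + r) n = m * n" for m n :: nat by (induction n) auto
  moreover have "computable (\<lambda>x. rec_nat 0 (\<lambda>n r. f x + r) (g x))"
    by (intro computable_intros computable_comp[OF assms(1)] assms(2))
  ultimately show ?thesis by simp
qed

lemma computable_power[computable_intros]:
  fixes f g :: "_ \<Rightarrow> nat"
  assumes "computable f" "computable g" shows "computable (\<lambda>x. f x ^ g x)"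
proof -
  have "rec_nat 1 (\<lambda>_ r. m * r) n = m ^ n" for m n :: nat by (induction n) auto
  moreover have "computable (\<lambda>x. rec_nat 1 (\<lambda>n r. f x * r) (g x))"
    by (intro computable_intros computable_comp[OF assms(1)] assms(2))
  ultimately show ?thesis by simp
qed

lemma computable_zero: assumes "computable f" shows "computable (\<lambda>x. f x = (0::nat))"
proof -
  have "rec_nat True (\<lambda>_ _. False) n = (n = 0)" for n by (cases n) auto
  moreover have "computable (\<lambda>x. rec_nat True (\<lambda>_ _. False) (f x))" by (intro computable_intros assms)
  ultimately show ?thesis by simp
qed

lemma computable_le[computable_intros]: "computable f \<Longrightarrow> computable g \<Longrightarrow> computable (\<lambda>x. f x \<le> (g x :: nat))"
  using computable_zero[OF computable_minus, of f g] by simp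

lemma computable_less[computable_intros]: "computable f \<Longrightarrow> computable g \<Longrightarrow> computable (\<lambda>x. f x < (g x :: nat))"
  using computable_le[OF computable_Suc, of f g] by (simp add: Suc_le_eq)

text \<open>Injectivity of \<open>enc\<close> reduces equality on any encodable type to two
  comparisons of codes.\<close>

lemma computable_eq[computable_intros]:
  assumes "computable f" "computable g" shows "computable (\<lambda>x. f x = g x)"
proof -
  have "computable (\<lambda>x. enc (f x) \<le> enc (g x) \<and> enc (g x) \<le> enc (f x))" by (intro computable_intros assms)
  moreover have "(enc (f x) \<le> enc (g x) \<and> enc (g x) \<le> enc (f x)) = (f x = g x)" for x
    using enc_inj[of "f x" "g x"] by auto
  ultimately show ?thesis by simp
qed

section \<open>List operations on codes\<close>

lemma enc_Nil: "enc [] = 0" and enc_Cons: "enc (x # xs) = Suc (prod_encode (enc x, enc xs))"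
  by (simp_all add: enc_list_def)

lemma computable_Cons[computable_intros]:
  assumes "computable f" "computable g" shows "computable (\<lambda>x. f x # g x)"
  using computable_Suc[OF computable_enc[OF computable_Pair[OF assms]]]
  unfolding computable_def by (simp add: enc_Cons enc_prod_def)

lemma computable_tl[computable_intros]:
  assumes "computable f" shows "computable (\<lambda>x. tl (f x))"
proof (rule computable_comp[of tl, OF _ assms])
  show "computable (tl :: 'b list \<Rightarrow> 'b list)"
  proof (rule computable_code)
    show "computable (\<lambda>c. snd (prod_decode (c - 1)))" by (intro computable_intros)
    \<comment> \<open>The empty list has code 0 and \<open>0 - 1\<close> is 0, so this makes the
      formula return the code of the empty list there as well.\<close>
    have "prod_decode 0 = (0, 0)"
      using prod_encode_inverse[of "(0, 0)"] by (simp add: prod_encode_def)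
    then show "enc (tl x) = snd (prod_decode (enc x - 1))" for x :: "'b list"
      by (cases x) (simp_all add: enc_Nil enc_Cons)
  qed
qed

lemma computable_hd[computable_intros]:
  assumes "computable f" shows "computable (\<lambda>x. hd (f x))"
proof (rule computable_comp[of hd, OF _ assms])
  show "computable (hd :: 'b list \<Rightarrow> 'b)"
  proof (rule computable_code)
    \<comment> \<open>\<open>hd []\<close> is a fixed unspecified value; its code enters as a
      constant.\<close>
    show "computable (\<lambda>c. if c = 0 then enc (hd [] :: 'b) else fst (prod_decode (c - 1)))"
      by (intro computable_intros)
    show "enc (hd x) = (if enc x = 0 then enc (hd [] :: 'b) else fst (prod_decode (enc x - 1)))"
      for x :: "'b list"
      by (cases x) (simp_all add: enc_Nil enc_Cons)
  qed
qed

lemma length_le_enc: "length xs \<le> enc xs"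
proof (induction xs)
  case (Cons x xs)
  then show ?case using le_prod_encode_2[of "enc xs" "enc x"] by (simp add: enc_Cons)
qed simp

text \<open>The code of a list bounds its length, so \<open>enc (l x)\<close> rounds are enough;
  \<open>step\<close> is idle once the list is used up.\<close>

lemma computable_foldl[computable_intros]:
  assumes "computable z" and "computable (\<lambda>p. f (fst p) (fst (snd p)) (snd (snd p)))" and "computable l"
  shows "computable (\<lambda>x. foldl (\<lambda>a b. f a b x) (z x) (l x))"
proof -
  define step where "step x s = (if snd s = [] then s else (f (fst s) (hd (snd s)) x, tl (snd s)))" for x s
  have it: "rec_nat (a, xs) (\<lambda>_. step x) n = (foldl (\<lambda>a b. f a b x) a (take n xs), drop n xs)" for x a xs n
  proof (induction n)
    case (Suc n)
    then show ?case
      by (auto simp: step_def take_Suc_conv_app_nth hd_drop_conv_nth tl_drop drop_Suc)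
  qed simp
  have st: "computable (\<lambda>p. step (snd (snd p)) (fst (snd p)))"
    unfolding step_def
    by (intro computable_intros computable_comp3[OF assms(2)])
  have "computable (\<lambda>x. fst (rec_nat (z x, l x) (\<lambda>n r. step x r) (enc (l x))))"
    by (intro computable_fst computable_rec_nat st computable_Pair computable_enc assms)
  then show ?thesis by (simp add: it length_le_enc)
qed

lemma computable_length[computable_intros]:
  assumes "computable l" shows "computable (\<lambda>x. length (l x))"
proof -
  have "foldl (\<lambda>a b. Suc a) n xs = n + length xs" for n and xs :: "'b list"
    by (induction xs arbitrary: n) auto
  moreover have "computable (\<lambda>x. foldl (\<lambda>a b. Suc a) 0 (l x))" by (intro computable_intros assms)
  ultimately show ?thesis by (simp only: add_0)
qed

lemma foldl_rev_append: "foldl (\<lambda>a b. f b # a) ys xs = rev (map f xs) @ ys"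
  by (induction xs arbitrary: ys) auto

lemma computable_rev[computable_intros]:
  assumes "computable l" shows "computable (\<lambda>x. rev (l x))"
proof -
  have "computable (\<lambda>x. foldl (\<lambda>a b. b # a) [] (l x))" by (intro computable_intros assms)
  then show ?thesis by (simp add: foldl_rev_append[where f="\<lambda>x. x"])
qed

lemma computable_map[computable_intros]:
  assumes "computable (\<lambda>p. f (fst p) (snd p))" "computable l"
  shows "computable (\<lambda>x. map (\<lambda>b. f b x) (l x))"
proof -
  have "computable (\<lambda>x. rev (foldl (\<lambda>a b. f b x # a) [] (l x)))"
    by (intro computable_intros assms(2) computable_comp2[OF assms(1)])
  then show ?thesis by (simp add: foldl_rev_append)
qed

lemma computable_append[computable_intros]:
  assumes "computable k" "computable l" shows "computable (\<lambda>x. k x @ l x)"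
proof -
  have "computable (\<lambda>x. foldl (\<lambda>a b. b # a) (l x) (rev (k x)))" by (intro computable_intros assms)
  then show ?thesis by (simp add: foldl_rev_append[where f="\<lambda>x. x"])
qed

lemma computable_concat[computable_intros]:
  assumes "computable l" shows "computable (\<lambda>x. concat (l x))"
proof -
  have "foldl (\<lambda>a b. a @ b) ys xs = ys @ concat xs" for ys and xs :: "'b list list"
    by (induction xs arbitrary: ys) auto
  moreover have "computable (\<lambda>x. foldl (\<lambda>a b. a @ b) [] (l x))" by (intro computable_intros assms)
  ultimately show ?thesis by simp
qed

lemma computable_filter[computable_intros]:
  assumes "computable (\<lambda>p. f (fst p) (snd p))" "computable l"
  shows "computable (\<lambda>x. filter (\<lambda>b. f b x) (l x))"
proof -
  have *: "concat (map (\<lambda>b. if f b x then [b] else []) xs) = filter (\<lambda>b. f b x) xs" for xs x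
    by (induction xs) auto
  have "computable (\<lambda>x. concat (map (\<lambda>b. if f b x then [b] else []) (l x)))"
    by (intro computable_intros assms(2) computable_comp2[OF assms(1)])
  then show ?thesis unfolding * .
qed

lemma computable_Ball_set[computable_intros]:
  assumes "computable (\<lambda>p. P (fst p) (snd p))" "computable l"
  shows "computable (\<lambda>x. \<forall>b \<in> set (l x). P b x)"
proof -
  have "computable (\<lambda>x. filter (\<lambda>b. \<not> P b x) (l x) = [])"
    by (intro computable_intros assms(2) computable_comp2[OF assms(1)])
  then show ?thesis by (simp add: filter_empty_conv)
qed

lemma computable_Bex_set[computable_intros]:
  assumes "computable (\<lambda>p. P (fst p) (snd p))" "computable l"
  shows "computable (\<lambda>x. \<exists>b \<in> set (l x). P b x)"
  using computable_not[OF computable_Ball_set[OF computable_not[OF assms(1)] assms(2)]] by simp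

lemma computable_mem_set[computable_intros]:
  assumes "computable f" "computable l"
  shows "computable (\<lambda>x. f x \<in> set (l x))"
proof -
  have "computable (\<lambda>x. \<exists>b \<in> set (l x). b = f x)"
    by (intro computable_intros assms(2) computable_comp[OF assms(1)])
  then show ?thesis by simp
qed

lemma computable_upt[computable_intros]:
  assumes "computable k" shows "computable (\<lambda>x. [0..<k x])"
proof -
  have "rec_nat [] (\<lambda>n r. r @ [n]) n = [0..<n]" for n by (induction n) auto
  moreover have "computable (\<lambda>x. rec_nat [] (\<lambda>n r. r @ [n]) (k x))" by (intro computable_intros assms)
  ultimately show ?thesis by simp
qed

section \<open>Relations with boundedly many residuals\<close>

text \<open>If one component of \<open>(p, q)\<close> is longer than the other, only extensions of the longer one are kept:
  a synchronous automaton then knows the shorter component to be complete.\<close>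

definition residual :: "('a list \<Rightarrow> 'b list \<Rightarrow> bool) \<Rightarrow> 'a list \<Rightarrow> 'b list \<Rightarrow> ('a list \<times> 'b list) set" where
  "residual P p q = {(x, y). P (p @ x) (q @ y) \<and> (length q < length p \<longrightarrow> y = [])
                  \<and> (length p < length q \<longrightarrow> x = [])}"

definition residuals :: "'a set \<Rightarrow> 'b set \<Rightarrow> ('a list \<Rightarrow> 'b list \<Rightarrow> bool) \<Rightarrow> ('a list \<times> 'b list) set set" where
  "residuals A B P = (\<lambda>(p, q). residual P p q) ` (lists A \<times> lists B)"

definition few_residuals :: "'a set \<Rightarrow> 'b set \<Rightarrow> nat \<Rightarrow> ('a list \<Rightarrow> 'b list \<Rightarrow> bool) \<Rightarrow> bool" where
  "few_residuals A B K P \<longleftrightarrow> finite (residuals A B P) \<and> card (residuals A B P) \<le> K"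

lemma residual_in_residuals: "p \<in> lists A \<Longrightarrow> q \<in> lists B \<Longrightarrow> residual P p q \<in> residuals A B P"
  by (auto simp: residuals_def)

text \<open>The side conditions of \<open>residual\<close> are void for equal lengths. The two
  companions below continue only the component that is not the shorter one.\<close>

lemma residual_same:
  assumes "residual P p q = residual P p' q'" "length p = length q" "length p' = length q'"
  shows "P (p @ x) (q @ y) = P (p' @ x) (q' @ y)"
proof -
  have "(x, y) \<in> residual P p q \<longleftrightarrow> (x, y) \<in> residual P p' q'" using assms by simp
  then show ?thesis using assms(2,3) by (simp add: residual_def)
qed

lemma residual_left:
  assumes "residual P p q = residual P p' q'" "length q \<le> length p" "length q' \<le> length p'"
  shows "P (p @ x) q = P (p' @ x) q'"
proof -
  have "(x, []) \<in> residual P p q \<longleftrightarrow> (x, []) \<in> residual P p' q'" using assms by simp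
  then show ?thesis using assms(2,3) by (simp add: residual_def)
qed

lemma residual_right:
  assumes "residual P p q = residual P p' q'" "length p \<le> length q" "length p' \<le> length q'"
  shows "P p (q @ y) = P p' (q' @ y)"
proof -
  have "([], y) \<in> residual P p q \<longleftrightarrow> ([], y) \<in> residual P p' q'" using assms by simp
  then show ?thesis using assms(2,3) by (simp add: residual_def)
qed

lemma pigeonhole_le:
  fixes f :: "nat \<Rightarrow> 'a"
  assumes "finite S" "card S \<le> k" "\<And>i. i \<le> k \<Longrightarrow> f i \<in> S"
  obtains i j where "i < j" "j \<le> k" "f i = f j"
proof -
  have "\<not> inj_on f {..k}"
  proof
    assume "inj_on f {..k}"
    then have "card {..k} \<le> card S" by (rule card_inj_on_le) (use assms in auto)
    with assms(2) show False by simp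
  qed
  then obtain i j where "i \<le> k" "j \<le> k" "f i = f j" "i \<noteq> j" by (auto simp: inj_on_def)
  then show ?thesis using that[of i j] that[of j i] by (cases "i < j") auto
qed

text \<open>On \<open>X\<close>, the map \<open>f\<close> factors through \<open>t\<close>.
  Residuals and quotients are counted in this way: it suffices to find descriptions \<open>t\<close>
  with few values that determine them.\<close>

lemma card_image_determined:
  assumes "\<And>a b. a \<in> X \<Longrightarrow> b \<in> X \<Longrightarrow> t a = t b \<Longrightarrow> f a = f b" "t ` X \<subseteq> Y" "finite Y"
  shows "finite (f ` X)" "card (f ` X) \<le> card Y"
proof -
  have eq: "f ` X = (\<lambda>c. f (inv_into X t c)) ` (t ` X)"
  proof -
    have "f (inv_into X t (t a)) = f a" if "a \<in> X" for a
      using assms(1)[of "inv_into X t (t a)" a] that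
      by (metis f_inv_into_f image_eqI inv_into_into)
    then show ?thesis by (auto simp: image_image)
  qed
  have fin: "finite (t ` X)" using assms(2,3) by (rule finite_subset)
  then show "finite (f ` X)" unfolding eq by simp
  have "card (f ` X) \<le> card (t ` X)" unfolding eq by (rule card_image_le[OF fin])
  also have "\<dots> \<le> card Y" using assms(2,3) by (simp add: card_mono)
  finally show "card (f ` X) \<le> card Y" .
qed

lemma lists_take: "x \<in> lists A \<Longrightarrow> take i x \<in> lists A"
  by (auto dest: in_set_takeD)

lemma lists_drop: "x \<in> lists A \<Longrightarrow> drop i x \<in> lists A"
  by (auto dest: in_set_dropD)

lemma card_Times_le: "card X \<le> m \<Longrightarrow> card Y \<le> n \<Longrightarrow> card (X \<times> Y) \<le> m * n"
  by (simp add: card_cartesian_product mult_le_mono)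

text \<open>Both relations are pumped down at once. If both components have length at least
  \<open>K * L\<close>, a segment is cut out of both at the same positions. Otherwise the longer one
  exceeds the shorter by more than \<open>K * L\<close>, and the cut is made beyond the end of the
  shorter one; this second case causes the factor 2.\<close>

lemma few_residuals_eq:
  assumes P: "few_residuals A B K P" and Q: "few_residuals A B L Q"
    and eq: "\<And>x y. x \<in> lists A \<Longrightarrow> y \<in> lists B \<Longrightarrow> length x \<le> 2 * (K * L) \<Longrightarrow>
               length y \<le> 2 * (K * L) \<Longrightarrow> P x y = Q x y"
  shows "x \<in> lists A \<Longrightarrow> y \<in> lists B \<Longrightarrow> P x y = Q x y"
proof (induction "length x + length y" arbitrary: x y rule: less_induct)
  case less
  let ?k = "K * L" and ?S = "residuals A B P \<times> residuals A B Q"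
  have S: "finite ?S" "card ?S \<le> ?k" using P Q by (simp_all add: few_residuals_def card_cartesian_product mult_le_mono)
  note xy = less.prems
  consider "?k \<le> length x" "?k \<le> length y"
    | "length x < ?k" "length y \<le> 2 * ?k" | "length y < ?k" "length x \<le> 2 * ?k"
    | "length y < ?k" "2 * ?k < length x" | "length x < ?k" "2 * ?k < length y"
    by linarith
  then show ?case
  proof cases
    case 1
    define f where "f t = (residual P (take t x) (take t y), residual Q (take t x) (take t y))" for t
    have "f i \<in> ?S" for i unfolding f_def using xy by (auto intro!: residual_in_residuals lists_take dest: in_set_takeD)
    then obtain i j where ij: "i < j" "j \<le> ?k" "f i = f j" using pigeonhole_le[OF S] by metis
    define x' y' where "x' = take i x @ drop j x" and "y' = take i y @ drop j y"
    have len: "length (take i x) = length (take i y)" "length (take j x) = length (take j y)"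
      using 1 ij by auto
    have "P (take j x @ drop j x) (take j y @ drop j y) = P x' y'"
      unfolding x'_def y'_def by (rule residual_same) (use ij len in \<open>auto simp: f_def\<close>)
    moreover have "Q (take j x @ drop j x) (take j y @ drop j y) = Q x' y'"
      unfolding x'_def y'_def by (rule residual_same) (use ij len in \<open>auto simp: f_def\<close>)
    moreover have "P x' y' = Q x' y'"
      by (rule less.hyps) (use 1 ij xy lists_take[of x A] lists_drop[of x A] lists_take[of y B] lists_drop[of y B]
          in \<open>auto simp: x'_def y'_def\<close>)
    ultimately show ?thesis by simp
  next
    case 4
    define f where "f t = (residual P (take (length y + t) x) y, residual Q (take (length y + t) x) y)" for t
    have "f i \<in> ?S" for i unfolding f_def using xy by (auto intro!: residual_in_residuals lists_take dest: in_set_takeD)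
    then obtain i j where ij: "i < j" "j \<le> ?k" "f i = f j" using pigeonhole_le[OF S] by metis
    define x' where "x' = take (length y + i) x @ drop (length y + j) x"
    have len: "length y \<le> length (take (length y + i) x)" "length y \<le> length (take (length y + j) x)"
      using 4 ij by auto
    have "P (take (length y + j) x @ drop (length y + j) x) y = P x' y"
      unfolding x'_def by (rule residual_left) (use ij len in \<open>auto simp: f_def\<close>)
    moreover have "Q (take (length y + j) x @ drop (length y + j) x) y = Q x' y"
      unfolding x'_def by (rule residual_left) (use ij len in \<open>auto simp: f_def\<close>)
    moreover have "P x' y = Q x' y"
      by (rule less.hyps) (use 4 ij xy lists_take[of x A] lists_drop[of x A] in \<open>auto simp: x'_def\<close>)
    ultimately show ?thesis by simp
  next
    case 5
    define f where "f t = (residual P x (take (length x + t) y), residual Q x (take (length x + t) y))" for t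
    have "f i \<in> ?S" for i unfolding f_def using xy by (auto intro!: residual_in_residuals lists_take dest: in_set_takeD)
    then obtain i j where ij: "i < j" "j \<le> ?k" "f i = f j" using pigeonhole_le[OF S] by metis
    define y' where "y' = take (length x + i) y @ drop (length x + j) y"
    have len: "length x \<le> length (take (length x + i) y)" "length x \<le> length (take (length x + j) y)"
      using 5 ij by auto
    have "P x (take (length x + j) y @ drop (length x + j) y) = P x y'"
      unfolding y'_def by (rule residual_right) (use ij len in \<open>auto simp: f_def\<close>)
    moreover have "Q x (take (length x + j) y @ drop (length x + j) y) = Q x y'"
      unfolding y'_def by (rule residual_right) (use ij len in \<open>auto simp: f_def\<close>)
    moreover have "P x y' = Q x y'"
      by (rule less.hyps) (use 5 ij xy lists_take[of y B] lists_drop[of y B] in \<open>auto simp: y'_def\<close>)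
    ultimately show ?thesis by simp
  qed (use xy eq in auto)
qed

section \<open>Operations that keep the number of residuals bounded\<close>

lemma few_residuals_residual:
  assumes "few_residuals A B K P" "length u = length v" "u \<in> lists A" "v \<in> lists B"
  shows "few_residuals A B K (\<lambda>x y. P (u @ x) (v @ y))"
proof -
  have "residual (\<lambda>x y. P (u @ x) (v @ y)) p q = residual P (u @ p) (v @ q)" for p q
    using assms(2) by (simp add: residual_def)
  then have "residuals A B (\<lambda>x y. P (u @ x) (v @ y)) \<subseteq> residuals A B P"
    using assms(3,4) by (auto simp: residuals_def image_iff)
      (metis append_in_lists_conv in_lists_conv_set)
  then show ?thesis using assms(1) unfolding few_residuals_def
    by (meson card_mono dual_order.trans finite_subset)
qed

text \<open>The extra condition only sees the first letters. Once both are read it is settled, and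
  the residual is empty or one of \<open>P\<close>. If only one is read, the other component is
  already complete and empty, so the condition is void. New are thus at most the empty residual and
  the one at \<open>([], [])\<close>.\<close>

lemma few_residuals_restrict:
  assumes "few_residuals A B K P"
  shows "few_residuals A B (K + 2) (\<lambda>x y. P x y \<and> \<not> (x \<noteq> [] \<and> y \<noteq> [] \<and> E (hd x) (hd y)))"
    (is "few_residuals A B _ ?P")
proof -
  have "residual ?P p q \<in> insert {} (insert (residual ?P [] []) (residuals A B P))"
    if "p \<in> lists A" "q \<in> lists B" for p q
  proof -
    consider "p = []" "q = []" | "p \<noteq> []" "q = []" | "p = []" "q \<noteq> []"
      | "p \<noteq> []" "q \<noteq> []" "E (hd p) (hd q)" | "p \<noteq> []" "q \<noteq> []" "\<not> E (hd p) (hd q)" by blast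
    then show ?thesis
    proof cases
      case 4
      then have "residual ?P p q = {}" by (auto simp: residual_def)
      then show ?thesis by simp
    next
      case 2
      then have "residual ?P p q = residual P p q" by (auto simp: residual_def)
      then show ?thesis using residual_in_residuals[OF that] by auto
    next
      case 3
      then have "residual ?P p q = residual P p q" by (auto simp: residual_def)
      then show ?thesis using residual_in_residuals[OF that] by auto
    next
      case 5
      then have "residual ?P p q = residual P p q" by (auto simp: residual_def)
      then show ?thesis using residual_in_residuals[OF that] by auto
    qed simp
  qed
  then have sub: "residuals A B ?P \<subseteq> insert {} (insert (residual ?P [] []) (residuals A B P))"
    by (auto simp: residuals_def)
  have fin: "finite (residuals A B P)" and c: "card (residuals A B P) \<le> K" using assms by (auto simp: few_residuals_def)
  have "card (insert {} (insert (residual ?P [] []) (residuals A B P))) \<le> K + 2"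
    using c by (simp add: card_insert_if fin)
  then show ?thesis unfolding few_residuals_def using sub fin
    by (meson card_mono dual_order.trans finite_insert finite_subset)
qed

lemma card_words_le:
  assumes "finite A" "card A \<le> n"
  shows "finite {w \<in> lists A. length w \<le> m}" "card {w \<in> lists A. length w \<le> m} \<le> Suc m * Suc n ^ m"
proof -
  have eq: "{w \<in> lists A. length w \<le> m} = {w. set w \<subseteq> A \<and> length w \<le> m}" by auto
  show "finite {w \<in> lists A. length w \<le> m}" unfolding eq using assms(1) by (rule finite_lists_length_le)
  have "(\<Sum>i\<le>m. card A ^ i) \<le> (\<Sum>i\<le>m. Suc n ^ m)"
  proof (rule sum_mono)
    fix i assume "i \<in> {..m}"
    have "card A ^ i \<le> Suc n ^ i" using assms(2) by (simp add: power_mono)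
    also have "\<dots> \<le> Suc n ^ m" using \<open>i \<in> {..m}\<close> by (intro power_increasing) auto
    finally show "card A ^ i \<le> Suc n ^ m" .
  qed
  then show "card {w \<in> lists A. length w \<le> m} \<le> Suc m * Suc n ^ m"
    unfolding eq card_lists_length_le[OF assms(1)] by simp
qed

text \<open>Prepending \<open>u\<close> on one side shifts the synchronisation by at most
  \<open>m\<close> letters. If \<open>g\<close> is the longer component, the residual of
  \<open>P\<close> at \<open>(u @ g, y)\<close> is enough. Otherwise \<open>u @ g\<close> is cut at
  the length of \<open>y\<close>, and the overhang, a word of length at most \<open>m\<close>, is
  remembered verbatim. The factor 3 counts the outcomes of the length comparison.\<close>

lemma few_residuals_shift:
  assumes rbP: "few_residuals A B K P" and A: "finite A" "card A \<le> n" and u: "u \<in> lists A" "length u \<le> m"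
  shows "few_residuals A B (3 * (K * (Suc m * Suc n ^ m))) (\<lambda>x y. P (u @ x) y)" (is "few_residuals A B _ ?P")
proof -
  let ?W = "{w \<in> lists A. length w \<le> m}"
  let ?Y = "{0, 1, 2 :: nat} \<times> (residuals A B P \<times> ?W)"
  define t where "t = (\<lambda>(g, y). if length y < length g then (0 :: nat, residual P (u @ g) y, [])
     else (if length y = length g then 1 else 2, residual P (take (length y) (u @ g)) y, drop (length y) (u @ g)))"
  have W: "finite ?W" "card ?W \<le> Suc m * Suc n ^ m" by (rule card_words_le[OF A])+
  have Q: "finite (residuals A B P)" "card (residuals A B P) \<le> K" using rbP by (auto simp: few_residuals_def)
  have Y: "finite ?Y" by (intro finite_cartesian_product W Q) simp
  have "card {0, 1, 2 :: nat} \<le> 3" by simp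
  then have cY: "card ?Y \<le> 3 * (K * (Suc m * Suc n ^ m))"
    by (rule card_Times_le[OF _ card_Times_le[OF Q(2) W(2)]])
  have tt: "t (g, y) \<in> ?Y" if gy: "g \<in> lists A" "y \<in> lists B" for g y
  proof -
    have ug: "u @ g \<in> lists A" using u gy by auto
    have 1: "residual P (u @ g) y \<in> residuals A B P" using ug gy(2) by (rule residual_in_residuals)
    have 2: "residual P (take (length y) (u @ g)) y \<in> residuals A B P"
      using lists_take[OF ug] gy(2) by (rule residual_in_residuals)
    have 3: "drop (length y) (u @ g) \<in> lists A" using ug by (rule lists_drop)
    show ?thesis
    proof (cases "length y < length g")
      case True
      then show ?thesis using 1 by (simp add: t_def)
    next
      case False
      then have "drop (length y) (u @ g) \<in> ?W" using 3 u by simp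
      then show ?thesis using 2 False by (simp only: t_def) simp
    qed
  qed
  have tY: "t ` (lists A \<times> lists B) \<subseteq> ?Y"
  proof (rule image_subsetI)
    fix z assume "z \<in> lists A \<times> lists B"
    then obtain g y where "g \<in> lists A" "y \<in> lists B" "z = (g, y)" by (rule SigmaE)
    then show "t z \<in> ?Y" using tt by (simp only:)
  qed
  have residual_eq: "residual ?P g y = residual ?P g' y'" if eq: "t (g, y) = t (g', y')" for g y g' y'
  proof -
    have "(x, z) \<in> residual ?P g y \<Longrightarrow> (x, z) \<in> residual ?P g' y'" if eq: "t (g, y) = t (g', y')" for x z g y g' y'
    proof -
      assume xz: "(x, z) \<in> residual ?P g y"
      consider "length y < length g" "length y' < length g'" "residual P (u @ g) y = residual P (u @ g') y'"
        | "length y = length g" "length y' = length g'"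
          "residual P (take (length y) (u @ g)) y = residual P (take (length y') (u @ g')) y'"
          "drop (length y) (u @ g) = drop (length y') (u @ g')"
        | "length y > length g" "length y' > length g'"
          "residual P (take (length y) (u @ g)) y = residual P (take (length y') (u @ g')) y'"
          "drop (length y) (u @ g) = drop (length y') (u @ g')"
        using eq by (auto simp: t_def split: if_splits)
      then show ?thesis
      proof cases
        case 1
        then show ?thesis using xz residual_left[OF 1(3), of x] by (auto simp: residual_def)
      next
        case 2
        have "P (take (length y) (u @ g) @ (drop (length y) (u @ g) @ x)) (y @ z)
          = P (take (length y') (u @ g') @ (drop (length y) (u @ g) @ x)) (y' @ z)"
          by (rule residual_same) (use 2 in auto)
        then have "P ((u @ g) @ x) (y @ z) = P ((u @ g') @ x) (y' @ z)"
          using 2(4) by (metis append.assoc append_take_drop_id)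
        then show ?thesis using xz 2 by (auto simp: residual_def)
      next
        case 3
        have x: "x = []" using xz 3 by (auto simp: residual_def)
        have "P (u @ g) (y @ z) = P (u @ g') (y' @ z)"
        proof (cases "drop (length y) (u @ g) = []")
          case True
          then have "take (length y) (u @ g) = u @ g" "take (length y') (u @ g') = u @ g'"
            using 3 by auto
          moreover have "length (u @ g) \<le> length y" "length (u @ g') \<le> length y'"
            using True 3 by auto
          ultimately show ?thesis using residual_right[of P "u @ g" y "u @ g'" y' z] 3 by simp
        next
          case False
          have "length y < length (u @ g)" "length y' < length (u @ g')"
            using False 3(4) by (metis drop_all not_le)+
          then have "length (take (length y) (u @ g)) = length y" "length (take (length y') (u @ g')) = length y'"
            by (simp_all only: length_take min_def if_True less_imp_le not_le split: if_split) auto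
          then have "P (take (length y) (u @ g) @ drop (length y) (u @ g)) (y @ z)
            = P (take (length y') (u @ g') @ drop (length y) (u @ g)) (y' @ z)"
            by (intro residual_same 3)
          then show ?thesis using 3(4) by (metis append_take_drop_id)
        qed
        then show ?thesis using xz 3 x by (auto simp: residual_def)
      qed
    qed
    from this[OF eq] this[OF eq[symmetric]] show ?thesis by auto
  qed
  have det: "(case a of (p, q) \<Rightarrow> residual ?P p q) = (case b of (p, q) \<Rightarrow> residual ?P p q)" if "t a = t b" for a b
  proof -
    obtain g y g' y' where ab: "a = (g, y)" "b = (g', y')" by (metis surj_pair)
    show ?thesis using residual_eq[OF that[unfolded ab]] by (simp only: ab prod.case)
  qed
  have "finite (residuals A B ?P)" "card (residuals A B ?P) \<le> card ?Y"
    unfolding residuals_def[of A B ?P] by (rule card_image_determined[OF det tY Y], assumption)+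
  then show ?thesis unfolding few_residuals_def using le_trans[OF _ cY] by blast
qed


text \<open>The proof splits \<open>x0 = P0 w r\<close> and replaces \<open>w\<close> by a proper prefix \<open>z\<close>. Some nonempty \<open>\<pi>\<close> can be
  pumped behind \<open>P0\<close> without changing the set of residuals reachable there, and \<open>w\<close> and \<open>z\<close> act alike once
  the second component is exhausted. A \<open>y\<close> telling \<open>P0 w g\<close> and \<open>P0 z g\<close> apart would yield, for every
  \<open>N\<close>, some \<open>y\<^sub>N\<close> telling \<open>P0 \<pi>\<^sup>N w g\<close> and \<open>P0 \<pi>\<^sup>N z g\<close> apart; with finitely many rows, \<open>y\<^sub>N\<close> also
  separates \<open>P0 \<pi>\<^sup>M w g\<close> and \<open>P0 \<pi>\<^sup>M z g\<close> for arbitrarily large \<open>M\<close>, where it is too short to do so.\<close>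

lemma few_residuals_reduce:
  assumes rbP: "few_residuals A B K P" and fin: "finite ((\<lambda>x. {y \<in> lists B. P x y}) ` lists A)"
    and x0: "x0 \<in> lists A" and len: "2 ^ K + 2 ^ (K * K) \<le> length x0"
  obtains x1 where "x1 \<in> lists A" "length x1 < length x0"
    "\<And>g y. g \<in> lists A \<Longrightarrow> y \<in> lists B \<Longrightarrow> P (x0 @ g) y = P (x1 @ g) y"
proof -
  let ?Q = "residuals A B P"
  have Q: "finite ?Q" "card ?Q \<le> K" using rbP by (auto simp: few_residuals_def)
  \<comment> \<open>\<open>S\<close> takes at most \<open>2 ^ K\<close> values and
    \<open>\<Theta>\<close> at most \<open>2 ^ (K * K)\<close>, whence the two summands of the
    length bound: a repetition of \<open>S\<close> yields \<open>\<pi>\<close>, and one of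
    \<open>\<Theta>\<close> yields \<open>w\<close> and \<open>z\<close>.\<close>
  define S where "S p = {residual P p v |v. v \<in> lists B \<and> length v = length p}" for p
  define \<Theta> where "\<Theta> z = {(residual P p q, residual P (p @ z) q) |p q. p \<in> lists A \<and> q \<in> lists B \<and> length q \<le> length p}" for z
  have QQ: "finite (?Q \<times> ?Q)" "card (?Q \<times> ?Q) \<le> K * K"
    using Q by (simp_all add: card_cartesian_product mult_le_mono)
  have SQ: "S p \<in> Pow ?Q" if "p \<in> lists A" for p
  proof
    show "S p \<subseteq> ?Q"
    proof
      fix r assume "r \<in> S p"
      then obtain v where "v \<in> lists B" "r = residual P p v" unfolding S_def by fast
      then show "r \<in> ?Q" using residual_in_residuals[OF that] by simp
    qed
  qed
  have "S (take i x0) \<in> Pow ?Q" for i by (rule SQ[OF lists_take[OF x0]])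
  moreover have "finite (Pow ?Q)" "card (Pow ?Q) \<le> 2 ^ K" using Q by (simp_all add: card_Pow)
  ultimately obtain i j where ij: "i < j" "j \<le> 2 ^ K" "S (take i x0) = S (take j x0)"
    using pigeonhole_le[of "Pow ?Q" "2 ^ K" "\<lambda>i. S (take i x0)"] by metis
  have TQ: "\<Theta> z \<in> Pow (?Q \<times> ?Q)" if z: "z \<in> lists A" for z
  proof -
    have "(residual P p q, residual P (p @ z) q) \<in> ?Q \<times> ?Q" if "p \<in> lists A" "q \<in> lists B" for p q
      using that z by (intro SigmaI residual_in_residuals append_in_lists_conv[THEN iffD2] conjI)
    then show ?thesis unfolding \<Theta>_def by fast
  qed
  have "\<Theta> (take k (drop i x0)) \<in> Pow (?Q \<times> ?Q)" for k
    by (rule TQ[OF lists_take[OF lists_drop[OF x0]]])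
  moreover have "finite (Pow (?Q \<times> ?Q))" "card (Pow (?Q \<times> ?Q)) \<le> 2 ^ (K * K)"
    using QQ by (simp_all add: card_Pow power_increasing del: card_cartesian_product)
  ultimately obtain k l where kl: "k < l" "l \<le> 2 ^ (K * K)"
    "\<Theta> (take k (drop i x0)) = \<Theta> (take l (drop i x0))"
    using pigeonhole_le[of "Pow (?Q \<times> ?Q)" "2 ^ (K * K)" "\<lambda>k. \<Theta> (take k (drop i x0))"] by metis
  define P0 w z \<pi> where "P0 = take i x0" and "w = take l (drop i x0)" and "z = take k (drop i x0)"
    and "\<pi> = drop i (take j x0)"
  define rest where "rest = drop (i + l) x0"
  have il: "i + l \<le> length x0" using ij kl len by linarith
  have x0_eq: "x0 = P0 @ w @ rest"
    unfolding P0_def w_def rest_def by (metis append_take_drop_id drop_drop add.commute)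
  have inA: "P0 \<in> lists A" "w \<in> lists A" "z \<in> lists A" "\<pi> \<in> lists A" "rest \<in> lists A"
    unfolding P0_def w_def z_def \<pi>_def rest_def by (intro lists_take lists_drop x0)+
  have S\<pi>: "S (P0 @ \<pi>) = S P0"
  proof -
    have "take j x0 = P0 @ \<pi>" unfolding P0_def \<pi>_def using ij(1)
      by (metis append_take_drop_id less_imp_le_nat min.absorb1 take_take)
    then show ?thesis using ij(3) by (simp add: P0_def)
  qed
  have \<pi>_ne: "\<pi> \<noteq> []" using ij il len kl by (auto simp: \<pi>_def)
  have \<Theta>eq: "\<Theta> z = \<Theta> w" using kl(3) by (simp add: z_def w_def)
  have absorb: "P (p @ w @ x) q = P (p @ z @ x) q"
    if "length q \<le> length p" "p \<in> lists A" "q \<in> lists B" for p q x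
  proof -
    have "(residual P p q, residual P (p @ w) q) \<in> \<Theta> z" unfolding \<Theta>eq using that by (auto simp: \<Theta>_def)
    then obtain p' q' where pq: "residual P p q = residual P p' q'" "residual P (p @ w) q = residual P (p' @ z) q'"
      "length q' \<le> length p'" by (auto simp: \<Theta>_def)
    have "P ((p @ w) @ x) q = P ((p' @ z) @ x) q'" by (rule residual_left) (use pq that in auto)
    also have "\<dots> = P (p @ z @ x) q" using residual_left[OF pq(1), of "z @ x"] pq that by simp
    finally show ?thesis by simp
  qed
  define pw where "pw N = P0 @ concat (replicate N \<pi>)" for N
  have pwA: "pw N \<in> lists A" for N unfolding pw_def using inA by (induction N) auto
  have pwS: "S (pw N) = S P0" for N
  proof (induction N)
    case (Suc N)
    \<comment> \<open>\<open>S (p @ z)\<close> depends on \<open>p\<close> only through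
      \<open>S p\<close>, since the part of \<open>v\<close> aligned with \<open>p\<close> can be
      exchanged. So invariance under one \<open>\<pi>\<close> carries over to all powers.\<close>
    have "S (p @ z) \<subseteq> S (p' @ z)" if pp: "S p = S p'" for p p' z
    proof
      fix r assume "r \<in> S (p @ z)"
      then obtain v where v: "v \<in> lists B" "length v = length p + length z" "r = residual P (p @ z) v"
        by (auto simp: S_def)
      define v1 v2 where "v1 = take (length p) v" and "v2 = drop (length p) v"
      have vv: "v = v1 @ v2" "length v1 = length p" "length v2 = length z" "v1 \<in> lists B" "v2 \<in> lists B"
        using v by (auto simp: v1_def v2_def lists_take lists_drop dest: in_set_takeD in_set_dropD)
      have "residual P p v1 \<in> S p'" unfolding pp[symmetric] using vv by (auto simp: S_def)
      then obtain v' where v': "residual P p v1 = residual P p' v'" "length v' = length p'" "v' \<in> lists B"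
        by (auto simp: S_def)
      have "r = residual P (p' @ z) (v' @ v2)"
        using residual_same[OF v'(1)] v' vv unfolding v(3) by (auto simp: residual_def)
      then show "r \<in> S (p' @ z)" unfolding S_def using v' vv
        by (intro CollectI exI[of _ "v' @ v2"]) auto
    qed
    then have "S (pw N @ \<pi>) = S (P0 @ \<pi>)" using Suc by blast
    moreover have "replicate (Suc N) \<pi> = replicate N \<pi> @ [\<pi>]"
      by (simp add: replicate_append_same)
    then have "pw (Suc N) = pw N @ \<pi>" by (simp add: pw_def del: replicate_Suc)
    ultimately show ?case using S\<pi> by simp
  qed (simp add: pw_def)
  have pw_len: "N \<le> length (pw N)" for N
  proof -
    have "N \<le> N * length \<pi>" using \<pi>_ne by (cases \<pi>) auto
    also have "\<dots> \<le> length (pw N)" by (simp add: pw_def length_concat sum_list_replicate)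
    finally show ?thesis .
  qed
  have main: "P (P0 @ w @ g) y = P (P0 @ z @ g) y" if g: "g \<in> lists A" and y: "y \<in> lists B" for g y
  proof (rule ccontr)
    assume neq: "P (P0 @ w @ g) y \<noteq> P (P0 @ z @ g) y"
    have longer: "length P0 \<le> length y" using absorb[of y P0 g] neq y inA by linarith
    define v1 v2 where "v1 = take (length P0) y" and "v2 = drop (length P0) y"
    have vv: "y = v1 @ v2" "length v1 = length P0" "v1 \<in> lists B" "v2 \<in> lists B"
      using longer y by (auto simp: v1_def v2_def dest: in_set_takeD in_set_dropD)
    have "\<exists>v. v \<in> lists B \<and> P (pw N @ w @ g) (v @ v2) \<noteq> P (pw N @ z @ g) (v @ v2)" for N
    proof -
      have "residual P P0 v1 \<in> S (pw N)" unfolding pwS using vv by (auto simp: S_def)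
      then obtain v where v: "v \<in> lists B" "length v = length (pw N)" "residual P P0 v1 = residual P (pw N) v"
        by (auto simp: S_def)
      from residual_same[OF v(3)] vv(2) v(2) neq vv(1) v(1) show ?thesis by (intro exI[of _ v]) auto
    qed
    then obtain v where v: "\<And>N. v N \<in> lists B" "\<And>N. P (pw N @ w @ g) (v N @ v2) \<noteq> P (pw N @ z @ g) (v N @ v2)"
      by metis
    define row where "row x = {y \<in> lists B. P x y}" for x
    define f where "f N = (row (pw N @ w @ g), row (pw N @ z @ g))" for N
    have "pw N @ w @ g \<in> lists A" "pw N @ z @ g \<in> lists A" for N
      using pwA[of N] inA g by (simp_all only: append_in_lists_conv)
    then have "range f \<subseteq> row ` lists A \<times> row ` lists A"
      unfolding f_def by fast
    moreover have "finite (row ` lists A \<times> row ` lists A)"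
      using fin unfolding row_def by (rule finite_cartesian_product[OF _ fin])
    ultimately have "finite (range f)" by (rule finite_subset)
    from pigeonhole_infinite[OF infinite_UNIV_nat this] obtain N where
      inf: "infinite {M. f M = f N}" by auto
    then obtain M where M: "M \<ge> length (v N @ v2)" "f M = f N"
      unfolding finite_nat_set_iff_bounded_le by (metis mem_Collect_eq nat_le_linear)
    have "(v N @ v2) \<in> lists B" using v vv by auto
    then have "P (pw M @ w @ g) (v N @ v2) \<noteq> P (pw M @ z @ g) (v N @ v2)"
      using M(2) v(2)[of N] unfolding f_def row_def prod.inject by blast
    moreover have "length (v N @ v2) \<le> length (pw M)" using M(1) pw_len[of M] by linarith
    ultimately show False using absorb[OF _ pwA] v vv by auto
  qed
  show ?thesis
  proof
    show "P0 @ z @ rest \<in> lists A" using inA by auto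
    show "length (P0 @ z @ rest) < length x0"
      unfolding x0_eq using kl il by (auto simp: z_def w_def)
    show "P (x0 @ g) y = P ((P0 @ z @ rest) @ g) y" if "g \<in> lists A" "y \<in> lists B" for g y
      using main[of "rest @ g" y] that inA unfolding x0_eq by simp
  qed
qed

text \<open>From right to left, the prefix of length \<open>N\<close> of a longer word can be
  exchanged again and again, so every row is already the row of a word of length at most
  \<open>N\<close>. The other direction is the reduction lemma at the critical length.\<close>

lemma finite_rows_iff:
  assumes rbP: "few_residuals A B K P" and A: "finite A" and N: "N = 2 ^ K + 2 ^ (K * K)"
  shows "finite ((\<lambda>x. {y \<in> lists B. P x y}) ` lists A) \<longleftrightarrow>
    (\<forall>x0 \<in> lists A. length x0 = N \<longrightarrow> (\<exists>x1 \<in> lists A. length x1 < N \<and>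
       (\<forall>g \<in> lists A. \<forall>y \<in> lists B. P (x0 @ g) y = P (x1 @ g) y)))" (is "?L \<longleftrightarrow> ?R")
proof
  assume ?L
  show ?R
  proof (intro ballI impI)
    fix x0 assume "x0 \<in> lists A" "length x0 = N"
    then show "\<exists>x1 \<in> lists A. length x1 < N \<and>
       (\<forall>g \<in> lists A. \<forall>y \<in> lists B. P (x0 @ g) y = P (x1 @ g) y)"
      using few_residuals_reduce[OF rbP \<open>?L\<close>, of x0] N by (metis order_refl)
  qed
next
  assume R: ?R
  let ?row = "\<lambda>x. {y \<in> lists B. P x y}"
  have "?row x \<in> ?row ` {w \<in> lists A. length w \<le> N}" if "x \<in> lists A" for x
    using that
  proof (induction "length x" arbitrary: x rule: less_induct)
    case less
    show ?case
    proof (cases "length x \<le> N")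
      case False
      define x0 g where "x0 = take N x" and "g = drop N x"
      have x: "x = x0 @ g" "length x0 = N" "x0 \<in> lists A" "g \<in> lists A"
        using False less.prems by (auto simp: x0_def g_def dest: in_set_takeD in_set_dropD)
      from bspec[OF R x(3), THEN mp, OF x(2)]
      obtain x1 where x1: "x1 \<in> lists A" "length x1 < N"
        "\<forall>g \<in> lists A. \<forall>y \<in> lists B. P (x0 @ g) y = P (x1 @ g) y"
        by (elim bexE conjE)
      have "?row x = ?row (x1 @ g)" unfolding x(1)
        by (intro Collect_cong conj_cong refl bspec[OF bspec[OF x1(3) x(4)]])
      moreover have "?row (x1 @ g) \<in> ?row ` {w \<in> lists A. length w \<le> N}"
        by (rule less.hyps) (use x x1 in auto)
      ultimately show ?thesis by simp
    qed (use less in auto)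
  qed
  then have "?row ` lists A \<subseteq> ?row ` {w \<in> lists A. length w \<le> N}" by auto
  then show ?L using card_words_le(1)[OF A order_refl] by (meson finite_imageI finite_subset)
qed

section \<open>Regular languages via left quotients\<close>

definition left_quotient :: "'a list \<Rightarrow> 'a list set \<Rightarrow> 'a list set" where
  "left_quotient w L = {v. w @ v \<in> L}"

text \<open>The Myhill-Nerode criterion; with it closure properties become counting arguments
  instead of automata constructions. Over the infinite alphabet \<open>nat\<close> it is weaker than
  \<open>regular\<close>: the set of all words has a single quotient, but no automaton with finitely
  many transitions accepts it.\<close>

definition finite_quotients :: "'a list set \<Rightarrow> bool" where
  "finite_quotients L \<longleftrightarrow> finite (range (\<lambda>w. left_quotient w L))"

lemma finite_image_determined:
  assumes "\<And>a b. a \<in> X \<Longrightarrow> b \<in> X \<Longrightarrow> t a = t b \<Longrightarrow> f a = f b" "finite (t ` X)"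
  shows "finite (f ` X)"
  by (rule card_image_determined(1)[OF assms(1) order_refl assms(2)])

lemma left_quotient_append: "left_quotient (u @ v) L = left_quotient v (left_quotient u L)"
  by (simp add: left_quotient_def)

lemma steps_append: "steps tr p (u @ v) q \<longleftrightarrow> (\<exists>r. steps tr p u r \<and> steps tr r v q)"
proof (induction u arbitrary: p)
  case Nil
  then show ?case by (auto intro: steps_nil elim: steps.cases)
next
  case (Cons a u)
  have "steps tr p (a # w) q \<longleftrightarrow> (\<exists>p'. (p, a, p') \<in> set tr \<and> steps tr p' w q)" for w q
    by (auto intro: steps_cons elim: steps.cases)
  then show ?case using Cons by auto
qed

lemma steps_target: "steps tr p w q \<Longrightarrow> q = p \<or> q \<in> (snd \<circ> snd) ` set tr"
proof (induction rule: steps.induct)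
  case (steps_cons p a q' tr w q)
  then show ?case by force
qed simp

text \<open>A quotient is determined by the set of states reached, which consists of initial states
  and targets of transitions. The explicit cardinality later bounds the prefixes \<open>u\<close> to
  be tested.\<close>

lemma left_quotient_nfa_lang:
  fixes tr I F
  defines "L \<equiv> nfa_lang (tr, I, F)"
  shows "finite (range (\<lambda>w. left_quotient w L))" "card (range (\<lambda>w. left_quotient w L)) \<le> 2 ^ (length I + length tr)"
proof -
  define Q where "Q = set I \<union> (snd \<circ> snd) ` set tr"
  define reach where "reach w = {q. \<exists>p \<in> set I. steps tr p w q}" for w
  have fin: "finite Q" by (simp add: Q_def)
  have det: "left_quotient w L = left_quotient w' L" if "reach w = reach w'" for w w'
  proof -
    have "v \<in> left_quotient w L \<longleftrightarrow> (\<exists>q \<in> reach w. \<exists>f \<in> set F. steps tr q v f)" for w v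
      unfolding left_quotient_def L_def nfa_lang_def reach_def by (auto simp: steps_append)
    then show ?thesis using that by blast
  qed
  have "reach w \<subseteq> Q" for w unfolding reach_def Q_def using steps_target by fastforce
  then have sub: "reach ` UNIV \<subseteq> Pow Q" by auto
  have "card Q \<le> length I + length tr"
    unfolding Q_def
    by (rule order.trans[OF card_Un_le add_mono[OF card_length order.trans[OF card_image_le card_length]]]) simp
  then have "card (Pow Q) \<le> 2 ^ (length I + length tr)" using fin by (simp add: card_Pow)
  with card_image_determined[of UNIV reach "\<lambda>w. left_quotient w L", OF det sub] fin
  show "finite (range (\<lambda>w. left_quotient w L))" "card (range (\<lambda>w. left_quotient w L)) \<le> 2 ^ (length I + length tr)"
    by auto
qed

lemma regular_imp_finite_quotients: "regular L \<Longrightarrow> finite_quotients L"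
  unfolding regular_def finite_quotients_def using left_quotient_nfa_lang(1) by (metis prod_cases3)

text \<open>The automaton has the quotients as states, numbered by an injection \<open>f\<close>;
  its transition by \<open>a\<close> takes the quotient by \<open>a\<close>, and the quotients
  containing the empty word are final.\<close>

lemma finite_quotients_imp_regular:
  assumes fin: "finite_quotients L" and L: "L \<subseteq> lists C" and C: "finite C"
  shows "regular L"
proof -
  let ?D = "range (\<lambda>w. left_quotient w L)"
  obtain f :: "nat list set \<Rightarrow> nat" where f: "inj_on f ?D"
    using finite_imp_inj_to_nat_seg[OF fin[unfolded finite_quotients_def]] by blast
  have "finite ((\<lambda>(D, a). (f D, a, f (left_quotient [a] D))) ` (?D \<times> C))"
    by (intro finite_imageI finite_cartesian_product C fin[unfolded finite_quotients_def])
  from finite_list[OF this] obtain tr where tr: "set tr = (\<lambda>(D, a). (f D, a, f (left_quotient [a] D))) ` (?D \<times> C)" ..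
  obtain F where F: "set F = f ` {D \<in> ?D. [] \<in> D}"
    using finite_list[of "f ` {D \<in> ?D. [] \<in> D}"] fin by (auto simp: finite_quotients_def)
  have st: "steps tr (f (left_quotient u L)) w q \<longleftrightarrow> w \<in> lists C \<and> q = f (left_quotient (u @ w) L)" for u w q
  proof (induction w arbitrary: u)
    case Nil
    then show ?case by (auto intro: steps_nil elim: steps.cases)
  next
    case (Cons a w)
    have tr_iff: "(f (left_quotient u L), a, p) \<in> set tr \<longleftrightarrow> a \<in> C \<and> p = f (left_quotient (u @ [a]) L)" for p
    proof
      assume "(f (left_quotient u L), a, p) \<in> set tr"
      then obtain x where "f (left_quotient u L) = f (left_quotient x L)" "a \<in> C" "p = f (left_quotient [a] (left_quotient x L))"
        unfolding tr by auto
      moreover from this(1) have "left_quotient u L = left_quotient x L" using f by (simp add: inj_on_def)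
      ultimately show "a \<in> C \<and> p = f (left_quotient (u @ [a]) L)" by (simp add: left_quotient_append)
    next
      assume "a \<in> C \<and> p = f (left_quotient (u @ [a]) L)"
      then show "(f (left_quotient u L), a, p) \<in> set tr"
        unfolding tr by (intro image_eqI[of _ _ "(left_quotient u L, a)"]) (auto simp: left_quotient_append)
    qed
    have "steps tr (f (left_quotient u L)) (a # w) q \<longleftrightarrow> (\<exists>p. (f (left_quotient u L), a, p) \<in> set tr \<and> steps tr p w q)"
      by (auto intro: steps_cons elim: steps.cases)
    then show ?case using Cons[of "u @ [a]"] by (auto simp: tr_iff)
  qed
  have "w \<in> nfa_lang (tr, [f L], F) \<longleftrightarrow> w \<in> L" for w
  proof -
    have "w \<in> nfa_lang (tr, [f L], F) \<longleftrightarrow> w \<in> lists C \<and> f (left_quotient w L) \<in> set F"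
      using st[of "[]" w] by (auto simp: nfa_lang_def left_quotient_def)
    also have "f (left_quotient w L) \<in> set F \<longleftrightarrow> [] \<in> left_quotient w L"
      unfolding F using f by (auto simp: inj_on_def)
    finally show ?thesis using L by (auto simp: left_quotient_def)
  qed
  then have "L = nfa_lang (tr, [f L], F)" by blast
  then show ?thesis unfolding regular_def by blast
qed

lemma finite_quotientsI:
  assumes "L \<subseteq> lists C" "finite ((\<lambda>w. left_quotient w L) ` lists C)"
  shows "finite_quotients L"
proof -
  have "left_quotient w L \<in> insert {} ((\<lambda>w. left_quotient w L) ` lists C)" for w
    using assms(1) by (cases "w \<in> lists C") (auto simp: left_quotient_def)
  then have "range (\<lambda>w. left_quotient w L) \<subseteq> insert {} ((\<lambda>w. left_quotient w L) ` lists C)" by auto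
  then show ?thesis unfolding finite_quotients_def using assms(2) by (meson finite_insert finite_subset)
qed

lemma finite_quotients_UN:
  assumes "finite I" "\<And>i. i \<in> I \<Longrightarrow> finite_quotients (L i)"
  shows "finite_quotients (\<Union>i\<in>I. L i)"
  using assms
proof (induction I rule: finite_induct)
  case empty
  then show ?case by (simp add: finite_quotients_def left_quotient_def)
next
  case (insert i I)
  let ?M = "\<Union>i\<in>I. L i"
  have eq: "left_quotient w (\<Union>i\<in>insert i I. L i) = (\<lambda>(X, Y). X \<union> Y) (left_quotient w (L i), left_quotient w ?M)" for w
    by (auto simp: left_quotient_def)
  have "range (\<lambda>w. left_quotient w (\<Union>i\<in>insert i I. L i))
     \<subseteq> (\<lambda>(X, Y). X \<union> Y) ` (range (\<lambda>w. left_quotient w (L i)) \<times> range (\<lambda>w. left_quotient w ?M))"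
    unfolding eq by blast
  moreover have "finite (range (\<lambda>w. left_quotient w (L i)) \<times> range (\<lambda>w. left_quotient w ?M))"
    using insert by (auto simp: finite_quotients_def)
  ultimately show ?case unfolding finite_quotients_def by (meson finite_imageI finite_subset)
qed

definition conc :: "'a list set \<Rightarrow> 'a list set \<Rightarrow> 'a list set" where
  "conc K L = {u @ v |u v. u \<in> K \<and> v \<in> L}"

text \<open>After reading \<open>w\<close>, either the word of \<open>K\<close> is still unfinished,
  or it was a prefix of \<open>w\<close> and the remaining suffix has been read in \<open>L\<close>.
  So the quotient of \<open>K\<close> and a set of quotients of \<open>L\<close> determine the
  result.\<close>

lemma finite_quotients_conc:
  assumes "finite_quotients K" "finite_quotients L"
  shows "finite_quotients (conc K L)"
proof -
  let ?t = "\<lambda>w. (left_quotient w K, {left_quotient z L |y z. w = y @ z \<and> y \<in> K})"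
  let ?Y = "range (\<lambda>w. left_quotient w K) \<times> Pow (range (\<lambda>w. left_quotient w L))"
  have eq: "left_quotient w (conc K L) = conc (left_quotient w K) L \<union> \<Union>{left_quotient z L |y z. w = y @ z \<and> y \<in> K}" for w
  proof (intro set_eqI iffI)
    fix v assume "v \<in> left_quotient w (conc K L)"
    then obtain a b where ab: "w @ v = a @ b" "a \<in> K" "b \<in> L" by (auto simp: left_quotient_def conc_def)
    from ab(1) obtain us where "w = a @ us \<and> us @ v = b \<or> w @ us = a \<and> v = us @ b"
      by (auto simp: append_eq_append_conv2)
    then show "v \<in> conc (left_quotient w K) L \<union> \<Union>{left_quotient z L |y z. w = y @ z \<and> y \<in> K}"
    proof
      assume "w = a @ us \<and> us @ v = b"
      then have "v \<in> left_quotient us L" "w = a @ us" using ab(3) by (auto simp: left_quotient_def)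
      then show ?thesis using ab(2) by blast
    next
      assume "w @ us = a \<and> v = us @ b"
      then have "us \<in> left_quotient w K" "v = us @ b" using ab(2) by (auto simp: left_quotient_def)
      then show ?thesis using ab(3) by (auto simp: conc_def)
    qed
  next
    fix v assume "v \<in> conc (left_quotient w K) L \<union> \<Union>{left_quotient z L |y z. w = y @ z \<and> y \<in> K}"
    then show "v \<in> left_quotient w (conc K L)"
      by (auto simp: left_quotient_def conc_def) (metis append.assoc, blast)
  qed
  have fin: "finite ?Y" using assms by (simp add: finite_quotients_def)
  have sub: "range ?t \<subseteq> ?Y" by auto
  show ?thesis unfolding finite_quotients_def
  proof (rule finite_image_determined[of UNIV ?t])
    show "left_quotient w (conc K L) = left_quotient w' (conc K L)" if "?t w = ?t w'" for w w'
      using that unfolding eq prod.inject by argo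
    show "finite (range ?t)" by (rule finite_subset[OF sub fin])
  qed
qed

text \<open>Translates words over pairs into alternating words. For words over pairs, the prefix
  closedness required of \<open>U\<close> is ordinary closedness under prefixes.\<close>

definition flat :: "('a \<times> 'a) list \<Rightarrow> 'a list" where
  "flat ps = concat (map (\<lambda>(a, b). [a, b]) ps)"

lemma flat_simps[simp]: "flat [] = []" "flat (p # ps) = fst p # snd p # flat ps" "flat (ps @ qs) = flat ps @ flat qs"
  by (auto simp: flat_def split: prod.splits)

lemma flat_inj: "flat ps = flat qs \<Longrightarrow> ps = qs"
proof (induction ps arbitrary: qs)
  case Nil
  then show ?case by (cases qs) auto
next
  case (Cons p ps)
  then show ?case by (cases qs) (auto simp: prod_eq_iff)
qed

lemma flat_in_lists: "ps \<in> lists (A \<times> B) \<Longrightarrow> flat ps \<in> lists (A \<union> B)"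
  by (induction ps) auto

lemma flat_eq_append:
  assumes "flat ps = w @ v"
  shows "(\<exists>ps1 ps2. ps = ps1 @ ps2 \<and> w = flat ps1 \<and> v = flat ps2) \<or>
    (\<exists>ps1 p ps2. ps = ps1 @ p # ps2 \<and> w = flat ps1 @ [fst p] \<and> v = snd p # flat ps2)"
  using assms
proof (induction ps arbitrary: w)
  case (Cons p ps)
  show ?case
  proof (cases w)
    case Nil
    then show ?thesis using Cons.prems by (intro disjI1 exI[of _ "[]"] exI[of _ "p # ps"]) auto
  next
    case (Cons a w')
    show ?thesis
    proof (cases w')
      case Nil
      then show ?thesis using Cons.prems Cons by (intro disjI2 exI[of _ "[]"] exI[of _ p] exI[of _ ps]) auto
    next
      case (Cons b w'')
      then have "flat ps = w'' @ v" using Cons.prems \<open>w = a # w'\<close> by auto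
      from Cons.IH[OF this] show ?thesis
      proof (elim disjE exE conjE)
        fix ps1 ps2 assume "ps = ps1 @ ps2" "w'' = flat ps1" "v = flat ps2"
        then show ?thesis using Cons.prems Cons \<open>w = a # w'\<close>
          by (intro disjI1 exI[of _ "p # ps1"] exI[of _ ps2]) auto
      next
        fix ps1 q ps2 assume "ps = ps1 @ q # ps2" "w'' = flat ps1 @ [fst q]" "v = snd q # flat ps2"
        then show ?thesis using Cons.prems Cons \<open>w = a # w'\<close>
          by (intro disjI2 exI[of _ "p # ps1"] exI[of _ q] exI[of _ ps2]) auto
      qed
    qed
  qed
qed simp

text \<open>After an even number of letters a quotient is the flattening of a quotient of
  \<open>V\<close>. After an odd number the pending first letter \<open>a\<close> of a pair must be
  remembered as well, which \<open>?odd\<close> does; finiteness of \<open>A\<close> bounds these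
  cases.\<close>

lemma finite_quotients_flat:
  assumes V: "finite_quotients V" "V \<subseteq> lists (A \<times> B)" and A: "finite A"
  shows "finite_quotients (flat ` V)"
proof -
  let ?D = "range (\<lambda>w. left_quotient w V)"
  let ?odd = "\<lambda>(D, a). {b # flat w |b w. (a, b) # w \<in> D}"
  have "left_quotient z (flat ` V) \<in> insert {} ((`) flat ` ?D \<union> ?odd ` (?D \<times> A))" for z
  proof (cases "left_quotient z (flat ` V) = {}")
    case False
    then obtain v where "z @ v \<in> flat ` V" by (auto simp: left_quotient_def)
    then obtain ps where "ps \<in> V" "flat ps = z @ v" by fastforce
    from flat_eq_append[OF this(2)] show ?thesis
    proof (elim disjE exE conjE)
      fix ps1 ps2 assume z: "z = flat ps1"
      have "left_quotient z (flat ` V) = flat ` left_quotient ps1 V"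
      proof (intro set_eqI iffI)
        fix v assume "v \<in> left_quotient z (flat ` V)"
        then obtain qs where qs: "qs \<in> V" "flat qs = z @ v" unfolding left_quotient_def by fastforce
        from flat_eq_append[OF qs(2)] show "v \<in> flat ` left_quotient ps1 V"
        proof (elim disjE exE conjE)
          fix qs1 qs2 assume "qs = qs1 @ qs2" "z = flat qs1" "v = flat qs2"
          then show ?thesis using qs z by (auto simp: left_quotient_def dest: flat_inj)
        next
          fix qs1 p qs2 assume "z = flat qs1 @ [fst p]"
          moreover have "even (length (flat ps))" for ps :: "('a \<times> 'a) list" by (induction ps) auto
          ultimately have False using z by (metis even_Suc length_append_singleton)
          then show ?thesis ..
        qed
      qed (auto simp: left_quotient_def z image_iff intro!: bexI)
      then show ?thesis by auto
    next
      fix ps1 p ps2 assume z: "z = flat ps1 @ [fst p]" and ps: "ps = ps1 @ p # ps2"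
      have "left_quotient z (flat ` V) = ?odd (left_quotient ps1 V, fst p)"
      proof (intro set_eqI iffI)
        fix v assume "v \<in> left_quotient z (flat ` V)"
        then obtain qs where qs: "qs \<in> V" "flat qs = z @ v" unfolding left_quotient_def by fastforce
        from flat_eq_append[OF qs(2)] show "v \<in> ?odd (left_quotient ps1 V, fst p)"
        proof (elim disjE exE conjE)
          fix qs1 qs2 assume "z = flat qs1"
          moreover have "even (length (flat ps))" for ps :: "('a \<times> 'a) list" by (induction ps) auto
          ultimately have False using z by (metis even_Suc length_append_singleton)
          then show ?thesis ..
        next
          fix qs1 q qs2 assume q: "qs = qs1 @ q # qs2" "z = flat qs1 @ [fst q]" "v = snd q # flat qs2"
          then have "qs1 = ps1" "fst q = fst p" using z by (auto dest: flat_inj)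
          then show ?thesis using q qs by (auto simp: left_quotient_def) (metis prod.collapse)
        qed
      next
        fix v assume "v \<in> ?odd (left_quotient ps1 V, fst p)"
        then obtain b w where bw: "v = b # flat w" "ps1 @ (fst p, b) # w \<in> V" by (auto simp: left_quotient_def)
        then have "flat (ps1 @ (fst p, b) # w) = z @ v" by (simp add: z)
        then show "v \<in> left_quotient z (flat ` V)" using bw
          unfolding left_quotient_def by (intro CollectI image_eqI[of _ _ "ps1 @ (fst p, b) # w"]) auto
      qed
      moreover have "ps1 @ p # ps2 \<in> lists (A \<times> B)" using V(2) \<open>ps \<in> V\<close> ps by blast
      then have "fst p \<in> A" by auto
      ultimately show ?thesis by (intro insertI2 UnI2 image_eqI[OF _ SigmaI[OF rangeI]])
    qed
  qed simp
  then have "range (\<lambda>z. left_quotient z (flat ` V)) \<subseteq> insert {} ((`) flat ` ?D \<union> ?odd ` (?D \<times> A))"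
    by (rule image_subsetI)
  moreover have "finite \<dots>"
    by (intro finite.insertI finite_UnI finite_imageI finite_cartesian_product A V(1)[unfolded finite_quotients_def])
  ultimately show ?thesis unfolding finite_quotients_def by (rule finite_subset)
qed

section \<open>Characterisation of the relations synchronised by a target language\<close>

text \<open>The reduction is repeated until the word is short. As all right contexts
  \<open>g\<close> are covered, equivalence with a short word survives further reading.\<close>

lemma few_residuals_right_congruence:
  assumes rbP: "few_residuals A B K P" and fin: "finite ((\<lambda>x. {y \<in> lists B. P x y}) ` lists A)"
  shows "z \<in> lists A \<Longrightarrow> \<exists>z' \<in> lists A. length z' \<le> 2 ^ K + 2 ^ (K * K) \<and>
    (\<forall>g \<in> lists A. \<forall>y \<in> lists B. P (z @ g) y = P (z' @ g) y)"
proof (induction "length z" arbitrary: z rule: less_induct)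
  case less
  show ?case
  proof (cases "length z \<le> 2 ^ K + 2 ^ (K * K)")
    case False
    then have "2 ^ K + 2 ^ (K * K) \<le> length z" by simp
    from few_residuals_reduce[OF rbP fin less.prems this] obtain z1 where
      z1: "z1 \<in> lists A" "length z1 < length z"
      "\<And>g y. g \<in> lists A \<Longrightarrow> y \<in> lists B \<Longrightarrow> P (z @ g) y = P (z1 @ g) y" by metis
    from less.hyps[OF z1(2,1)] z1(3) show ?thesis by metis
  qed (use less.prems in blast)
qed

section \<open>Regularity of rows and of row classes\<close>

lemma finite_quotients_row:
  assumes rbP: "few_residuals A B K P" and B: "finite B" and v: "v \<in> lists A"
  shows "finite_quotients {y \<in> lists B. P v y}" (is "finite_quotients ?L")
proof (rule finite_quotientsI)
  let ?f = "\<lambda>z. left_quotient z ?L"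
  let ?long = "{z \<in> lists B. length v \<le> length z}"
  have "finite (?f ` ?long)"
  proof (rule finite_image_determined[of _ "residual P v"])
    fix z z' assume "z \<in> ?long" "z' \<in> ?long" "residual P v z = residual P v z'"
    then show "?f z = ?f z'" using residual_right[of P v z v z'] by (auto simp: left_quotient_def)
  next
    have "residual P v ` ?long \<subseteq> residuals A B P" using residual_in_residuals[OF v, where P=P and B=B] by blast
    then show "finite (residual P v ` ?long)" using rbP unfolding few_residuals_def by (meson finite_subset)
  qed
  moreover have "finite (?f ` {z \<in> lists B. length z \<le> length v})"
    by (intro finite_imageI card_words_le(1)[OF B order_refl])
  ultimately have "finite (?f ` ?long \<union> ?f ` {z \<in> lists B. length z \<le> length v})" by simp
  moreover have "lists B = ?long \<union> {z \<in> lists B. length z \<le> length v}"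
    using nat_le_linear by blast
  ultimately show "finite (?f ` lists B)" by (metis image_Un)
qed auto

text \<open>Every word has the same rows after all right extensions as some word of bounded length,
  so a bounded set of representatives produces all quotients.\<close>

lemma finite_quotients_row_class:
  assumes rbP: "few_residuals A B K P" and A: "finite A"
    and fin: "finite ((\<lambda>x. {y \<in> lists B. P x y}) ` lists A)"
  shows "finite_quotients {v \<in> lists A. {y \<in> lists B. P v y} = Y}" (is "finite_quotients ?L")
proof (rule finite_quotientsI)
  have "left_quotient z ?L \<in> (\<lambda>z. left_quotient z ?L) ` {z \<in> lists A. length z \<le> 2 ^ K + 2 ^ (K * K)}" if z: "z \<in> lists A" for z
  proof -
    from few_residuals_right_congruence[OF rbP fin z] obtain z' where z': "z' \<in> lists A" "length z' \<le> 2 ^ K + 2 ^ (K * K)"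
      and eq: "\<And>g y. g \<in> lists A \<Longrightarrow> y \<in> lists B \<Longrightarrow> P (z @ g) y = P (z' @ g) y" by metis
    have "left_quotient z ?L = left_quotient z' ?L"
    proof (rule Set.set_eqI)
      fix w
      show "w \<in> left_quotient z ?L \<longleftrightarrow> w \<in> left_quotient z' ?L"
      proof (cases "w \<in> lists A")
        case True
        then have "{y \<in> lists B. P (z @ w) y} = {y \<in> lists B. P (z' @ w) y}" using eq by blast
        then show ?thesis using True z z' by (simp add: left_quotient_def)
      qed (simp add: left_quotient_def)
    qed
    then show ?thesis using z' by blast
  qed
  then have "(\<lambda>z. left_quotient z ?L) ` lists A \<subseteq> (\<lambda>z. left_quotient z ?L) ` {z \<in> lists A. length z \<le> 2 ^ K + 2 ^ (K * K)}"
    by (rule image_subsetI)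
  then show "finite ((\<lambda>z. left_quotient z ?L) ` lists A)"
    by (rule finite_subset) (intro finite_imageI card_words_le(1)[OF A order_refl])
qed auto

lemma sem_append: "sem A B (u @ v) = (fst (sem A B u) @ fst (sem A B v), snd (sem A B u) @ snd (sem A B v))"
  by (simp add: sem_def)

lemma sem_flat:
  "A \<inter> B = {} \<Longrightarrow> ps \<in> lists (A \<times> B) \<Longrightarrow> sem A B (flat ps) = (map fst ps, map snd ps)"
  by (induction ps) (auto simp: sem_def)

lemma sem_left: "A \<inter> B = {} \<Longrightarrow> v \<in> lists A \<Longrightarrow> sem A B v = (v, [])"
  by (auto simp: sem_def filter_id_conv filter_empty_conv)

lemma sem_right: "A \<inter> B = {} \<Longrightarrow> v \<in> lists B \<Longrightarrow> sem A B v = ([], v)"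
  by (auto simp: sem_def filter_id_conv filter_empty_conv)

text \<open>\<open>V\<close> is the set \<open>U\<close> written over pairs of letters;
  \<open>R\<close> is an arbitrary relation known only through its number of residuals.\<close>

locale sync_target =
  fixes A B :: "nat set" and V :: "(nat \<times> nat) list set"
    and R :: "nat list \<Rightarrow> nat list \<Rightarrow> bool" and K :: nat
  assumes finA: "finite A" and finB: "finite B" and disj: "A \<inter> B = {}"
    and V_lists: "V \<subseteq> lists (A \<times> B)" and V_closed: "us @ [p] \<in> V \<Longrightarrow> us \<in> V"
    and R_lists: "R x y \<Longrightarrow> x \<in> lists A \<and> y \<in> lists B"
    and rbR: "few_residuals A B K R" and finite_quotients_V: "finite_quotients V"
begin

text \<open>The relation called \<open>R\<close> indexed by \<open>u\<close> in the overview. As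
  \<open>V\<close> is prefix closed, it is enough to forbid that the next pair of letters extends
  \<open>u\<close> within \<open>V\<close>; then no longer common prefix lies in
  \<open>V\<close>.\<close>

definition rest_rel :: "(nat \<times> nat) list \<Rightarrow> nat list \<Rightarrow> nat list \<Rightarrow> bool" where
  "rest_rel u x y \<longleftrightarrow> R (map fst u @ x) (map snd u @ y) \<and> \<not> (x \<noteq> [] \<and> y \<noteq> [] \<and> u @ [(hd x, hd y)] \<in> V)"

definition T :: "nat list set" where
  "T = {flat u @ v @ x |u v x. u \<in> V \<and> v \<in> lists A \<and> x \<in> lists B}"

definition row :: "(nat \<times> nat) list \<Rightarrow> nat list \<Rightarrow> nat list set" where
  "row u x = {y \<in> lists B. rest_rel u x y}"

text \<open>The kernel is a right congruence of finite index on pair words. It determines membership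
  in \<open>V\<close> and the relation \<open>rest_rel u\<close>, so it captures all dependence on
  \<open>u\<close>.\<close>

definition \<kappa> :: "(nat \<times> nat) list \<Rightarrow> (nat list \<times> nat list) set \<times> (nat \<times> nat) list set" where
  "\<kappa> u = (residual R (map fst u) (map snd u), left_quotient u V)"

lemma pair_lists: "u \<in> lists (A \<times> B) \<Longrightarrow> map fst u \<in> lists A \<and> map snd u \<in> lists B"
  by (induction u) auto

lemma V_prefix: "us @ vs \<in> V \<Longrightarrow> us \<in> V"
proof (induction vs rule: rev_induct)
  case (snoc p vs)
  then show ?case using V_closed[of "us @ vs" p] by simp
qed simp

lemma rest_rel_lists: "u \<in> lists (A \<times> B) \<Longrightarrow> rest_rel u x y \<Longrightarrow> x \<in> lists A \<and> y \<in> lists B"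
  unfolding rest_rel_def using R_lists by fastforce

lemma few_residuals_rest_rel: "u \<in> lists (A \<times> B) \<Longrightarrow> few_residuals A B (K + 2) (rest_rel u)"
  using few_residuals_restrict[OF few_residuals_residual[OF rbR], of "map fst u" "map snd u" "\<lambda>a b. u @ [(a, b)] \<in> V"]
    pair_lists[of u] unfolding rest_rel_def[abs_def] by simp

lemma \<kappa>_rest_rel: assumes "\<kappa> u = \<kappa> u'" shows "rest_rel u = rest_rel u'"
proof (intro ext)
  fix x y
  have "R (map fst u @ x) (map snd u @ y) = R (map fst u' @ x) (map snd u' @ y)"
    by (rule residual_same) (use assms in \<open>auto simp: \<kappa>_def\<close>)
  moreover have "p \<in> left_quotient u V \<longleftrightarrow> p \<in> left_quotient u' V" for p using assms by (simp add: \<kappa>_def)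
  then have "u @ [p] \<in> V \<longleftrightarrow> u' @ [p] \<in> V" for p by (simp add: left_quotient_def)
  ultimately show "rest_rel u x y = rest_rel u' x y" by (simp add: rest_rel_def)
qed

lemma \<kappa>_append: assumes "\<kappa> u = \<kappa> u'" shows "\<kappa> (u @ w) = \<kappa> (u' @ w)"
proof -
  have "R (map fst u @ x) (map snd u @ y) = R (map fst u' @ x) (map snd u' @ y)" for x y
    by (rule residual_same) (use assms in \<open>auto simp: \<kappa>_def\<close>)
  then have "residual R (map fst (u @ w)) (map snd (u @ w)) = residual R (map fst (u' @ w)) (map snd (u' @ w))"
    by (simp add: residual_def)
  then show ?thesis using assms by (simp add: \<kappa>_def left_quotient_append)
qed

lemma finite_\<kappa>: "finite (\<kappa> ` lists (A \<times> B))"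
proof (rule finite_subset)
  show "\<kappa> ` lists (A \<times> B) \<subseteq> residuals A B R \<times> range (\<lambda>u. left_quotient u V)"
    unfolding \<kappa>_def using pair_lists by (intro image_subsetI SigmaI residual_in_residuals rangeI) blast+
  show "finite (residuals A B R \<times> range (\<lambda>u. left_quotient u V))"
    using rbR finite_quotients_V by (simp add: few_residuals_def finite_quotients_def)
qed

lemma \<kappa>_V: "\<kappa> u = \<kappa> u' \<Longrightarrow> u \<in> V \<longleftrightarrow> u' \<in> V"
proof -
  assume "\<kappa> u = \<kappa> u'"
  then have "[] \<in> left_quotient u V \<longleftrightarrow> [] \<in> left_quotient u' V" by (simp add: \<kappa>_def)
  then show ?thesis by (simp add: left_quotient_def)
qed

lemma finite_quotients_\<kappa>_class: "finite_quotients {u \<in> V. \<kappa> u = c}" (is "finite_quotients ?L")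
proof (rule finite_quotientsI)
  show "?L \<subseteq> lists (A \<times> B)" using V_lists by blast
  show "finite ((\<lambda>w. left_quotient w ?L) ` lists (A \<times> B))"
  proof (rule finite_image_determined[OF _ finite_\<kappa>])
    fix p p' assume "\<kappa> p = \<kappa> p'"
    then show "left_quotient p ?L = left_quotient p' ?L"
      using \<kappa>_append[of p p'] \<kappa>_V[of "p @ _" "p' @ _"] by (auto simp: left_quotient_def)
  qed
qed

text \<open>One product piece of \<open>T'\<close>: \<open>u\<close> and \<open>v\<close> range over
  their classes, independently of each other and of the second component in the common row. A block
  depends only on \<open>\<kappa> u\<close> and \<open>row u v\<close>, which makes the union
  finite.\<close>

definition block :: "(nat \<times> nat) list \<times> nat list \<Rightarrow> nat list set" where
  "block = (\<lambda>(u, v). conc (flat ` {u' \<in> V. \<kappa> u' = \<kappa> u})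
     (conc {v' \<in> lists A. row u v' = row u v} (row u v)))"

definition T' :: "nat list set" where
  "T' = {flat u @ v @ x |u v x. u \<in> V \<and> v \<in> lists A \<and> x \<in> lists B \<and> rest_rel u v x}"

lemma T'_eq: "T' = \<Union> (block ` (V \<times> lists A))"
proof (intro equalityI subsetI)
  fix w assume "w \<in> T'"
  then obtain u v x where "w = flat u @ v @ x" "u \<in> V" "v \<in> lists A" "x \<in> row u v"
    by (auto simp: T'_def row_def)
  then have "w \<in> block (u, v)" "(u, v) \<in> V \<times> lists A" by (auto simp: block_def conc_def)
  then show "w \<in> \<Union> (block ` (V \<times> lists A))" by blast
next
  fix w assume "w \<in> \<Union> (block ` (V \<times> lists A))"
  then obtain u v where "w \<in> block (u, v)" by auto
  then obtain u' v' x where w: "w = flat u' @ v' @ x" "u' \<in> V" "\<kappa> u' = \<kappa> u"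
     "v' \<in> lists A" "row u v' = row u v" "x \<in> row u v"
    unfolding block_def conc_def by auto
  then have "x \<in> row u' v'" using \<kappa>_rest_rel[of u' u] by (auto simp: row_def)
  then show "w \<in> T'" using w unfolding T'_def row_def by blast
qed

text \<open>Finitely many classes of \<open>\<kappa>\<close> with finitely many rows each leave
  finitely many blocks, and each block is a concatenation of three languages with finitely many
  quotients.\<close>

lemma regular_T':
  assumes fin: "\<And>u. u \<in> V \<Longrightarrow> finite (row u ` lists A)"
  shows "regular T'"
proof -
  let ?t = "\<lambda>(u, v). (\<kappa> u, row u v)"
  have "finite (block ` (V \<times> lists A))"
  proof (rule finite_image_determined[of _ ?t])
    fix a b assume "?t a = ?t b"
    moreover obtain u v u' v' where ab: "a = (u, v)" "b = (u', v')" by (metis surj_pair)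
    ultimately have eq: "\<kappa> u = \<kappa> u'" "row u v = row u' v'" by auto
    have "row u = row u'" using \<kappa>_rest_rel[OF eq(1)] by (simp add: row_def fun_eq_iff)
    then show "block a = block b" using eq by (simp add: block_def ab)
  next
    let ?S = "\<lambda>u. {\<kappa> u} \<times> row u ` lists A"
    have "\<kappa> ` V \<subseteq> \<kappa> ` lists (A \<times> B)" using V_lists by (rule image_mono)
    then have "finite (\<kappa> ` V)" using finite_\<kappa> by (rule finite_subset)
    then have "finite (?S ` V)"
    proof (rule finite_image_determined[of V \<kappa> ?S, rotated])
      fix u u' assume "\<kappa> u = \<kappa> u'"
      then have "row u = row u'" using \<kappa>_rest_rel[OF \<open>\<kappa> u = \<kappa> u'\<close>] by (simp add: row_def fun_eq_iff)
      then show "?S u = ?S u'" using \<open>\<kappa> u = \<kappa> u'\<close> by simp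
    qed
    moreover have "finite (?S u)" if "u \<in> V" for u using fin[OF that] by simp
    ultimately have "finite (\<Union> (?S ` V))" by (intro finite_Union) blast+
    moreover have "?t ` (V \<times> lists A) \<subseteq> \<Union> (?S ` V)"
    proof (rule image_subsetI)
      fix p assume "p \<in> V \<times> lists A"
      then obtain u v where "p = (u, v)" "u \<in> V" "v \<in> lists A" by (rule SigmaE)
      then show "?t p \<in> \<Union> (?S ` V)" by (intro UnionI[OF imageI[of u]]) simp_all
    qed
    ultimately show "finite (?t ` (V \<times> lists A))" by (rule finite_subset[rotated])
  qed
  moreover have "finite_quotients (block p)" if p: "p \<in> V \<times> lists A" for p
  proof -
    obtain u v where uv: "p = (u, v)" "u \<in> V" "v \<in> lists A" using p by blast
    have u: "u \<in> lists (A \<times> B)" using uv V_lists by blast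
    have f: "finite ((\<lambda>x. {y \<in> lists B. rest_rel u x y}) ` lists A)" using fin[OF uv(2)] by (simp add: row_def[abs_def])
    have 1: "{u' \<in> V. \<kappa> u' = \<kappa> u} \<subseteq> lists (A \<times> B)" using V_lists by blast
    show ?thesis unfolding uv(1) block_def prod.case row_def
      by (rule finite_quotients_conc[OF finite_quotients_flat[OF finite_quotients_\<kappa>_class 1 finA] finite_quotients_conc[OF
          finite_quotients_row_class[OF few_residuals_rest_rel[OF u] finA f] finite_quotients_row[OF few_residuals_rest_rel[OF u] finB uv(3)]]])
  qed
  ultimately have "finite_quotients (\<Union>L \<in> block ` (V \<times> lists A). L)"
    by (intro finite_quotients_UN) auto
  then have "finite_quotients T'" by (simp add: T'_eq)
  moreover have "T' \<subseteq> lists (A \<union> B)"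
  proof
    fix w assume "w \<in> T'"
    then obtain u v x where w: "w = flat u @ v @ x" "u \<in> V" "v \<in> lists A" "x \<in> lists B"
      by (auto simp: T'_def)
    have "u \<in> lists (A \<times> B)" using w(2) V_lists by blast
    then have "flat u \<in> lists (A \<union> B)" by (rule flat_in_lists)
    moreover have "v \<in> lists (A \<union> B)" "x \<in> lists (A \<union> B)"
      using w(3,4) lists_mono[of A "A \<union> B"] lists_mono[of B "A \<union> B"] by blast+
    ultimately show "w \<in> lists (A \<union> B)" unfolding w(1) by (simp only: append_in_lists_conv)
  qed
  ultimately show ?thesis by (rule finite_quotients_imp_regular) (simp add: finA finB)
qed

lemma sem_word:
  "u \<in> V \<Longrightarrow> v \<in> lists A \<Longrightarrow> x \<in> lists B \<Longrightarrow>
    sem A B (flat u @ v @ x) = (map fst u @ v, map snd u @ x)"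
proof -
  assume u: "u \<in> V" and v: "v \<in> lists A" and x: "x \<in> lists B"
  have "u \<in> lists (A \<times> B)" using u V_lists by blast
  then show ?thesis
    by (simp only: sem_append sem_flat[OF disj] sem_left[OF disj v] sem_right[OF disj x] fst_conv snd_conv append_Nil append_Nil2)
qed

lemma sem_T':
  assumes "(\<exists>x y. R x y) \<longrightarrow> V \<noteq> {}"
  shows "sem A B ` T' = {(x, y). R x y}"
proof (intro equalityI subsetI)
  fix p assume "p \<in> sem A B ` T'"
  then obtain u v x where w: "p = sem A B (flat u @ v @ x)" "u \<in> V" "v \<in> lists A" "x \<in> lists B" "rest_rel u v x"
    unfolding T'_def by blast
  then show "p \<in> {(x, y). R x y}" using sem_word[OF w(2-4)] by (simp add: rest_rel_def)
next
  fix p assume "p \<in> {(x, y). R x y}"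
  then obtain x y where p: "p = (x, y)" and R: "R x y" by auto
  let ?P = "\<lambda>n. \<exists>u x' y'. u \<in> V \<and> x = map fst u @ x' \<and> y = map snd u @ y' \<and> length u = n"
  obtain u0 where "u0 \<in> V" using assms R by blast
  then have "[] \<in> V" using V_prefix[of "[]" u0] by simp
  then have P0: "?P 0" by auto
  \<comment> \<open>A common prefix is no longer than \<open>x\<close>, so a longest one in
    \<open>V\<close> exists; \<open>[] \<in> V\<close> provides a start.\<close>
  have "m \<le> length x" if "?P m" for m using that by auto
  then have "?P (Greatest ?P)" "?P m \<Longrightarrow> m \<le> Greatest ?P" for m
    using GreatestI_nat[of ?P 0 "length x"] Greatest_le_nat[of ?P m "length x"] P0 by blast+
  then have "\<exists>n. ?P n \<and> (\<forall>m. ?P m \<longrightarrow> m \<le> n)" by blast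
  then obtain u x' y' where u: "u \<in> V" "x = map fst u @ x'" "y = map snd u @ y'"
    and max: "\<And>m. ?P m \<Longrightarrow> m \<le> length u" by blast
  have "\<not> (x' \<noteq> [] \<and> y' \<noteq> [] \<and> u @ [(hd x', hd y')] \<in> V)"
  proof
    assume *: "x' \<noteq> [] \<and> y' \<noteq> [] \<and> u @ [(hd x', hd y')] \<in> V"
    then have "?P (Suc (length u))"
      by (intro exI[of _ "u @ [(hd x', hd y')]"] exI[of _ "tl x'"] exI[of _ "tl y'"]) (simp add: u)
    then show False using max by fastforce
  qed
  then have rest_rel: "rest_rel u x' y'" using R u by (simp add: rest_rel_def)
  have "u \<in> lists (A \<times> B)" using u V_lists by blast
  from rest_rel_lists[OF this rest_rel] have "flat u @ x' @ y' \<in> T'" "sem A B (flat u @ x' @ y') = p"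
    using u rest_rel by (auto simp: T'_def sem_word p simp del: in_lists_conv_set)
  then show "p \<in> sem A B ` T'" by force
qed

text \<open>By maximality of \<open>u\<close>, a word of \<open>W\<close> for such a pair spends
  some prefix \<open>take k u\<close> on its alternating part and writes the rest of
  \<open>u\<close> in the two sorted parts. Hence membership of \<open>y\<close> in a row is a
  condition on \<open>Suc (length u)\<close> quotients of \<open>W\<close>.\<close>

lemma finite_rows_if_Rel:
  assumes W: "W \<subseteq> T" "regular W" "sem A B ` W = {(x, y). R x y}" and u: "u \<in> V"
  shows "finite (row u ` lists A)"
proof -
  define cut where "cut x k = left_quotient (flat (take k u) @ (map fst (drop k u) @ x) @ map snd (drop k u)) W" for x k
  \<comment> \<open>The first letter of \<open>x\<close> is recorded because \<open>rest_rel\<close>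
    tests whether the next pair stays in \<open>V\<close>.\<close>
  define t where "t x = (if x = [] then None else Some (hd x), map (cut x) [0..<Suc (length u)])" for x
  have ul: "u \<in> lists (A \<times> B)" using u V_lists by blast
  have char: "R (map fst u @ x) (map snd u @ y) \<longleftrightarrow> (\<exists>k \<le> length u. y \<in> cut x k)"
    if x: "x \<in> lists A" and y: "y \<in> lists B" and max: "\<not> (x \<noteq> [] \<and> y \<noteq> [] \<and> u @ [(hd x, hd y)] \<in> V)" for x y
  proof
    assume "R (map fst u @ x) (map snd u @ y)"
    then have "(map fst u @ x, map snd u @ y) \<in> sem A B ` W" unfolding W(3) by simp
    then obtain w where w: "w \<in> W" "sem A B w = (map fst u @ x, map snd u @ y)" by auto
    then obtain u' v z where w_eq: "w = flat u' @ v @ z" and u': "u' \<in> V" and v: "v \<in> lists A" and z: "z \<in> lists B"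
      using W(1) unfolding T_def by blast
    have eqs: "map fst u' @ v = map fst u @ x" "map snd u' @ z = map snd u @ y"
      using w(2) unfolding w_eq sem_word[OF u' v z] by auto
    have len: "length u' \<le> length u"
    proof (rule ccontr)
      assume "\<not> length u' \<le> length u"
      then have lt: "length u < length u'" by simp
      define n where "n = length u"
      have f: "map fst (take n u') = map fst u" "map snd (take n u') = map snd u"
        using arg_cong[OF eqs(1), of "take n"] arg_cong[OF eqs(2), of "take n"] lt
        by (simp_all add: n_def take_map)
      have "take n u' = u" using f by (metis zip_map_fst_snd)
      moreover have "drop n u' \<noteq> []" using lt by (simp add: n_def)
      then obtain p r where pr: "drop n u' = p # r" by (cases "drop n u'") auto
      ultimately have u'_eq: "u' = u @ p # r" by (metis append_take_drop_id)
      then have "x = fst p # map fst r @ v" "y = snd p # map snd r @ z" using eqs by auto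
      moreover have "u @ [p] \<in> V" using V_prefix[of "u @ [p]" r] u' u'_eq by simp
      ultimately show False using max by simp
    qed
    define k where "k = length u'"
    have f: "map fst (take k u) = map fst u'" "map snd (take k u) = map snd u'"
      using arg_cong[OF eqs(1), of "take k"] arg_cong[OF eqs(2), of "take k"] len
      by (simp_all add: k_def take_map)
    then have "take k u = u'" by (metis zip_map_fst_snd)
    then have "u = u' @ drop k u" by (metis append_take_drop_id)
    then have "map fst u = map fst u' @ map fst (drop k u)" "map snd u = map snd u' @ map snd (drop k u)"
      by (metis map_append)+
    then have "v = map fst (drop k u) @ x" "z = map snd (drop k u) @ y"
      using eqs by simp_all
    then have "y \<in> cut x k" using w(1) w_eq \<open>take k u = u'\<close> by (simp add: cut_def left_quotient_def)
    then show "\<exists>k \<le> length u. y \<in> cut x k" using len k_def by blast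
  next
    assume "\<exists>k \<le> length u. y \<in> cut x k"
    then obtain k where "(flat (take k u) @ (map fst (drop k u) @ x) @ map snd (drop k u)) @ y \<in> W"
      by (auto simp: cut_def left_quotient_def)
    moreover have "take k u \<in> V" using V_prefix[of "take k u" "drop k u"] u by simp
    moreover have "map fst (drop k u) @ x \<in> lists A" "map snd (drop k u) @ y \<in> lists B"
      using pair_lists[OF lists_drop[OF ul]] x y by auto
    ultimately have "(map fst (take k u) @ map fst (drop k u) @ x, map snd (take k u) @ map snd (drop k u) @ y)
        \<in> sem A B ` W"
      using sem_word by (metis append.assoc image_eqI)
    moreover have "map fst (take k u) @ map fst (drop k u) @ x = map fst u @ x"
      "map snd (take k u) @ map snd (drop k u) @ y = map snd u @ y"
      by (metis append.assoc append_take_drop_id map_append)+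
    ultimately show "R (map fst u @ x) (map snd u @ y)" unfolding W(3) by simp
  qed
  show ?thesis
  proof (rule finite_image_determined[of _ t])
    fix x x' assume x: "x \<in> lists A" "x' \<in> lists A" and eq: "t x = t x'"
    have hd: "x = [] \<longleftrightarrow> x' = []" "x \<noteq> [] \<Longrightarrow> hd x = hd x'" using eq by (auto simp: t_def split: if_splits)
    have "map (cut x) [0..<Suc (length u)] = map (cut x') [0..<Suc (length u)]"
      using eq by (simp only: t_def prod.inject)
    then have "cut x k = cut x' k" if "k \<le> length u" for k using that by (auto simp: map_eq_conv)
    then show "row u x = row u x'"
      unfolding row_def rest_rel_def using char[OF x(1)] char[OF x(2)] hd by (intro Collect_cong) metis
  next
    let ?D = "range (\<lambda>w. left_quotient w W)"
    have "t ` lists A \<subseteq> insert None (Some ` A) \<times> {l. set l \<subseteq> ?D \<and> length l = Suc (length u)}"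
    proof (rule image_subsetI)
      fix x assume "x \<in> lists A"
      then show "t x \<in> insert None (Some ` A) \<times> {l. set l \<subseteq> ?D \<and> length l = Suc (length u)}"
        unfolding t_def by (cases x) (auto simp: cut_def)
    qed
    moreover have "finite (insert None (Some ` A) \<times> {l. set l \<subseteq> ?D \<and> length l = Suc (length u)})"
      using regular_imp_finite_quotients[OF W(2)] finA finite_lists_length_eq[of ?D "Suc (length u)"]
      by (simp add: finite_quotients_def)
    ultimately show "finite (t ` lists A)" by (rule finite_subset)
  qed
qed

theorem Rel_iff:
  "{(x, y). R x y} \<in> Rel A B T \<longleftrightarrow>
    ((\<exists>x y. R x y) \<longrightarrow> V \<noteq> {}) \<and> (\<forall>u \<in> V. finite (row u ` lists A))"
proof
  assume "{(x, y). R x y} \<in> Rel A B T"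
  then obtain W where W: "W \<subseteq> T" "regular W" "sem A B ` W = {(x, y). R x y}" by (auto simp: Rel_def)
  have "V \<noteq> {}" if "R x y" for x y
  proof -
    have "(x, y) \<in> sem A B ` W" using W(3) that by simp
    then obtain w where "w \<in> W" by auto
    then have "w \<in> T" using W(1) by blast
    then show ?thesis by (auto simp: T_def)
  qed
  then show "((\<exists>x y. R x y) \<longrightarrow> V \<noteq> {}) \<and> (\<forall>u \<in> V. finite (row u ` lists A))"
    using finite_rows_if_Rel[OF W] by blast
next
  assume *: "((\<exists>x y. R x y) \<longrightarrow> V \<noteq> {}) \<and> (\<forall>u \<in> V. finite (row u ` lists A))"
  have "T' \<subseteq> T" unfolding T'_def T_def by blast
  moreover have "regular T'" using * by (intro regular_T') blast
  moreover have "sem A B ` T' = {(x, y). R x y}" using * by (intro sem_T') blast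
  ultimately show "{(x, y). R x y} \<in> Rel A B T" unfolding Rel_def by blast
qed

end

section \<open>Automata of finite shiftlag\<close>

definition balance :: "nat set \<Rightarrow> nat set \<Rightarrow> nat list \<Rightarrow> int" where
  "balance A B w = int (length (filter (\<lambda>x. x \<in> A) w)) - int (length (filter (\<lambda>x. x \<in> B) w))"

lemma balance_append[simp]: "balance A B (u @ v) = balance A B u + balance A B v"
  by (simp add: balance_def)

lemma balance_Nil[simp]: "balance A B [] = 0"
  by (simp add: balance_def)

lemma balance_replicate: "balance A B (concat (replicate M \<beta>)) = int M * balance A B \<beta>"
  by (induction M) (auto simp: algebra_simps)

lemma abs_balance_le: "\<bar>balance A B w\<bar> \<le> int (length w)"
  using length_filter_le[of "\<lambda>x. x \<in> A" w] length_filter_le[of "\<lambda>x. x \<in> B" w] unfolding balance_def by linarith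

lemma steps_replicate: "steps tr p \<beta> p \<Longrightarrow> steps tr p (concat (replicate M \<beta>)) p"
  by (induction M) (auto simp: steps_append intro: steps_nil)

definition states :: "(nat \<times> nat \<times> nat) list \<Rightarrow> nat set" where
  "states tr = fst ` set tr \<union> (snd \<circ> snd) ` set tr"

lemma steps_in:
  assumes "steps tr p w q" "states tr \<subseteq> Q" "p \<in> Q" shows "q \<in> Q"
  using steps_target[OF assms(1)] assms(2,3) unfolding states_def by blast

lemma run_states:
  assumes "steps tr p w q"
  obtains st where "st 0 = p" "st (length w) = q"
    "\<And>i j. i \<le> j \<Longrightarrow> j \<le> length w \<Longrightarrow> steps tr (st i) (drop i (take j w)) (st j)"
  using assms
proof (induction arbitrary: thesis rule: steps.induct)
  case (steps_nil tr p)
  show ?case by (rule steps_nil[of "\<lambda>_. p"]) (auto intro: steps.steps_nil)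
next
  case (steps_cons p a q' tr w q)
  obtain st where st: "st 0 = q'" "st (length w) = q"
    "\<And>i j. i \<le> j \<Longrightarrow> j \<le> length w \<Longrightarrow> steps tr (st i) (drop i (take j w)) (st j)"
    using steps_cons.IH by metis
  define st' where "st' = case_nat p st"
  show ?case
  proof (rule steps_cons.prems)
    show "st' 0 = p" "st' (length (a # w)) = q" using st by (auto simp: st'_def)
    fix i j :: nat assume ij: "i \<le> j" "j \<le> length (a # w)"
    show "steps tr (st' i) (drop i (take j (a # w))) (st' j)"
    proof (cases i)
      case 0
      show ?thesis
      proof (cases j)
        case (Suc j')
        then have "steps tr q' (take j' w) (st j')" using st(3)[of 0 j'] st(1) ij by simp
        then show ?thesis using 0 Suc steps_cons.hyps by (auto simp: st'_def intro: steps.steps_cons)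
      qed (auto simp: 0 intro: steps.steps_nil)
    next
      case (Suc i')
      then obtain j' where j': "j = Suc j'" using ij by (cases j) auto
      then show ?thesis using st(3)[of i' j'] ij Suc by (simp add: st'_def)
    qed
  qed
qed

text \<open>An imbalance above \<open>n\<close> forces more than \<open>n\<close> letters and so a
  cycle. If that cycle is balanced, removing it shortens the run and keeps the imbalance, so the
  argument can be repeated.\<close>

lemma unbalanced_cycle:
  assumes Q: "finite Q" "card Q \<le> n" "states tr \<subseteq> Q" "p0 \<in> Q"
  shows "steps tr p0 w q \<Longrightarrow> \<bar>balance A B w\<bar> > int n \<Longrightarrow>
    \<exists>\<alpha> \<beta> \<gamma> p. steps tr p0 \<alpha> p \<and> steps tr p \<beta> p \<and> steps tr p \<gamma> q \<and> balance A B \<beta> \<noteq> 0"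
proof (induction "length w" arbitrary: w rule: less_induct)
  case less
  obtain st where st: "st 0 = p0" "st (length w) = q"
    "\<And>i j. i \<le> j \<Longrightarrow> j \<le> length w \<Longrightarrow> steps tr (st i) (drop i (take j w)) (st j)"
    using run_states[OF less.prems(1)] by metis
  have long: "n < length w" using less.prems(2) abs_balance_le[of A B w] by linarith
  have "st i \<in> Q" if "i \<le> n" for i
    using steps_in[OF st(3)[of 0 i] Q(3)] st(1) Q(4) that long by simp
  then obtain i j where ij: "i < j" "j \<le> n" "st i = st j" using pigeonhole_le[OF Q(1,2), of st] by metis
  define \<alpha> \<beta> \<gamma> where "\<alpha> = take i w" and "\<beta> = drop i (take j w)" and "\<gamma> = drop j w"
  have w: "w = \<alpha> @ \<beta> @ \<gamma>"
    unfolding \<alpha>_def \<beta>_def \<gamma>_def using ij(1)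
    by (metis append_take_drop_id append.assoc less_imp_le_nat min.absorb1 take_take)
  have run: "steps tr p0 \<alpha> (st i)" "steps tr (st i) \<beta> (st i)" "steps tr (st i) \<gamma> q"
    using st(3)[of 0 i] st(3)[of i j] st(3)[of j "length w"] st(1,2) ij long
    by (simp_all add: \<alpha>_def \<beta>_def \<gamma>_def)
  show ?case
  proof (cases "balance A B \<beta> = 0")
    case True
    have "length (\<alpha> @ \<gamma>) < length w" using ij long by (simp add: \<alpha>_def \<gamma>_def)
    moreover have "steps tr p0 (\<alpha> @ \<gamma>) q" using run by (auto simp: steps_append)
    moreover have "\<bar>balance A B (\<alpha> @ \<gamma>)\<bar> > int n" using less.prems(2) True by (simp add: w)
    ultimately show ?thesis by (rule less.hyps)
  qed (use run in blast)
qed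

lemma has_consec_le_length:
  assumes "has_consec_lagged_shifts A B w n" shows "n \<le> length w"
proof (cases n)
  case (Suc m)
  obtain s :: "nat \<Rightarrow> nat" where s: "\<And>j. j < n \<Longrightarrow> is_shift A w (s j)" "\<And>j. Suc j < n \<Longrightarrow> s j < s (Suc j)"
    using assms unfolding has_consec_lagged_shifts_def by blast
  have "Suc j \<le> s j" if "j < n" for j
    using that
  proof (induction j)
    case 0
    then show ?case using s(1)[of 0] by (simp add: is_shift_def)
  next
    case (Suc j)
    then show ?case using s(2)[of j] by simp
  qed
  from this[of m] s(1)[of m] Suc show ?thesis by (simp add: is_shift_def)
qed simp

text \<open>\<open>shiftlag\<close> is a \<open>Max\<close>, which bounds the elements of a set only
  if the set is finite; the word length supplies this.\<close>

lemma has_consec_le_shiftlag: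
  assumes "has_consec_lagged_shifts A B w n" shows "n \<le> shiftlag A B w"
proof -
  have "{n. has_consec_lagged_shifts A B w n} \<subseteq> {..length w}"
    using has_consec_le_length by auto
  then have "finite {n. has_consec_lagged_shifts A B w n}" by (rule finite_subset) simp
  then show ?thesis unfolding shiftlag_def using assms by (intro Max_ge) auto
qed

text \<open>All shifts within an interval, listed in increasing order, are consecutive, so counting
  them is enough.\<close>

lemma consec_lagged_shiftsI:
  assumes Sh: "Sh = {i. l \<le> i \<and> i \<le> u \<and> is_shift A w i}" and card: "n \<le> card Sh"
    and lag: "\<And>i. i \<in> Sh \<Longrightarrow> int n \<le> lag A B w i"
  shows "has_consec_lagged_shifts A B w n"
proof -
  have fin: "finite Sh" unfolding Sh by simp
  define xs where "xs = sorted_list_of_set Sh"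
  have xs: "sorted xs" "distinct xs" "set xs = Sh" "length xs = card Sh"
    using fin by (simp_all add: xs_def)
  have strict: "xs ! i < xs ! j" if "i < j" "j < length xs" for i j
    using sorted_wrt_nth_less[of "(<)" xs i j] that by (simp add: xs_def)
  show ?thesis unfolding has_consec_lagged_shifts_def
  proof (intro exI[of _ "\<lambda>j. xs ! j"] conjI allI impI)
    fix j assume "j < n"
    then have "xs ! j \<in> Sh" using xs card nth_mem[of j xs] by simp
    then show "is_shift A w (xs ! j)" "int n \<le> lag A B w (xs ! j)" using lag by (auto simp: Sh)
  next
    fix j assume "Suc j < n"
    then show "xs ! j < xs ! Suc j" using strict xs card by simp
  next
    fix j k assume j: "Suc j < n" and k: "xs ! j < k \<and> k < xs ! Suc j"
    show "\<not> is_shift A w k"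
    proof
      assume "is_shift A w k"
      moreover have "xs ! j \<in> Sh" "xs ! Suc j \<in> Sh" using j xs card nth_mem[of _ xs] by auto
      ultimately have "k \<in> set xs" using k unfolding xs(3) Sh by auto
      then obtain m where m: "m < length xs" "xs ! m = k" by (auto simp: in_set_conv_nth)
      have "j < m" using strict[of m j] m k j xs card by (metis Suc_lessD linorder_neqE_nat order_less_asym order_less_irrefl order_less_le_trans)
      moreover have "m < Suc j" using strict[of "Suc j" m] m k by (metis linorder_neqE_nat order_less_asym order_less_irrefl)
      ultimately show False by simp
    qed
  qed
qed

text \<open>Equivalently, the word has no shift; like \<open>is_shift\<close>, the definition refers
  to \<open>A\<close> only.\<close>

definition homogeneous :: "nat set \<Rightarrow> nat list \<Rightarrow> bool" where
  "homogeneous A w \<longleftrightarrow> set w \<subseteq> A \<or> set w \<inter> A = {}"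

lemma not_homogeneous_shift:
  assumes "\<not> homogeneous A w" obtains j where "Suc j < length w" "(w ! j \<in> A) \<noteq> (w ! Suc j \<in> A)"
proof -
  have "\<exists>j. Suc j < length w \<and> (w ! j \<in> A) \<noteq> (w ! Suc j \<in> A)"
  proof (rule ccontr)
    assume *: "\<nexists>j. Suc j < length w \<and> (w ! j \<in> A) \<noteq> (w ! Suc j \<in> A)"
    have "w ! j \<in> A \<longleftrightarrow> w ! 0 \<in> A" if "j < length w" for j
      using that by (induction j) (use * in auto)
    then have "homogeneous A w" unfolding homogeneous_def by (auto simp: in_set_conv_nth)
    then show False using assms by simp
  qed
  then show ?thesis using that by blast
qed

text \<open>Each copy of \<open>\<delta>\<close> contributes a shift. Inside the \<open>N\<close>
  copies the balance changes by at most \<open>N * length \<delta>\<close>, so the imbalance of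
  \<open>X\<close> keeps the lag at \<open>N\<close> or more throughout.\<close>

lemma pumped_shifts:
  assumes \<delta>: "\<not> homogeneous A \<delta>" and X: "\<bar>balance A B X\<bar> \<ge> int (N * length \<delta> + N)"
  shows "has_consec_lagged_shifts A B (X @ concat (replicate N \<delta>) @ \<theta>) N"
proof -
  define D w L d where "D = concat (replicate N \<delta>)" and "w = X @ D @ \<theta>" and "L = length X" and "d = length \<delta>"
  have lenD: "length D = N * d" by (simp add: D_def d_def length_concat sum_list_replicate)
  define Sh where "Sh = {i. L \<le> i \<and> i \<le> L + N * d \<and> is_shift A w i}"
  obtain j where j: "Suc j < d" "(\<delta> ! j \<in> A) \<noteq> (\<delta> ! Suc j \<in> A)"
    using not_homogeneous_shift[OF \<delta>] by (auto simp: d_def)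
  have nthD: "D ! (k * d + i) = \<delta> ! i" if "k < N" "i < d" for k i
  proof -
    have "concat (replicate M \<delta>) ! (k * d + i) = \<delta> ! i" if "k < M" for M
      using that
    proof (induction M arbitrary: k)
      case (Suc M)
      show ?case
      proof (cases k)
        case 0
        then show ?thesis using \<open>i < d\<close> by (simp add: nth_append d_def)
      next
        case (Suc k')
        then have "concat (replicate M \<delta>) ! (k' * d + i) = \<delta> ! i" using Suc.IH[of k'] Suc.prems by simp
        then show ?thesis using Suc by (simp add: nth_append d_def algebra_simps)
      qed
    qed simp
    then show ?thesis using that by (simp add: D_def)
  qed
  have bound: "k * d + i < N * d" if "k < N" "i < d" for k i
  proof -
    have "k * d + i < Suc k * d" using that by simp
    also have "\<dots> \<le> N * d" using that by (intro mult_le_mono1) simp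
    finally show ?thesis .
  qed
  define f where "f k = L + (k * d + Suc j)" for k
  have "f k \<in> Sh" if k: "k < N" for k
  proof -
    have "k * d + Suc j < N * d" using bound[OF k j(1)] .
    moreover have "w ! (f k - 1) = \<delta> ! j" "w ! (f k) = \<delta> ! Suc j"
      using nthD[OF k, of j] nthD[OF k, of "Suc j"] j calculation lenD
      by (simp_all add: w_def f_def L_def nth_append)
    ultimately show ?thesis using j(2) lenD by (simp add: Sh_def is_shift_def f_def w_def L_def)
  qed
  moreover have "inj_on f {..<N}" using j by (auto simp: inj_on_def f_def)
  moreover have "finite Sh" by (simp add: Sh_def)
  ultimately have "card {..<N} \<le> card Sh" by (intro card_inj_on_le[of f]) auto
  then have card: "N \<le> card Sh" by simp
  have "int N \<le> lag A B w i" if "i \<in> Sh" for i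
  proof -
    have i: "L \<le> i" "i \<le> L + N * d" using that by (auto simp: Sh_def)
    have "lag A B w i = \<bar>balance A B (take i w)\<bar>" by (simp add: lag_def balance_def)
    also have "take i w = X @ take (i - L) D" using i by (simp add: w_def L_def lenD)
    finally have "lag A B w i = \<bar>balance A B X + balance A B (take (i - L) D)\<bar>" by simp
    moreover have "\<bar>balance A B (take (i - L) D)\<bar> \<le> int (N * d)"
    proof -
      have "length (take (i - L) D) \<le> N * d" using lenD by simp
      then show ?thesis using abs_balance_le[of A B "take (i - L) D"] by linarith
    qed
    moreover have "int (N * d) + int N \<le> \<bar>balance A B X\<bar>" using X by (simp add: d_def)
    ultimately show ?thesis by linarith
  qed
  then have "has_consec_lagged_shifts A B w N" by (rule consec_lagged_shiftsI[OF Sh_def card])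
  then show ?thesis by (simp add: w_def D_def)
qed

text \<open>Pumping \<open>\<beta>\<close> creates an arbitrarily large imbalance; pumping
  \<open>\<delta>\<close> afterwards creates arbitrarily many shifts at that lag, against the bound
  on the shiftlag.\<close>

lemma no_mixed_cycle:
  assumes fin: "finite_shiftlag A B (nfa_lang (tr, I, F))"
    and p0: "p0 \<in> set I" "steps tr p0 \<alpha> p" and \<beta>: "steps tr p \<beta> p" "balance A B \<beta> \<noteq> 0"
    and run: "steps tr p \<gamma> r" "steps tr r \<delta> r" "steps tr r \<theta> f" "f \<in> set F"
  shows "homogeneous A \<delta>"
proof (rule ccontr)
  assume mixed: "\<not> homogeneous A \<delta>"
  obtain b where b: "\<And>w. w \<in> nfa_lang (tr, I, F) \<Longrightarrow> shiftlag A B w \<le> b"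
    using fin by (auto simp: finite_shiftlag_def)
  \<comment> \<open>\<open>N\<close> exceeds the bound on the shiftlag. Each round of
    \<open>\<beta>\<close> changes the balance by at least 1 in a fixed direction, so
    \<open>M\<close> rounds outweigh \<open>\<alpha>\<close> and \<open>\<gamma>\<close> and still
    leave the imbalance required for \<open>N\<close> copies of \<open>\<delta>\<close>.\<close>
  define N M where "N = Suc b" and "M = nat \<bar>balance A B \<alpha> + balance A B \<gamma>\<bar> + (N * length \<delta> + N)"
  define X where "X = \<alpha> @ concat (replicate M \<beta>) @ \<gamma>"
  have "int M * 1 \<le> int M * \<bar>balance A B \<beta>\<bar>" using \<beta>(2) by (intro mult_left_mono) auto
  then have "int M \<le> \<bar>int M * balance A B \<beta>\<bar>" by (simp add: abs_mult)
  moreover have "int M = \<bar>balance A B \<alpha> + balance A B \<gamma>\<bar> + int (N * length \<delta> + N)" by (simp add: M_def)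
  moreover have "balance A B X = (balance A B \<alpha> + balance A B \<gamma>) + int M * balance A B \<beta>"
    by (simp add: X_def balance_replicate)
  ultimately have "\<bar>balance A B X\<bar> \<ge> int (N * length \<delta> + N)" by linarith
  from has_consec_le_shiftlag[OF pumped_shifts[OF mixed this, of \<theta>]]
  have "N \<le> shiftlag A B (X @ concat (replicate N \<delta>) @ \<theta>)" .
  moreover have "steps tr p0 X r" unfolding X_def using p0 steps_replicate[OF \<beta>(1)] run(1)
    by (auto simp: steps_append)
  then have "steps tr p0 (X @ concat (replicate N \<delta>) @ \<theta>) f"
    using steps_replicate[OF run(2)] run(3) steps_append by blast
  then have "X @ concat (replicate N \<delta>) @ \<theta> \<in> nfa_lang (tr, I, F)"
    using p0 run by (auto simp: nfa_lang_def)
  ultimately show False using b N_def by fastforce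
qed


section \<open>Runs cut into homogeneous blocks\<close>

primrec block_run :: "(nat \<times> nat \<times> nat) list \<Rightarrow> nat set \<Rightarrow> nat \<Rightarrow> nat \<Rightarrow> nat list \<Rightarrow> nat \<Rightarrow> bool" where
  "block_run tr A 0 s w f \<longleftrightarrow> w = [] \<and> s = f"
| "block_run tr A (Suc m) s w f \<longleftrightarrow> (\<exists>u v r. w = u @ v \<and> homogeneous A u \<and> steps tr s u r \<and> block_run tr A m r v f)"

lemma block_run_Suc: "block_run tr A m s w f \<Longrightarrow> block_run tr A (Suc m) s w f"
  by (intro iffD2[OF block_run.simps(2)] exI[of _ "[]"] exI[of _ w] exI[of _ s])
    (auto simp: homogeneous_def intro: steps_nil)

lemma block_run_mono: "block_run tr A m s w f \<Longrightarrow> m \<le> m' \<Longrightarrow> block_run tr A m' s w f"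
proof (induction m')
  case (Suc m')
  then show ?case by (cases "m = Suc m'") (simp_all only: block_run_Suc le_Suc_eq simp_thms)
qed simp

definition avoid :: "nat \<Rightarrow> (nat \<times> nat \<times> nat) list \<Rightarrow> (nat \<times> nat \<times> nat) list" where
  "avoid s tr = filter (\<lambda>t. fst t \<noteq> s \<and> snd (snd t) \<noteq> s) tr"

text \<open>A run that meets \<open>s\<close> is cut at its last visit there, so that the part after
  the next letter lives in the automaton without \<open>s\<close>.\<close>

lemma last_visit:
  assumes "steps tr p w f"
  shows "(p \<noteq> s \<and> steps (avoid s tr) p w f) \<or> (\<exists>w1 w2. w = w1 @ w2 \<and> steps tr p w1 s \<and>
    (w2 = [] \<and> f = s \<or> (\<exists>a v s'. w2 = a # v \<and> (s, a, s') \<in> set tr \<and> s' \<noteq> s \<and> steps (avoid s tr) s' v f)))"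
    (is "_ \<or> (\<exists>w1 w2. _ \<and> _ \<and> ?last tr f w2)")
  using assms
proof (induction rule: steps.induct)
  case (steps_nil tr p)
  then show ?case by (cases "p = s") (auto intro: steps.steps_nil)
next
  case (steps_cons p a q' tr w f)
  from steps_cons.IH consider "q' \<noteq> s" "steps (avoid s tr) q' w f"
    | w1 w2 where "w = w1 @ w2" "steps tr q' w1 s" "?last tr f w2" by blast
  then show ?case
  proof cases
    case q': 1
    show ?thesis
    proof (cases "p = s")
      case True
      then have "a # w = [] @ a # w \<and> steps tr p [] s \<and> ?last tr f (a # w)"
        using q' steps_cons.hyps by (auto intro: steps.steps_nil)
      then show ?thesis by blast
    next
      case False
      then have "(p, a, q') \<in> set (avoid s tr)" using steps_cons.hyps q' by (simp add: avoid_def)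
      then show ?thesis using False q' by (blast intro: steps.steps_cons)
    qed
  next
    case 2
    then have "a # w = (a # w1) @ w2 \<and> steps tr p (a # w1) s \<and> ?last tr f w2"
      using steps_cons.hyps by (simp add: steps.steps_cons)
    then show ?thesis by blast
  qed
qed

lemma steps_mono: "steps tr p w q \<Longrightarrow> set tr \<subseteq> set tr' \<Longrightarrow> steps tr' p w q"
  by (induction rule: steps.induct) (auto intro: steps.intros)

text \<open>Up to its last visit the run is a cycle at \<open>s\<close>, hence one block; the letter
  leaving \<open>s\<close> is a second one, and the rest avoids \<open>s\<close>. So each state
  costs two blocks. The run shrinks to \<open>tr'\<close>, while the hypothesis on cycles stays with
  the full \<open>tr\<close>.\<close>

lemma block_run_if_no_mixed_cycle:
  assumes "finite D"
  shows "card D \<le> k \<Longrightarrow> states tr' \<subseteq> D \<Longrightarrow> set tr' \<subseteq> set tr \<Longrightarrow> s \<in> D \<Longrightarrow> steps tr' s w f \<Longrightarrow>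
    (\<And>r \<eta> \<delta> \<theta>. steps tr s \<eta> r \<Longrightarrow> steps tr r \<delta> r \<Longrightarrow> steps tr r \<theta> f \<Longrightarrow> homogeneous A \<delta>) \<Longrightarrow>
    block_run tr A (2 * k) s w f"
  using assms
proof (induction k arbitrary: D tr' s w)
  case 0
  then show ?case by auto
next
  case (Suc k)
  note homogeneous = Suc.prems(6)
  obtain w1 w2 where w: "w = w1 @ w2" "steps tr' s w1 s" and
    w2: "w2 = [] \<and> f = s \<or> (\<exists>a v s'. w2 = a # v \<and> (s, a, s') \<in> set tr' \<and> s' \<noteq> s \<and> steps (avoid s tr') s' v f)"
    using last_visit[OF Suc.prems(5), of s] by blast
  have lift: "steps tr p u q" if "steps tr' p u q" for p u q using steps_mono[OF that Suc.prems(3)] .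
  have w1: "steps tr s w1 s" using lift[OF w(2)] .
  from w2 show ?case
  proof (elim disjE exE conjE)
    assume e: "w2 = []" "f = s"
    have "homogeneous A w1" using homogeneous[of "[]" s w1 "[]"] w1 e by (auto intro: steps_nil)
    then have "block_run tr A (Suc 0) s w f" using w w1 e by (auto simp: homogeneous_def)
    then show ?thesis by (rule block_run_mono) simp
  next
    fix a v s' assume e: "w2 = a # v" "(s, a, s') \<in> set tr'" "s' \<noteq> s" "steps (avoid s tr') s' v f"
    have sub: "set (avoid s tr') \<subseteq> set tr'" by (auto simp: avoid_def)
    have tra: "(s, a, s') \<in> set tr" using e(2) Suc.prems(3) by blast
    then have sa: "steps tr s [a] s'" by (auto intro: steps.intros)
    have rest: "steps tr s' v f" using lift[OF steps_mono[OF e(4) sub]] .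
    then have w2f: "steps tr s w2 f" using tra e(1) by (auto intro: steps.intros)
    have "block_run tr A (2 * k) s' v f"
    proof (rule Suc.IH[of "D - {s}" "avoid s tr'"])
      show "card (D - {s}) \<le> k" using Suc.prems(1,4,7) by simp
      have "states (avoid s tr') \<subseteq> states tr' - {s}" unfolding states_def avoid_def by auto
      then show "states (avoid s tr') \<subseteq> D - {s}" using Suc.prems(2) by blast
      show "set (avoid s tr') \<subseteq> set tr" using sub Suc.prems(3) by blast
      have "s' \<in> states tr'" using e(2) unfolding states_def by force
      then show "s' \<in> D - {s}" using Suc.prems(2) e(3) by blast
      show "finite (D - {s})" using Suc.prems(7) by simp
      show "homogeneous A \<delta>" if "steps tr s' \<eta> r" "steps tr r \<delta> r" "steps tr r \<theta> f" for r \<eta> \<delta> \<theta>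
        using homogeneous[of "a # \<eta>" r \<delta> \<theta>] that tra by (auto intro: steps.intros)
    qed (rule e(4))
    moreover have "homogeneous A [a]" by (auto simp: homogeneous_def)
    ultimately have "block_run tr A (Suc (2 * k)) s w2 f" 
      using sa unfolding e(1) block_run.simps(2)
      by (intro exI[of _ "[a]"] exI[of _ v] exI[of _ s'] conjI) simp_all
    moreover have "homogeneous A w1" using homogeneous[of "[]" s w1 w2] w1 w2f by (auto intro: steps_nil)
    ultimately have "block_run tr A (Suc (Suc (2 * k))) s w f"
      using w1 w(1) by (subst block_run.simps(2)) blast
    then show ?thesis by simp
  qed
qed

text \<open>The cut is made just before the letter that first pushes the lag above \<open>n\<close>.
  The state after that letter lies behind an unbalanced cycle, so the rest of the run meets only
  homogeneous cycles and needs at most \<open>2 * n\<close> blocks. The letter itself is the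
  additional one.\<close>

lemma bounded_lag_decomposition:
  assumes fin: "finite_shiftlag A B (nfa_lang (tr, I, F))"
    and Q: "finite Q" "card Q \<le> n" "states tr \<subseteq> Q" "set I \<subseteq> Q"
    and p0: "p0 \<in> set I" and f: "f \<in> set F" and run: "steps tr p0 w f"
  obtains w1 w2 r where "w = w1 @ w2" "steps tr p0 w1 r" "block_run tr A (Suc (2 * n)) r w2 f"
    "\<And>i. \<bar>balance A B (take i w1)\<bar> \<le> int n"
proof (cases "\<exists>i. \<bar>balance A B (take i w)\<bar> > int n")
  case False
  have "block_run tr A 0 f [] f" by simp
  then have "block_run tr A (Suc (2 * n)) f [] f" by (rule block_run_mono) simp
  then show ?thesis using that[of w "[]" f] run False by (auto simp: not_less)
next
  case True
  define i where "i = (LEAST i. \<bar>balance A B (take i w)\<bar> > int n)"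
  have i: "\<bar>balance A B (take i w)\<bar> > int n" unfolding i_def using True by (rule LeastI_ex)
  have less: "\<bar>balance A B (take j w)\<bar> \<le> int n" if "j < i" for j
    using not_less_Least[of j "\<lambda>i. \<bar>balance A B (take i w)\<bar> > int n"] that unfolding i_def by simp
  obtain j where j: "i = Suc j" using i by (cases i) auto
  have "j < length w"
  proof (rule ccontr)
    assume "\<not> j < length w"
    then have "take i w = take j w" using j by simp
    then show False using less[of j] i j by simp
  qed
  then have w: "w = take j w @ [w ! j] @ drop i w" unfolding j by (simp add: id_take_nth_drop)
  obtain r where r: "steps tr p0 (take j w) r" "steps tr r ([w ! j] @ drop i w) f"
    using run w by (metis steps_append)
  then obtain r' where r': "steps tr r [w ! j] r'" "steps tr r' (drop i w) f"
    unfolding steps_append by blast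
  have p0Q: "p0 \<in> Q" using p0 Q(4) by blast
  have "steps tr p0 (take i w) r'" using r(1) r'(1) \<open>j < length w\<close> unfolding j
    by (auto simp: take_Suc_conv_app_nth steps_append)
  from unbalanced_cycle[OF Q(1-3) p0Q this i]
  obtain \<alpha> \<beta> \<gamma> p where cyc: "steps tr p0 \<alpha> p" "steps tr p \<beta> p" "steps tr p \<gamma> r'" "balance A B \<beta> \<noteq> 0"
    by blast
  have "block_run tr A (2 * n) r' (drop i w) f"
  proof (rule block_run_if_no_mixed_cycle[OF Q(1-3) order_refl])
    show "r' \<in> Q" using steps_in[OF \<open>steps tr p0 (take i w) r'\<close> Q(3) p0Q] .
    show "homogeneous A \<delta>" if "steps tr r' \<eta> s" "steps tr s \<delta> s" "steps tr s \<theta> f" for s \<eta> \<delta> \<theta>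
    proof (rule no_mixed_cycle[OF fin p0 cyc(1,2,4) _ that(2,3) f])
      show "steps tr p (\<gamma> @ \<eta>) s" using cyc(3) that(1) steps_append by blast
    qed
  qed (rule r'(2))
  moreover have "homogeneous A [w ! j]" by (auto simp: homogeneous_def)
  ultimately have "block_run tr A (Suc (2 * n)) r ([w ! j] @ drop i w) f" using r'(1) block_run.simps(2) by blast
  moreover have "\<bar>balance A B (take l (take j w))\<bar> \<le> int n" for l
    using less[of "min l j"] j by simp
  ultimately show ?thesis using that[of "take j w" "[w ! j] @ drop i w" r] r(1) w by simp
qed

section \<open>Reading the two components of a block run independently\<close>

primrec path_seq :: "(nat \<times> nat \<times> nat) list \<Rightarrow> nat set \<Rightarrow> (nat \<times> nat) list \<Rightarrow> nat list \<Rightarrow> bool" where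
  "path_seq tr A [] x \<longleftrightarrow> x = []"
| "path_seq tr A (p # ps) x \<longleftrightarrow> (\<exists>x1 x2. x = x1 @ x2 \<and> x1 \<in> lists A \<and> steps tr (fst p) x1 (snd p) \<and> path_seq tr A ps x2)"

lemma path_seq_append: "path_seq tr A (ps @ qs) x \<longleftrightarrow> (\<exists>x1 x2. x = x1 @ x2 \<and> path_seq tr A ps x1 \<and> path_seq tr A qs x2)"
proof (induction ps arbitrary: x)
  case (Cons p ps)
  show ?case
  proof
    assume "path_seq tr A ((p # ps) @ qs) x"
    then obtain x1 y1 y2 where "x = x1 @ y1 @ y2" "x1 \<in> lists A" "steps tr (fst p) x1 (snd p)"
      "path_seq tr A ps y1" "path_seq tr A qs y2" using Cons by auto
    then show "\<exists>x1 x2. x = x1 @ x2 \<and> path_seq tr A (p # ps) x1 \<and> path_seq tr A qs x2"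
      by (intro exI[of _ "x1 @ y1"] exI[of _ y2]) auto
  next
    assume "\<exists>x1 x2. x = x1 @ x2 \<and> path_seq tr A (p # ps) x1 \<and> path_seq tr A qs x2"
    then obtain x1 y1 y2 where "x = x1 @ y1 @ y2" "x1 \<in> lists A" "steps tr (fst p) x1 (snd p)"
      "path_seq tr A ps y1" "path_seq tr A qs y2" unfolding path_seq.simps append_assoc[symmetric] by blast
    then show "path_seq tr A ((p # ps) @ qs) x" using Cons[of "y1 @ y2"] by auto
  qed
qed simp

text \<open>The boundary between \<open>a\<close> and \<open>x\<close> falls into one segment
  \<open>(r, r')\<close>, which is divided at the state \<open>t\<close> reached there. The separate
  path from \<open>r\<close> to \<open>t\<close> serves to show that \<open>t\<close> is a state of
  the automaton.\<close>

lemma path_seq_split: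
  "path_seq tr A ps (a @ x) \<Longrightarrow> (ps = [] \<and> a = [] \<and> x = []) \<or>
    (\<exists>ps1 r r' ps2 t. ps = ps1 @ (r, r') # ps2 \<and> path_seq tr A (ps1 @ [(r, t)]) a \<and> (\<exists>v. steps tr r v t)
        \<and> path_seq tr A ((t, r') # ps2) x)"
proof (induction ps arbitrary: a)
  case (Cons p ps)
  obtain r r' where p: "p = (r, r')" by fastforce
  obtain x1 x2 where x: "a @ x = x1 @ x2" "x1 \<in> lists A" "steps tr r x1 r'" "path_seq tr A ps x2"
    using Cons.prems by (auto simp: p)
  from x(1) consider us where "a @ us = x1" "x = us @ x2"
    | us where "a = x1 @ us" "us @ x = x2" "us \<noteq> []"
    by (auto simp: append_eq_append_conv2) (metis append_Nil2 append_self_conv2)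
  then show ?case
  proof cases
    case 1
    then obtain t where t: "steps tr r a t" "steps tr t us r'" using x(3) steps_append by blast
    have "path_seq tr A ([] @ [(r, t)]) a" using t 1 x(2) by (auto intro!: exI[of _ a])
    moreover have "us \<in> lists A" using 1(1) x(2) by auto
    then have "path_seq tr A ((t, r') # ps) x"
      using t(2) x(4) unfolding 1(2) path_seq.simps fst_conv snd_conv by blast
    ultimately show ?thesis using p t(1) by blast
  next
    case 2
    have "path_seq tr A ps (us @ x)" using x(4) 2 by simp
    from Cons.IH[OF this] 2(3) obtain ps1 s s' ps2 t where IH: "ps = ps1 @ (s, s') # ps2"
      "path_seq tr A (ps1 @ [(s, t)]) us" "\<exists>v. steps tr s v t" "path_seq tr A ((t, s') # ps2) x" by blast
    have "path_seq tr A ((p # ps1) @ [(s, t)]) a" using 2 IH(2) x p by auto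
    then show ?thesis using IH by (metis append_Cons)
  qed
qed simp

text \<open>Every block belongs to one component only, so the two components can be exchanged
  independently along the same segments and reassembled into a run with the same ends.\<close>

lemma block_run_path_seq:
  assumes "block_run tr A m s w f" "w \<in> lists (A \<union> B)" "A \<inter> B = {}" "states tr \<subseteq> Q" "s \<in> Q"
  shows "\<exists>xs ys. length xs \<le> m \<and> length ys \<le> m \<and> set xs \<subseteq> Q \<times> Q \<and> set ys \<subseteq> Q \<times> Q \<and>
    path_seq tr A xs (filter (\<lambda>x. x \<in> A) w) \<and> path_seq tr B ys (filter (\<lambda>x. x \<in> B) w) \<and>
    (\<forall>x y. path_seq tr A xs x \<longrightarrow> path_seq tr B ys y \<longrightarrow> (\<exists>w'. steps tr s w' f \<and> sem A B w' = (x, y)))"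
  using assms(1,2,5)
proof (induction m arbitrary: s w)
  case 0
  then show ?case by (intro exI[of _ "[]"]) (auto simp: sem_def intro: steps_nil exI[of _ "[]"])
next
  case (Suc m)
  obtain u v r where w: "w = u @ v" "homogeneous A u" "steps tr s u r" "block_run tr A m r v f" using Suc.prems(1) by auto
  have uv: "u \<in> lists (A \<union> B)" "v \<in> lists (A \<union> B)" using Suc.prems(2) w(1) by auto
  have rQ: "r \<in> Q" using steps_in[OF w(3) assms(4) Suc.prems(3)] .
  from Suc.IH[OF w(4) uv(2) rQ] obtain xs ys where IH: "length xs \<le> m" "length ys \<le> m"
    "set xs \<subseteq> Q \<times> Q" "set ys \<subseteq> Q \<times> Q"
    "path_seq tr A xs (filter (\<lambda>x. x \<in> A) v)" "path_seq tr B ys (filter (\<lambda>x. x \<in> B) v)"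
    "\<And>x y. path_seq tr A xs x \<Longrightarrow> path_seq tr B ys y \<Longrightarrow> \<exists>w'. steps tr r w' f \<and> sem A B w' = (x, y)" by blast
  from w(2) consider "set u \<subseteq> A" | "set u \<subseteq> B" using uv(1) by (auto simp: homogeneous_def)
  then show ?case
  proof cases
    case 1
    then have u: "u \<in> lists A" by auto
    then have sem: "sem A B u = (u, [])" by (rule sem_left[OF assms(3)])
    show ?thesis
    proof (rule exI[of _ "(s, r) # xs"], rule exI[of _ ys], intro conjI allI impI)
      show "path_seq tr A ((s, r) # xs) (filter (\<lambda>x. x \<in> A) w)"
        using sem u w(1,3) IH(5) by (auto simp: sem_def)
      show "path_seq tr B ys (filter (\<lambda>x. x \<in> B) w)" using sem w(1) IH(6) by (auto simp: sem_def)
      fix x y assume "path_seq tr A ((s, r) # xs) x" and y: "path_seq tr B ys y"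
      then obtain x1 x2 where x: "x = x1 @ x2" "x1 \<in> lists A" "steps tr s x1 r" "path_seq tr A xs x2" by auto
      obtain w' where "steps tr r w' f" "sem A B w' = (x2, y)" using IH(7)[OF x(4) y] by blast
      then show "\<exists>w'. steps tr s w' f \<and> sem A B w' = (x, y)"
        using x sem_left[OF assms(3) x(2)] by (intro exI[of _ "x1 @ w'"]) (auto simp: steps_append sem_append)
    qed (use IH rQ Suc.prems in auto)
  next
    case 2
    then have u: "u \<in> lists B" by auto
    then have sem: "sem A B u = ([], u)" by (rule sem_right[OF assms(3)])
    show ?thesis
    proof (rule exI[of _ xs], rule exI[of _ "(s, r) # ys"], intro conjI allI impI)
      show "path_seq tr B ((s, r) # ys) (filter (\<lambda>x. x \<in> B) w)"
        using sem u w(1,3) IH(6) by (auto simp: sem_def)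
      show "path_seq tr A xs (filter (\<lambda>x. x \<in> A) w)" using sem w(1) IH(5) by (auto simp: sem_def)
      fix x y assume x: "path_seq tr A xs x" and "path_seq tr B ((s, r) # ys) y"
      then obtain x1 x2 where y: "y = x1 @ x2" "x1 \<in> lists B" "steps tr s x1 r" "path_seq tr B ys x2" by auto
      obtain w' where "steps tr r w' f" "sem A B w' = (x, x2)" using IH(7)[OF x y(4)] by blast
      then show "\<exists>w'. steps tr s w' f \<and> sem A B w' = (x, y)"
        using y sem_right[OF assms(3) y(2)] by (intro exI[of _ "x1 @ w'"]) (auto simp: steps_append sem_append)
    qed (use IH rQ Suc.prems in auto)
  qed
qed

section \<open>Residuals of a relation given by an automaton of finite shiftlag\<close>

text \<open>The number of blocks given by \<open>bounded_lag_decomposition\<close>.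
  \<open>word_bound\<close> then counts words of length at most \<open>n\<close> over
  \<open>n\<close> letters, and \<open>path_bound\<close> counts lists of at most
  \<open>block_count n\<close> state pairs.\<close>

definition block_count :: "nat \<Rightarrow> nat" where
  "block_count n = Suc (2 * n)"

definition word_bound :: "nat \<Rightarrow> nat" where
  "word_bound n = Suc n * Suc n ^ n"

definition path_bound :: "nat \<Rightarrow> nat" where
  "path_bound n = Suc (block_count n) * Suc (n * n) ^ block_count n"

text \<open>The number of possible triples of \<open>order_code\<close>, \<open>Type1\<close> and
  \<open>Type2\<close>: three length comparisons, sets of states with two short words, and sets of
  states with two sets of paths.\<close>

definition residual_bound :: "nat \<Rightarrow> nat" where
  "residual_bound n = 3 * (2 ^ (n * (word_bound n * word_bound n)) *
     2 ^ (n * (2 ^ path_bound n * 2 ^ path_bound n)))"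

locale finite_shiftlag_nfa =
  fixes A B :: "nat set" and tr :: "(nat \<times> nat \<times> nat) list" and I F :: "nat list" and n :: nat
  assumes disj: "A \<inter> B = {}" and finA: "finite A" "card A \<le> n" and finB: "finite B" "card B \<le> n"
    and lang: "nfa_lang (tr, I, F) \<subseteq> lists (A \<union> B)"
    and shiftlag: "finite_shiftlag A B (nfa_lang (tr, I, F))"
    and size: "card (set I \<union> states tr) \<le> n"
begin

definition "Q = set I \<union> states tr"

lemma Q: "finite Q" "card Q \<le> n" "states tr \<subseteq> Q" "set I \<subseteq> Q"
  using size by (auto simp: Q_def states_def)

definition R :: "nat list \<Rightarrow> nat list \<Rightarrow> bool" where
  "R x y \<longleftrightarrow> (x, y) \<in> sem A B ` nfa_lang (tr, I, F)"

definition paths :: "nat set \<Rightarrow> nat list \<Rightarrow> (nat \<times> nat) list set" where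
  "paths C a = {ps \<in> lists (Q \<times> Q). length ps \<le> block_count n \<and> path_seq tr C ps a}"

text \<open>\<open>Desc p q\<close> describes the partial runs on \<open>(p, q)\<close> by the state reached and the unread rests \<open>a\<close>, \<open>b\<close>.
  In the part of bounded lag one rest is empty and the other short, so it can be kept verbatim (\<open>Type1\<close>); in
  front of boundedly many blocks it suffices to know the paths along which the rests can be read (\<open>Type2\<close>).\<close>

definition Desc :: "nat list \<Rightarrow> nat list \<Rightarrow> (nat \<times> nat list \<times> nat list) set" where
  "Desc p q = {(s, a, b). \<exists>p' q' w s0. p = p' @ a \<and> q = q' @ b \<and> s0 \<in> set I \<and> steps tr s0 w s \<and> sem A B w = (p', q')}"

definition Type1 :: "nat list \<Rightarrow> nat list \<Rightarrow> (nat \<times> nat list \<times> nat list) set" where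
  "Type1 p q = {(s, a, b) \<in> Desc p q. length a \<le> n \<and> length b \<le> n}"

definition Type2 :: "nat list \<Rightarrow> nat list \<Rightarrow> (nat \<times> (nat \<times> nat) list set \<times> (nat \<times> nat) list set) set" where
  "Type2 p q = (\<lambda>(s, a, b). (s, paths A a, paths B b)) ` Desc p q"

definition order_code :: "nat list \<Rightarrow> nat list \<Rightarrow> nat" where
  "order_code p q = (if length p = length q then 0 else if length p < length q then 1 else 2)"

text \<open>Truncating \<open>ps\<close> at the segment where \<open>a\<close> ends gives a list
  that is no longer than \<open>ps\<close> and so is among \<open>paths C a\<close>. It also reads
  \<open>a'\<close>, and \<open>x\<close> continues from the same state \<open>t\<close>.\<close>

lemma path_seq_paths:
  assumes "paths C a = paths C a'" "set ps \<subseteq> Q \<times> Q" "length ps \<le> block_count n" "path_seq tr C ps (a @ x)"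
  shows "path_seq tr C ps (a' @ x)"
proof -
  from path_seq_split[OF assms(4)] show ?thesis
  proof (elim disjE exE conjE)
    assume "ps = []" "a = []" "x = []"
    then have "[] \<in> paths C a" by (simp add: paths_def)
    then have "[] \<in> paths C a'" unfolding assms(1) .
    then show ?thesis using \<open>ps = []\<close> \<open>x = []\<close> by (simp add: paths_def)
  next
    fix ps1 r r' ps2 t v assume ps: "ps = ps1 @ (r, r') # ps2" and a: "path_seq tr C (ps1 @ [(r, t)]) a"
      and v: "steps tr r v t" and x: "path_seq tr C ((t, r') # ps2) x"
    have "t \<in> Q" using steps_in[OF v Q(3)] assms(2) ps by auto
    then have "ps1 @ [(r, t)] \<in> paths C a" using a assms(2,3) ps by (auto simp: paths_def)
    then have "path_seq tr C (ps1 @ [(r, t)]) a'" unfolding assms(1) by (simp add: paths_def)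
    then obtain y1 y2 where y: "a' = y1 @ y2" "path_seq tr C ps1 y1" "y2 \<in> lists C" "steps tr r y2 t"
      by (auto simp: path_seq_append)
    obtain x1 x2 where xx: "x = x1 @ x2" "x1 \<in> lists C" "steps tr t x1 r'" "path_seq tr C ps2 x2"
      using x by auto
    have "y2 @ x1 \<in> lists C" "steps tr r (y2 @ x1) r'"
      using y(3,4) xx(2,3) steps_append by (simp only: append_in_lists_conv, blast)
    then have "path_seq tr C ((r, r') # ps2) ((y2 @ x1) @ x2)"
      using xx(4) unfolding path_seq.simps fst_conv snd_conv by blast
    then show ?thesis unfolding ps path_seq_append using y(1,2) xx(1) by auto
  qed
qed

lemma R_I:
  assumes "(s, a, b) \<in> Desc p q" "steps tr s w f" "f \<in> set F" "sem A B w = (a @ x, b @ y)"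
  shows "R (p @ x) (q @ y)"
proof -
  obtain p' q' v s0 where d: "p = p' @ a" "q = q' @ b" "s0 \<in> set I" "steps tr s0 v s" "sem A B v = (p', q')"
    using assms(1) by (auto simp: Desc_def)
  have "steps tr s0 (v @ w) f" using d(4) assms(2) steps_append by blast
  then have "v @ w \<in> nfa_lang (tr, I, F)" using d(3) assms(3) by (auto simp: nfa_lang_def)
  moreover have "sem A B (v @ w) = (p @ x, q @ y)" using d assms(4) by (simp add: sem_append)
  ultimately show ?thesis unfolding R_def by (metis image_eqI)
qed

lemma R_Type1:
  assumes "Type1 p q = Type1 p' q'" "(s, a, b) \<in> Desc p q" "length a \<le> n" "length b \<le> n"
    "steps tr s w f" "f \<in> set F" "sem A B w = (a @ x, b @ y)"
  shows "R (p' @ x) (q' @ y)"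
proof -
  have "(s, a, b) \<in> Type1 p q" using assms(2-4) by (simp add: Type1_def)
  then have "(s, a, b) \<in> Desc p' q'" unfolding assms(1) by (simp add: Type1_def)
  then show ?thesis using R_I assms(5-7) by blast
qed

lemma R_Type2:
  assumes "Type2 p q = Type2 p' q'" "(s, a, b) \<in> Desc p q" "block_run tr A (block_count n) s w f"
    "f \<in> set F" "w \<in> lists (A \<union> B)" "sem A B w = (a @ x, b @ y)"
  shows "R (p' @ x) (q' @ y)"
proof -
  have "(s, paths A a, paths B b) \<in> Type2 p q" using assms(2) by (force simp: Type2_def)
  then obtain a' b' where ab: "(s, a', b') \<in> Desc p' q'" "paths A a = paths A a'" "paths B b = paths B b'"
    unfolding assms(1) by (auto simp: Type2_def)
  have "s \<in> Q" using assms(2) steps_in[OF _ Q(3)] Q(4) by (auto simp: Desc_def)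
  from block_run_path_seq[OF assms(3,5) disj Q(3) this] assms(6) obtain xs ys where
    xy: "length xs \<le> block_count n" "length ys \<le> block_count n" "set xs \<subseteq> Q \<times> Q" "set ys \<subseteq> Q \<times> Q"
    "path_seq tr A xs (a @ x)" "path_seq tr B ys (b @ y)"
    and re: "\<And>x y. path_seq tr A xs x \<Longrightarrow> path_seq tr B ys y \<Longrightarrow> \<exists>w'. steps tr s w' f \<and> sem A B w' = (x, y)"
    unfolding sem_def by auto
  from re[OF path_seq_paths[OF ab(2) xy(3,1,5)] path_seq_paths[OF ab(3) xy(4,2,6)]]
  obtain w' where "steps tr s w' f" "sem A B w' = (a' @ x, b' @ y)" by blast
  then show ?thesis using R_I[OF ab(1)] assms(4) by blast
qed

lemma append_eq_take: "u @ v = p @ x \<Longrightarrow> length u \<le> length p \<Longrightarrow> u = take (length u) p \<and> v = drop (length u) p @ x"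
  by (metis append_eq_conv_conj drop_append diff_is_0_eq' drop0 take_append append_Nil2 take0)

text \<open>A run on the extended pair is stopped when \<open>p\<close> or \<open>q\<close> is used
  up, or when its part of bounded lag ends first. In the latter case only boundedly many blocks
  remain and \<open>Type2\<close> applies.\<close>

lemma R_determined:
  assumes R: "R (p @ x) (q @ y)" and len: "length q < length p \<longrightarrow> y = []" "length p < length q \<longrightarrow> x = []"
    and T1: "Type1 p q = Type1 p' q'" and T2: "Type2 p q = Type2 p' q'"
  shows "R (p' @ x) (q' @ y)"
proof -
  obtain w where wL: "w \<in> nfa_lang (tr, I, F)" and sem: "sem A B w = (p @ x, q @ y)"
    using R unfolding R_def by (metis imageE)
  then obtain s0 f where w: "w \<in> nfa_lang (tr, I, F)" "s0 \<in> set I" "f \<in> set F" "steps tr s0 w f"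
    by (auto simp: nfa_lang_def)
  have wl: "w \<in> lists (A \<union> B)" using w(1) lang by blast
  obtain w1 w2 r where dec: "w = w1 @ w2" "steps tr s0 w1 r" "block_run tr A (block_count n) r w2 f"
    "\<And>i. \<bar>balance A B (take i w1)\<bar> \<le> int n"
    using bounded_lag_decomposition[OF shiftlag Q w(2,3,4)] unfolding block_count_def by metis
  define a where "a i = length (fst (sem A B (take i w1)))" for i
  define b where "b i = length (snd (sem A B (take i w1)))" for i
  have lag: "\<bar>int (a i) - int (b i)\<bar> \<le> int n" for i
    using dec(4)[of i] by (simp add: a_def b_def sem_def balance_def)
  have desc: "(s, drop (a i) p, drop (b i) q) \<in> Desc p q \<and> sem A B (drop i w1 @ w2) = (drop (a i) p @ x, drop (b i) q @ y)"
    if s: "steps tr s0 (take i w1) s" and le: "a i \<le> length p" "b i \<le> length q" for i s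
  proof -
    obtain u v where uv: "sem A B (take i w1) = (u, v)" by fastforce
    obtain u' v' where uv': "sem A B (drop i w1 @ w2) = (u', v')" by fastforce
    have "w = take i w1 @ (drop i w1 @ w2)" using dec(1) by simp
    then have "u @ u' = p @ x" "v @ v' = q @ y" using sem uv uv' by (metis sem_append fst_conv snd_conv)+
    then have "u = take (a i) p \<and> u' = drop (a i) p @ x" "v = take (b i) q \<and> v' = drop (b i) q @ y"
      using append_eq_take[of u u' p x] append_eq_take[of v v' q y] le uv by (auto simp: a_def b_def)
    moreover from this have "(s, drop (a i) p, drop (b i) q) \<in> Desc p q"
      unfolding Desc_def mem_Collect_eq prod.case using s w(2) uv by (metis append_take_drop_id)
    ultimately show ?thesis using uv' by simp
  qed
  show ?thesis
  proof (cases "\<exists>i. length p \<le> a i \<or> length q \<le> b i")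
    case False
    then have le: "a (length w1) \<le> length p" "b (length w1) \<le> length q" by (auto simp: not_le less_imp_le)
    have w2: "w2 \<in> lists (A \<union> B)" using wl dec(1) by simp
    let ?a = "drop (a (length w1)) p" and ?b = "drop (b (length w1)) q"
    have "(r, ?a, ?b) \<in> Desc p q" "sem A B w2 = (?a @ x, ?b @ y)"
      using desc[OF _ le, of r] dec(2) by simp_all
    then show ?thesis using R_Type2[OF T2 _ dec(3) w(3) w2] by blast
  next
    case True
    \<comment> \<open>At this first moment neither \<open>p\<close> nor \<open>q\<close> is overrun,
      because one further letter raises only one of the two counts, and by 1.\<close>
    define i where "i = (LEAST i. length p \<le> a i \<or> length q \<le> b i)"
    have i: "length p \<le> a i \<or> length q \<le> b i" unfolding i_def using True by (rule LeastI_ex)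
    have "a i \<le> length p \<and> b i \<le> length q"
    proof (cases i)
      case 0
      then show ?thesis by (simp add: a_def b_def sem_def)
    next
      case (Suc j)
      have "\<not> (length p \<le> a j \<or> length q \<le> b j)"
        using not_less_Least[of j "\<lambda>i. length p \<le> a i \<or> length q \<le> b i"] Suc unfolding i_def by simp
      moreover have "a i \<le> Suc (a j)" "b i \<le> Suc (b j)"
        unfolding Suc a_def b_def sem_def by (cases "j < length w1"; simp add: take_Suc_conv_app_nth)+
      ultimately show ?thesis by linarith
    qed
    then have le: "a i \<le> length p" "b i \<le> length q" by auto
    obtain s where s: "steps tr s0 (take i w1) s" "steps tr s (drop i w1 @ w2) f"
      using w(4) dec(1) steps_append by (metis append.assoc append_take_drop_id)
    note d = desc[OF s(1) le]
    let ?v = "drop i w1 @ w2"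
    have vl: "?v \<in> lists (A \<union> B)"
    proof -
      have "w = take i w1 @ ?v" using dec(1) by simp
      then show ?thesis using wl by (metis append_in_lists_conv)
    qed
    \<comment> \<open>If the word just used up is not the shorter one, the bound on the lag makes
      the other rest short. Otherwise the shorter component is complete by the convention of
      \<open>residual\<close>, and what remains to be read is over one alphabet, that is, a single
      block.\<close>
    consider "length p - a i \<le> n" "length q - b i \<le> n"
      | "length q = b i" "y = []" | "length p = a i" "x = []"
      using i le lag[of i] len by (cases "length p" "length q" rule: linorder_cases) auto
    then show ?thesis
    proof cases
      case 1
      then show ?thesis using R_Type1[OF T1 _ _ _ s(2) w(3)] d by auto
    next
      case 2
      then have "set ?v \<inter> B = {}" using d by (auto simp: sem_def filter_empty_conv)
      then have "homogeneous A ?v" using vl by (auto simp: homogeneous_def)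
      then have "block_run tr A (Suc 0) s ?v f" using s(2) by auto
      then have "block_run tr A (block_count n) s ?v f" by (rule block_run_mono) (simp add: block_count_def)
      then show ?thesis using R_Type2[OF T2 _ _ w(3) vl] d by blast
    next
      case 3
      then have "set ?v \<inter> A = {}" using d by (auto simp: sem_def filter_empty_conv)
      then have "homogeneous A ?v" by (auto simp: homogeneous_def)
      then have "block_run tr A (Suc 0) s ?v f" using s(2) by auto
      then have "block_run tr A (block_count n) s ?v f" by (rule block_run_mono) (simp add: block_count_def)
      then show ?thesis using R_Type2[OF T2 _ _ w(3) vl] d by blast
    qed
  qed
qed

lemma card_Pow_le: "finite X \<Longrightarrow> card X \<le> m \<Longrightarrow> card (Pow X) \<le> 2 ^ m"
  by (simp add: card_Pow)

text \<open>\<open>order_code\<close> joins the two types since the side conditions of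
  \<open>residual\<close> depend on the length comparison.\<close>

theorem few_residuals_R: "few_residuals A B (residual_bound n) R"
proof -
  let ?WA = "{w \<in> lists A. length w \<le> n}" and ?WB = "{w \<in> lists B. length w \<le> n}"
  let ?P = "{ps \<in> lists (Q \<times> Q). length ps \<le> block_count n}"
  let ?Y = "{0, 1, 2 :: nat} \<times> (Pow (Q \<times> (?WA \<times> ?WB)) \<times> Pow (Q \<times> (Pow ?P \<times> Pow ?P)))"
  define t where "t = (\<lambda>(p, q). (order_code p q, Type1 p q, Type2 p q))"
  have QQ: "finite (Q \<times> Q)" "card (Q \<times> Q) \<le> n * n" using Q by (simp_all add: card_cartesian_product mult_le_mono)
  have WA: "finite ?WA" "card ?WA \<le> word_bound n" and WB: "finite ?WB" "card ?WB \<le> word_bound n"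
    unfolding word_bound_def by (rule card_words_le[OF finA] card_words_le[OF finB])+
  have P: "finite ?P" "card ?P \<le> path_bound n"
    unfolding path_bound_def by (rule card_words_le[OF QQ])+
  have PP: "finite (Pow ?P)" "card (Pow ?P) \<le> 2 ^ path_bound n" using P by (simp_all add: card_Pow_le)
  have f1: "finite (Q \<times> (?WA \<times> ?WB))" and f2: "finite (Q \<times> (Pow ?P \<times> Pow ?P))"
    by (intro finite_cartesian_product Q WA WB PP)+
  have finY: "finite ?Y"
    by (rule finite_cartesian_product[OF _ finite_cartesian_product[OF finite_Pow_iff[THEN iffD2, OF f1] finite_Pow_iff[THEN iffD2, OF f2]]]) simp
  have c3: "card {0, 1, 2 :: nat} \<le> 3" by simp
  have cY: "card ?Y \<le> residual_bound n"
    unfolding residual_bound_def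
    by (rule card_Times_le[OF c3 card_Times_le[OF
          card_Pow_le[OF f1 card_Times_le[OF Q(2) card_Times_le[OF WA(2) WB(2)]]]
          card_Pow_le[OF f2 card_Times_le[OF Q(2) card_Times_le[OF PP(2) PP(2)]]]]])
  have tt: "t (p, q) \<in> ?Y" if pq: "p \<in> lists A" "q \<in> lists B" for p q
  proof -
    have D: "s \<in> Q \<and> a \<in> lists A \<and> b \<in> lists B" if d: "(s, a, b) \<in> Desc p q" for s a b
    proof -
      from d obtain p' q' w s0 where "p = p' @ a" "q = q' @ b" "s0 \<in> set I" "steps tr s0 w s"
        by (auto simp: Desc_def)
      then show ?thesis using steps_in[OF _ Q(3), of s0 w s] Q(4) pq by auto
    qed
    have "order_code p q \<in> {0, 1, 2}" by (simp add: order_code_def)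
    moreover have "Type1 p q \<in> Pow (Q \<times> (?WA \<times> ?WB))"
    proof (intro PowI subsetI)
      fix z assume "z \<in> Type1 p q"
      then obtain s a b where z: "z = (s, a, b)" "(s, a, b) \<in> Desc p q" "length a \<le> n" "length b \<le> n"
        by (auto simp: Type1_def)
      then show "z \<in> Q \<times> (?WA \<times> ?WB)" using D[OF z(2)] by simp
    qed
    moreover have "Type2 p q \<in> Pow (Q \<times> (Pow ?P \<times> Pow ?P))"
    proof (intro PowI subsetI)
      fix z assume "z \<in> Type2 p q"
      then obtain s a b where z: "z = (s, paths A a, paths B b)" "(s, a, b) \<in> Desc p q"
        by (auto simp: Type2_def)
      then show "z \<in> Q \<times> (Pow ?P \<times> Pow ?P)" using D[OF z(2)] unfolding paths_def by blast
    qed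
    ultimately show ?thesis unfolding t_def prod.case by (intro SigmaI)
  qed
  have tY: "t ` (lists A \<times> lists B) \<subseteq> ?Y"
  proof (rule image_subsetI)
    fix z assume "z \<in> lists A \<times> lists B"
    then obtain p q where "p \<in> lists A" "q \<in> lists B" "z = (p, q)" by (rule SigmaE)
    then show "t z \<in> ?Y" using tt by (simp only:)
  qed
  have det: "residual R p q \<subseteq> residual R p' q'" if "t (p, q) = t (p', q')" for p q p' q'
  proof
    fix z assume z: "z \<in> residual R p q"
    obtain x y where xy: "z = (x, y)" by fastforce
    have eq: "order_code p q = order_code p' q'" "Type1 p q = Type1 p' q'" "Type2 p q = Type2 p' q'"
      using that by (simp_all add: t_def)
    have "length q < length p \<longleftrightarrow> length q' < length p'" "length p < length q \<longleftrightarrow> length p' < length q'"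
      using eq(1) by (auto simp: order_code_def split: if_splits)
    then show "z \<in> residual R p' q'"
      using z R_determined[OF _ _ _ eq(2,3), of x y] by (simp add: xy residual_def)
  qed
  have det': "(case c of (p, q) \<Rightarrow> residual R p q) = (case d of (p, q) \<Rightarrow> residual R p q)" if "t c = t d" for c d
  proof -
    obtain p q p' q' where cd: "c = (p, q)" "d = (p', q')" by (metis surj_pair)
    show ?thesis using det[OF that[unfolded cd]] det[OF that[unfolded cd, symmetric]]
      by (simp only: cd prod.case)
  qed
  have "finite (residuals A B R)" "card (residuals A B R) \<le> card ?Y"
    unfolding residuals_def[of A B R] by (rule card_image_determined[OF det' tY finY], assumption)+
  then show ?thesis unfolding few_residuals_def using le_trans[OF _ cY] by blast
qed

end

section \<open>The decision procedure\<close>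

text \<open>Phrased with \<open>rec_nat\<close>, \<open>concat\<close> and \<open>map\<close> so
  that the computability rules apply directly; \<open>accepts\<close> uses \<open>foldl\<close> and
  projections for the same reason.\<close>

definition words :: "'a list \<Rightarrow> nat \<Rightarrow> 'a list list" where
  "words xs n = rec_nat [[]] (\<lambda>_ W. concat (map (\<lambda>a. map (\<lambda>w. a # w) W) xs)) n"

definition words_le :: "'a list \<Rightarrow> nat \<Rightarrow> 'a list list" where
  "words_le xs n = concat (map (\<lambda>i. words xs i) [0..<Suc n])"

lemma set_words: "set (words xs n) = {w \<in> lists (set xs). length w = n}"
proof (induction n)
  case (Suc n)
  have "words xs (Suc n) = concat (map (\<lambda>a. map (\<lambda>w. a # w) (words xs n)) xs)"
    by (simp add: words_def)
  then show ?case using Suc by (auto simp: length_Suc_conv image_iff)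
qed (auto simp: words_def)

lemma set_words_le: "set (words_le xs n) = {w \<in> lists (set xs). length w \<le> n}"
  by (auto simp: words_le_def set_words)

definition accepts :: "nfa \<Rightarrow> nat list \<Rightarrow> bool" where
  "accepts M w \<longleftrightarrow> (\<exists>q \<in> set (snd (snd M)). q \<in> set (foldl
     (\<lambda>P a. map (\<lambda>t. snd (snd t)) (filter (\<lambda>t. fst (snd t) = a \<and> fst t \<in> set P) (fst M)))
     (fst (snd M)) w))"

lemma accepts_iff: "accepts M w \<longleftrightarrow> w \<in> nfa_lang M"
proof -
  obtain tr I F where M: "M = (tr, I, F)" by (metis surj_pair)
  define step where "step P a = map (\<lambda>t. snd (snd t)) (filter (\<lambda>t. fst (snd t) = a \<and> fst t \<in> set P) tr)" for P a
  have set_step: "q \<in> set (step P a) \<longleftrightarrow> (\<exists>p \<in> set P. (p, a, q) \<in> set tr)" for P a q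
    unfolding step_def by force
  have "q \<in> set (foldl step P w) \<longleftrightarrow> (\<exists>p \<in> set P. steps tr p w q)" for P q
  proof (induction w arbitrary: P)
    case Nil
    then show ?case by (auto intro: steps_nil elim: steps.cases)
  next
    case (Cons a w)
    have "steps tr p (a # w) q \<longleftrightarrow> (\<exists>p'. (p, a, p') \<in> set tr \<and> steps tr p' w q)" for p
      by (auto intro: steps_cons elim: steps.cases)
    then show ?case unfolding foldl.simps Cons.IH using set_step[of _ P a] by blast
  qed
  then show ?thesis by (auto simp: accepts_def nfa_lang_def M step_def[abs_def])
qed

text \<open>Over disjoint alphabets a word with projections \<open>x\<close> and \<open>y\<close>
  has exactly \<open>length x + length y\<close> letters, so the search is finite.\<close>

definition rel_test :: "nat list \<Rightarrow> nat list \<Rightarrow> nfa \<Rightarrow> nat list \<Rightarrow> nat list \<Rightarrow> bool" where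
  "rel_test Sig Gam M x y \<longleftrightarrow> (\<exists>w \<in> set (words (Sig @ Gam) (length x + length y)).
     accepts M w \<and> filter (\<lambda>c. c \<in> set Sig) w = x \<and> filter (\<lambda>c. c \<in> set Gam) w = y)"

definition pairs :: "'a list \<Rightarrow> 'b list \<Rightarrow> ('a \<times> 'b) list" where
  "pairs xs ys = concat (map (\<lambda>a. map (\<lambda>b. (a, b)) ys) xs)"

lemma set_pairs: "set (pairs xs ys) = set xs \<times> set ys"
  by (auto simp: pairs_def)

definition prefix_test :: "nat list \<Rightarrow> nat list \<Rightarrow> nfa \<Rightarrow> (nat \<times> nat) list \<Rightarrow> bool" where
  "prefix_test Sig Gam M u \<longleftrightarrow> accepts M (concat (map (\<lambda>p. [fst p, snd p]) u)) \<and>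
     (\<forall>q \<in> set (pairs Sig Gam). accepts M (concat (map (\<lambda>p. [fst p, snd p]) (u @ [q]))))"

definition residual_test :: "nat list \<Rightarrow> nat list \<Rightarrow> nfa \<Rightarrow> nfa \<Rightarrow> (nat \<times> nat) list \<Rightarrow> nat list \<Rightarrow> nat list \<Rightarrow> bool" where
  "residual_test Sig Gam M M' u x y \<longleftrightarrow> rel_test Sig Gam M (map fst u @ x) (map snd u @ y) \<and>
     \<not> (x \<noteq> [] \<and> y \<noteq> [] \<and> prefix_test Sig Gam M' (u @ [(hd x, hd y)]))"

definition rows_test :: "nat list \<Rightarrow> nat list \<Rightarrow> nfa \<Rightarrow> nfa \<Rightarrow> nat \<Rightarrow> nat \<Rightarrow> (nat \<times> nat) list \<Rightarrow> bool" where
  "rows_test Sig Gam M M' N b u \<longleftrightarrow> (\<forall>x0 \<in> set (words Sig N). \<exists>x1 \<in> set (words_le Sig (N - 1)).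
     \<forall>g \<in> set (words_le Sig b). \<forall>y \<in> set (words_le Gam b).
       residual_test Sig Gam M M' u (x0 @ g) y = residual_test Sig Gam M M' u (x1 @ g) y)"

definition row_length :: "nat \<Rightarrow> nat" where
  "row_length K = 2 ^ K + 2 ^ (K * K)"

text \<open>The bound of \<open>few_residuals_eq\<close> for two relations shifted by words of
  length at most \<open>row_length K\<close>, each with the number of residuals given by
  \<open>few_residuals_shift\<close>.\<close>

definition context_bound :: "nat \<Rightarrow> nat \<Rightarrow> nat" where
  "context_bound n K = 2 * ((3 * (K * (Suc (row_length K) * Suc n ^ row_length K))) *
     (3 * (K * (Suc (row_length K) * Suc n ^ row_length K))))"

text \<open>\<open>2 * K\<close> comes from comparing \<open>R\<close> with the empty relation,
  which has one residual. \<open>K * 2 ^ m\<close> bounds the classes of \<open>\<kappa>\<close>: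
  \<open>K\<close> residuals times \<open>2 ^ m\<close> quotients. \<open>K + 2\<close> is the
  residual bound of \<open>rest_rel u\<close>.\<close>

definition Rel_test :: "nat list \<Rightarrow> nat list \<Rightarrow> nfa \<Rightarrow> nfa \<Rightarrow> nat \<Rightarrow> nat \<Rightarrow> nat \<Rightarrow> bool" where
  "Rel_test Sig Gam M M' n m K \<longleftrightarrow>
     ((\<exists>x \<in> set (words_le Sig (2 * K)). \<exists>y \<in> set (words_le Gam (2 * K)). rel_test Sig Gam M x y) \<longrightarrow>
       prefix_test Sig Gam M' []) \<and>
     (\<forall>u \<in> set (words_le (pairs Sig Gam) (K * 2 ^ m)). prefix_test Sig Gam M' u \<longrightarrow>
       rows_test Sig Gam M M' (row_length (K + 2)) (context_bound n (K + 2)) u)"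

definition full_test :: "nat list \<Rightarrow> nat list \<Rightarrow> nfa \<Rightarrow> nfa \<Rightarrow> nat \<Rightarrow> bool" where
  "full_test Sig Gam M M' n \<longleftrightarrow>
     Rel_test Sig Gam M M' n (length (fst (snd M')) + length (fst M')) (residual_bound n)"

text \<open>The size parameter dominates both alphabets and the state set of \<open>M\<close>, to
  which a transition contributes up to two states. For \<open>M'\<close> only initial states and
  targets matter, so \<open>full_test\<close> counts transitions once.\<close>

definition decision :: "nat list \<Rightarrow> nat list \<Rightarrow> nfa \<Rightarrow> nfa \<Rightarrow> bool" where
  "decision Sig Gam M M' \<longleftrightarrow>
     full_test Sig Gam M M' (length Sig + length Gam + (length (fst (snd M)) + 2 * length (fst M)))"

section \<open>Computability of the tests\<close>

lemma computable_words: "computable (\<lambda>p. words (fst p) (snd p) :: 'a::encodable list list)"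
  unfolding words_def by (intro computable_intros)

lemma computable_words_le: "computable (\<lambda>p. words_le (fst p) (snd p) :: 'a::encodable list list)"
  unfolding words_le_def by (intro computable_intros computable_comp2[OF computable_words])

lemma computable_accepts: "computable (\<lambda>p. accepts (fst p) (snd p))"
  unfolding accepts_def by (intro computable_intros)

lemmas computable_intros1 = computable_intros computable_comp2[OF computable_words] computable_comp2[OF computable_words_le] computable_comp2[OF computable_accepts]

lemma computable_rel_test: "computable (\<lambda>p. rel_test (fst p) (fst (snd p)) (fst (snd (snd p)))
    (fst (snd (snd (snd p)))) (snd (snd (snd (snd p)))))"
  unfolding rel_test_def by (intro computable_intros1)

lemma computable_prefix_test: "computable (\<lambda>p. prefix_test (fst p) (fst (snd p)) (fst (snd (snd p))) (snd (snd (snd p))))"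
  unfolding prefix_test_def pairs_def by (intro computable_intros1)


lemma computable_rel_test':
  assumes "computable a" "computable b" "computable c" "computable d" "computable e"
  shows "computable (\<lambda>z. rel_test (a z) (b z) (c z) (d z) (e z))"
  using computable_comp[OF computable_rel_test computable_Pair[OF assms(1) computable_Pair[OF assms(2) computable_Pair[OF assms(3)
    computable_Pair[OF assms(4,5)]]]]] by (simp only: fst_conv snd_conv)

lemma computable_prefix_test':
  assumes "computable a" "computable b" "computable c" "computable d"
  shows "computable (\<lambda>z. prefix_test (a z) (b z) (c z) (d z))"
  using computable_comp[OF computable_prefix_test computable_Pair[OF assms(1) computable_Pair[OF assms(2) computable_Pair[OF assms(3,4)]]]]
  by (simp only: fst_conv snd_conv)

lemma computable_residual_test: "computable (\<lambda>p. residual_test (fst p) (fst (snd p)) (fst (snd (snd p)))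
    (fst (snd (snd (snd p)))) (fst (snd (snd (snd (snd p))))) (fst (snd (snd (snd (snd (snd p))))))
    (snd (snd (snd (snd (snd (snd p)))))))"
  unfolding residual_test_def by (intro computable_intros computable_rel_test' computable_prefix_test')

lemma computable_residual_test':
  assumes "computable a" "computable b" "computable c" "computable d" "computable e" "computable f" "computable g"
  shows "computable (\<lambda>z. residual_test (a z) (b z) (c z) (d z) (e z) (f z) (g z))"
  using computable_comp[OF computable_residual_test computable_Pair[OF assms(1) computable_Pair[OF assms(2) computable_Pair[OF assms(3)
    computable_Pair[OF assms(4) computable_Pair[OF assms(5) computable_Pair[OF assms(6,7)]]]]]]] by (simp only: fst_conv snd_conv)

lemma computable_rows_test: "computable (\<lambda>p. rows_test (fst p) (fst (snd p)) (fst (snd (snd p)))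
    (fst (snd (snd (snd p)))) (fst (snd (snd (snd (snd p))))) (fst (snd (snd (snd (snd (snd p))))))
    (snd (snd (snd (snd (snd (snd p)))))))"
  unfolding rows_test_def by (intro computable_intros1 computable_residual_test')

lemma computable_rows_test':
  assumes "computable a" "computable b" "computable c" "computable d" "computable e" "computable f" "computable g"
  shows "computable (\<lambda>z. rows_test (a z) (b z) (c z) (d z) (e z) (f z) (g z))"
  using computable_comp[OF computable_rows_test computable_Pair[OF assms(1) computable_Pair[OF assms(2) computable_Pair[OF assms(3)
    computable_Pair[OF assms(4) computable_Pair[OF assms(5) computable_Pair[OF assms(6,7)]]]]]]] by (simp only: fst_conv snd_conv)

lemma computable_row_length: "computable row_length"
  unfolding row_length_def[abs_def] by (intro computable_intros)

lemma computable_context_bound: "computable (\<lambda>p. context_bound (fst p) (snd p))"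
  unfolding context_bound_def by (intro computable_intros computable_comp[OF computable_row_length])

lemma computable_residual_bound: "computable residual_bound"
  unfolding residual_bound_def[abs_def] word_bound_def path_bound_def block_count_def by (intro computable_intros)

lemma computable_Rel_test: "computable (\<lambda>p. Rel_test (fst p) (fst (snd p)) (fst (snd (snd p)))
    (fst (snd (snd (snd p)))) (fst (snd (snd (snd (snd p))))) (fst (snd (snd (snd (snd (snd p))))))
    (snd (snd (snd (snd (snd (snd p)))))))"
  unfolding Rel_test_def pairs_def
  by (intro computable_intros1 computable_rel_test' computable_prefix_test' computable_rows_test' computable_comp[OF computable_row_length]
      computable_comp2[OF computable_context_bound])

lemma computable_Rel_test':
  assumes "computable a" "computable b" "computable c" "computable d" "computable e" "computable f" "computable g"
  shows "computable (\<lambda>z. Rel_test (a z) (b z) (c z) (d z) (e z) (f z) (g z))"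
  using computable_comp[OF computable_Rel_test computable_Pair[OF assms(1) computable_Pair[OF assms(2) computable_Pair[OF assms(3)
    computable_Pair[OF assms(4) computable_Pair[OF assms(5) computable_Pair[OF assms(6,7)]]]]]]] by (simp only: fst_conv snd_conv)

definition decode_nfa :: "nat \<Rightarrow> nfa" where
  "decode_nfa c =
     (map (\<lambda>t. (hd (list_decode t), hd (tl (list_decode t)), hd (tl (tl (list_decode t)))))
        (list_decode (hd (list_decode c))),
      list_decode (hd (tl (list_decode c))), list_decode (hd (tl (tl (list_decode c)))))"

lemma decode_enc_nfa: "decode_nfa (enc_nfa M) = M"
  by (cases M) (auto simp: decode_nfa_def enc_nfa_def o_def case_prod_beta)

lemma computable_decode_nfa: "computable f \<Longrightarrow> computable (\<lambda>x. decode_nfa (f x))"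
  by (rule computable_comp[of decode_nfa]) (auto simp: decode_nfa_def[abs_def] intro!: computable_intros)

text \<open>Works on raw numbers: \<open>enc_input\<close> codes a transition as a list of three
  numbers, whereas \<open>enc\<close> would code it as a nested pair.\<close>

definition decide_code :: "nat \<Rightarrow> bool" where
  "decide_code c = decision (list_decode (hd (list_decode c))) (list_decode (hd (tl (list_decode c))))
     (decode_nfa (hd (tl (tl (list_decode c))))) (decode_nfa (hd (tl (tl (tl (list_decode c))))))"

lemma decide_enc_input: "decide_code (enc_input Sig Gam AS AT) = decision Sig Gam AS AT"
  by (simp add: decide_code_def enc_input_def decode_enc_nfa)

lemma computable_decide_code: "computable decide_code"
  unfolding decide_code_def[abs_def] decision_def full_test_def
  by (intro computable_intros computable_Rel_test' computable_comp[OF computable_residual_bound] computable_decode_nfa)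

section \<open>Bounds on the words that have to be tested\<close>

context sync_target
begin

text \<open>Among more than \<open>K * M\<close> prefixes two lie in the same class; since
  \<open>\<kappa>\<close> is a right congruence, the factor between them can be removed without
  changing the class of \<open>u\<close>.\<close>

lemma \<kappa>_short:
  assumes M: "card ((\<lambda>p. left_quotient p V) ` lists (A \<times> B)) \<le> M"
  shows "u \<in> lists (A \<times> B) \<Longrightarrow> \<exists>u' \<in> lists (A \<times> B). length u' \<le> K * M \<and> \<kappa> u' = \<kappa> u"
proof (induction "length u" arbitrary: u rule: less_induct)
  case less
  let ?S = "residuals A B R \<times> (\<lambda>p. left_quotient p V) ` lists (A \<times> B)"
  show ?case
  proof (cases "length u \<le> K * M")
    case False
    have "finite ((\<lambda>p. left_quotient p V) ` lists (A \<times> B))"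
      using finite_quotients_V unfolding finite_quotients_def by (rule rev_finite_subset) auto
    then have S: "finite ?S" "card ?S \<le> K * M"
      using rbR M by (simp_all add: few_residuals_def card_cartesian_product mult_le_mono)
    have "\<kappa> (take i u) \<in> ?S" for i
      unfolding \<kappa>_def using lists_take[OF less.prems, of i] pair_lists[of "take i u"]
      by (intro SigmaI residual_in_residuals imageI) blast+
    then obtain i j where ij: "i < j" "j \<le> K * M" "\<kappa> (take i u) = \<kappa> (take j u)"
      using pigeonhole_le[OF S, of "\<lambda>i. \<kappa> (take i u)"] by metis
    let ?u = "take i u @ drop j u"
    have "?u \<in> lists (A \<times> B)" 
      using lists_take[OF less.prems] lists_drop[OF less.prems] by (simp only: append_in_lists_conv)
    moreover have "length ?u < length u" using ij False by simp
    moreover have "\<kappa> ?u = \<kappa> u" using \<kappa>_append[OF ij(3), of "drop j u"] by simp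
    ultimately show ?thesis using less.hyps[of ?u] by metis
  qed (use less.prems in blast)
qed

lemma few_residuals_False: "few_residuals A B 1 (\<lambda>_ _. False)"
proof -
  have "residuals A B (\<lambda>_ _. False) \<subseteq> {{}}" by (auto simp: residuals_def residual_def)
  from card_mono[OF _ this] finite_subset[OF this] show ?thesis by (simp add: few_residuals_def)
qed

lemma R_nonempty_iff:
  "(\<exists>x y. R x y) \<longleftrightarrow>
    (\<exists>x \<in> lists A. \<exists>y \<in> lists B. length x \<le> 2 * K \<and> length y \<le> 2 * K \<and> R x y)"
proof
  assume "\<exists>x y. R x y"
  then obtain x y where xy: "R x y" by blast
  show "\<exists>x \<in> lists A. \<exists>y \<in> lists B. length x \<le> 2 * K \<and> length y \<le> 2 * K \<and> R x y"
  proof (rule ccontr)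
    assume neg: "\<not> ?thesis"
    have "R x y = False"
    proof (rule few_residuals_eq[OF rbR few_residuals_False])
      fix x y assume "x \<in> lists A" "y \<in> lists B" "length x \<le> 2 * (K * 1)" "length y \<le> 2 * (K * 1)"
      then show "R x y = False" using neg unfolding mult_1_right by blast
    qed (use R_lists[OF xy] in blast)+
    then show False using xy by simp
  qed
qed blast

text \<open>That \<open>x0\<close> and \<open>x1\<close> agree in all contexts is an equality of two
  shifted relations with few residuals, so short contexts decide it.\<close>

lemma finite_row_iff_bounded:
  assumes u: "u \<in> lists (A \<times> B)" and n: "card A \<le> n"
  shows "finite (row u ` lists A) \<longleftrightarrow>
    (\<forall>x0 \<in> lists A. length x0 = row_length (K + 2) \<longrightarrow>
      (\<exists>x1 \<in> lists A. length x1 < row_length (K + 2) \<and>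
       (\<forall>g \<in> lists A. \<forall>y \<in> lists B. length g \<le> context_bound n (K + 2) \<longrightarrow>
          length y \<le> context_bound n (K + 2) \<longrightarrow> rest_rel u (x0 @ g) y = rest_rel u (x1 @ g) y)))"
proof -
  let ?N = "row_length (K + 2)" and ?b = "context_bound n (K + 2)"
  have few_residuals: "few_residuals A B (K + 2) (rest_rel u)" by (rule few_residuals_rest_rel[OF u])
  have eq: "(\<forall>g \<in> lists A. \<forall>y \<in> lists B. rest_rel u (x0 @ g) y = rest_rel u (x1 @ g) y) \<longleftrightarrow>
      (\<forall>g \<in> lists A. \<forall>y \<in> lists B. length g \<le> ?b \<longrightarrow> length y \<le> ?b \<longrightarrow> rest_rel u (x0 @ g) y = rest_rel u (x1 @ g) y)"
    if x: "x0 \<in> lists A" "length x0 \<le> ?N" "x1 \<in> lists A" "length x1 \<le> ?N" for x0 x1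
  proof (rule iffI; (intro ballI)?)
    fix g y assume *: "\<forall>g \<in> lists A. \<forall>y \<in> lists B. length g \<le> ?b \<longrightarrow> length y \<le> ?b \<longrightarrow>
      rest_rel u (x0 @ g) y = rest_rel u (x1 @ g) y" and g: "g \<in> lists A" and y: "y \<in> lists B"
    show "rest_rel u (x0 @ g) y = rest_rel u (x1 @ g) y"
      using few_residuals_eq[OF few_residuals_shift[OF few_residuals finA n x(1,2)] few_residuals_shift[OF few_residuals finA n x(3,4)] _ g y] *
      unfolding context_bound_def by blast
  qed blast
  show ?thesis
    unfolding row_def[abs_def] finite_rows_iff[OF few_residuals finA row_length_def]
    by (intro ball_cong refl imp_cong bex_cong conj_cong eq) auto
qed

end

text \<open>Two adjacent pairs contain a letter of \<open>B\<close> followed by a letter of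
  \<open>A\<close>, which cannot occur in \<open>v @ x\<close>.\<close>

lemma flat_sorted_length:
  assumes "flat ps = v @ x" "v \<in> lists A" "x \<in> lists B" "ps \<in> lists (A \<times> B)" "A \<inter> B = {}"
  shows "length ps \<le> 1"
proof (rule ccontr)
  assume "\<not> length ps \<le> 1"
  then obtain p q r where ps: "ps = p # q # r" by (cases ps; cases "tl ps") auto
  have pq: "fst p \<in> A" "snd p \<in> B" "fst q \<in> A" using assms(4) ps by auto
  have eq: "v @ x = fst p # snd p # fst q # snd q # flat r" using assms(1) ps by simp
  show False
  proof (cases v)
    case Nil
    then show False using eq assms(3,5) pq by auto
  next
    case (Cons c v')
    then show False using eq assms(2,3,5) pq by (cases v') auto
  qed
qed

lemma alt_words_eq: "alt_words A B = flat ` lists (A \<times> B)"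
  unfolding alt_words_def flat_def by (auto simp: image_iff lists_eq_set)

text \<open>The pair form of \<open>U\<close> expressed through \<open>T\<close> alone, since an
  automaton is at hand only for \<open>T\<close>.\<close>

definition prefix_set :: "nat set \<Rightarrow> nat set \<Rightarrow> nat list set \<Rightarrow> (nat \<times> nat) list set" where
  "prefix_set A B T = {ps \<in> lists (A \<times> B). flat ps \<in> T \<and> (\<forall>p \<in> A \<times> B. flat (ps @ [p]) \<in> T)}"

lemma alt_prefix_closedD:
  assumes "alt_prefix_closed A B U" "us @ [p] \<in> lists (A \<times> B)" "flat (us @ [p]) \<in> U"
  shows "flat us \<in> U"
  using assms unfolding alt_prefix_closed_def alt_words_eq by (cases p) fastforce

text \<open>Although \<open>T\<close> does not determine \<open>U\<close> through \<open>T \<inter> (\<Sigma>\<Gamma>)\<^sup>*\<close> (a factor \<open>ab\<close> may belong to \<open>\<Sigma>\<^sup>*\<Gamma>\<^sup>*\<close>),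
  prefix-closedness makes one further letter pair enough to recognise the words of \<open>U\<close>.\<close>

lemma prefix_set_correct:
  assumes disj: "A \<inter> B = {}" and U: "U \<subseteq> alt_words A B" and cl: "alt_prefix_closed A B U"
    and T: "T = {u @ v @ x |u v x. u \<in> U \<and> v \<in> lists A \<and> x \<in> lists B}"
  shows "ps \<in> prefix_set A B T \<longleftrightarrow> ps \<in> lists (A \<times> B) \<and> flat ps \<in> U"
proof
  assume "ps \<in> lists (A \<times> B) \<and> flat ps \<in> U"
  then have ps: "ps \<in> lists (A \<times> B)" "flat ps \<in> U" by auto
  have "flat ps = flat ps @ [] @ []" by simp
  then have "flat ps \<in> T" unfolding T using ps(2) by blast
  moreover have "flat (ps @ [p]) \<in> T" if "p \<in> A \<times> B" for p
  proof -
    have "flat (ps @ [p]) = flat ps @ [fst p] @ [snd p]" "[fst p] \<in> lists A" "[snd p] \<in> lists B"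
      using that by auto
    then show ?thesis unfolding T using ps(2) by blast
  qed
  ultimately show "ps \<in> prefix_set A B T"
    unfolding prefix_set_def using ps(1) by (intro CollectI conjI ballI)
next
  assume "ps \<in> prefix_set A B T"
  then have ps: "ps \<in> lists (A \<times> B)" "flat ps \<in> T" "\<And>p. p \<in> A \<times> B \<Longrightarrow> flat (ps @ [p]) \<in> T"
    unfolding prefix_set_def by blast+
  have "flat ps \<in> U"
  proof (cases "A \<times> B = {}")
    case True
    then have "ps = []" using ps(1) by (cases ps) auto
    then show ?thesis using ps(2) unfolding T by auto
  next
    case False
    then obtain p where p: "p \<in> A \<times> B" by blast
    obtain u v x where uvx: "flat (ps @ [p]) = u @ v @ x" "u \<in> U" "v \<in> lists A" "x \<in> lists B"
      using ps(3)[OF p] unfolding T by blast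
    obtain qs where qs: "u = flat qs" "qs \<in> lists (A \<times> B)"
      using uvx(2) U unfolding alt_words_eq by blast
    have psp: "ps @ [p] \<in> lists (A \<times> B)" using ps(1) p by auto
    have even: "even (length (flat ps))" for ps :: "(nat \<times> nat) list" by (induction ps) auto
    \<comment> \<open>Both \<open>u\<close> and \<open>flat ps1\<close> have even length, so the cut
      cannot fall inside a pair.\<close>
    from flat_eq_append[OF uvx(1)] obtain rs where rs: "ps @ [p] = qs @ rs" "v @ x = flat rs"
    proof (elim disjE exE conjE)
      fix ps1 ps2 assume "ps @ [p] = ps1 @ ps2" "u = flat ps1" "v @ x = flat ps2"
      then show thesis using that[of ps2] qs flat_inj[of ps1 qs] by simp
    next
      fix ps1 q ps2 assume "u = flat ps1 @ [fst q]"
      then show thesis using qs even[of qs] even[of ps1] by simp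
    qed
    have "rs \<in> lists (A \<times> B)" using psp rs(1) by (metis append_in_lists_conv)
    then have "length rs \<le> 1" using flat_sorted_length[OF rs(2)[symmetric] uvx(3,4) _ disj] by simp
    \<comment> \<open>Either \<open>u\<close> is all of \<open>flat (ps @ [p])\<close> and
      closedness removes \<open>p\<close>, or \<open>u\<close> is exactly
      \<open>flat ps\<close>.\<close>
    then consider "rs = []" | q where "rs = [q]" by (cases rs) auto
    then show ?thesis
    proof cases
      case 1
      then have "flat (ps @ [p]) \<in> U" using rs qs uvx(2) by simp
      then show ?thesis using alt_prefix_closedD[OF cl psp] by simp
    next
      case 2
      then show ?thesis using rs(1) qs uvx(2) by simp
    qed
  qed
  then show "ps \<in> lists (A \<times> B) \<and> flat ps \<in> U" using ps(1) by simp
qed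

text \<open>Membership of \<open>p @ w\<close> is decided by whether its flattening and those of its
  one-pair extensions lie in \<open>T\<close>, hence by the quotient of \<open>T\<close> by
  \<open>flat p\<close>. So the bound read off the automaton for \<open>T\<close> carries
  over.\<close>

lemma left_quotient_prefix_set:
  assumes fin: "finite (range (\<lambda>w. left_quotient w T))" "card (range (\<lambda>w. left_quotient w T)) \<le> m"
  shows "finite_quotients (prefix_set A B T)" "card ((\<lambda>p. left_quotient p (prefix_set A B T)) ` lists (A \<times> B)) \<le> m"
proof -
  let ?V = "prefix_set A B T"
  have det: "left_quotient p ?V = left_quotient p' ?V"
    if "p \<in> lists (A \<times> B)" "p' \<in> lists (A \<times> B)" "left_quotient (flat p) T = left_quotient (flat p') T" for p p'
  proof -
    have "flat (p @ w) \<in> T \<longleftrightarrow> flat (p' @ w) \<in> T" for w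
    proof -
      have "flat w \<in> left_quotient (flat p) T \<longleftrightarrow> flat w \<in> left_quotient (flat p') T" using that(3) by simp
      then show ?thesis by (simp add: left_quotient_def)
    qed
    from this[of w for w] this[of "w @ [q]" for w q] show ?thesis
      using that(1,2) unfolding left_quotient_def prefix_set_def by auto
  qed
  have sub: "(\<lambda>p. left_quotient (flat p) T) ` lists (A \<times> B) \<subseteq> range (\<lambda>w. left_quotient w T)" by auto
  have *: "finite ((\<lambda>p. left_quotient p ?V) ` lists (A \<times> B))"
    "card ((\<lambda>p. left_quotient p ?V) ` lists (A \<times> B)) \<le> card (range (\<lambda>w. left_quotient w T))"
    by (rule card_image_determined[OF det sub fin(1)], assumption+)+
  show "finite_quotients ?V" by (rule finite_quotientsI[OF _ *(1)]) (auto simp: prefix_set_def)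
  show "card ((\<lambda>p. left_quotient p ?V) ` lists (A \<times> B)) \<le> m" using *(2) fin(2) by (rule le_trans)
qed

lemma flat_eq_concat: "concat (map (\<lambda>p. [fst p, snd p]) ps) = flat ps"
  by (induction ps) auto

lemma prefix_test_iff:
  "u \<in> lists (set Sig \<times> set Gam) \<Longrightarrow>
    prefix_test Sig Gam M u \<longleftrightarrow> u \<in> prefix_set (set Sig) (set Gam) (nfa_lang M)"
  unfolding prefix_test_def prefix_set_def flat_eq_concat accepts_iff set_pairs by blast

lemma length_filter_disjoint:
  "w \<in> lists (A \<union> B) \<Longrightarrow> A \<inter> B = {} \<Longrightarrow>
    length (filter (\<lambda>c. c \<in> A) w) + length (filter (\<lambda>c. c \<in> B) w) = length w"
  by (induction w) auto

lemma rel_test_iff: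
  assumes "set Sig \<inter> set Gam = {}" "nfa_lang M \<subseteq> lists (set Sig \<union> set Gam)"
  shows "rel_test Sig Gam M x y \<longleftrightarrow> (x, y) \<in> sem (set Sig) (set Gam) ` nfa_lang M"
proof
  assume "rel_test Sig Gam M x y"
  then show "(x, y) \<in> sem (set Sig) (set Gam) ` nfa_lang M"
    unfolding rel_test_def accepts_iff sem_def by blast
next
  assume "(x, y) \<in> sem (set Sig) (set Gam) ` nfa_lang M"
  then obtain w where w: "w \<in> nfa_lang M" "(x, y) = sem (set Sig) (set Gam) w" by (rule imageE)
  have wl: "w \<in> lists (set Sig \<union> set Gam)" using w(1) assms(2) by blast
  have "w \<in> set (words (Sig @ Gam) (length x + length y))"
    using w(2) wl length_filter_disjoint[OF wl assms(1)] unfolding set_words set_append sem_def by simp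
  then show "rel_test Sig Gam M x y" using w unfolding rel_test_def accepts_iff sem_def by blast
qed

text \<open>Positivity matters because lengths below \<open>N\<close> are enumerated as lengths up
  to \<open>N - 1\<close>; for \<open>N = 0\<close> the empty word would be included.\<close>

lemma rows_test_iff:
  assumes "N > 0"
  shows "rows_test Sig Gam M M' N b u \<longleftrightarrow> (\<forall>x0 \<in> lists (set Sig). length x0 = N \<longrightarrow>
    (\<exists>x1 \<in> lists (set Sig). length x1 < N \<and>
      (\<forall>g \<in> lists (set Sig). \<forall>y \<in> lists (set Gam). length g \<le> b \<longrightarrow> length y \<le> b \<longrightarrow>
        residual_test Sig Gam M M' u (x0 @ g) y = residual_test Sig Gam M M' u (x1 @ g) y)))"
proof -
  have le: "length w \<le> N - 1 \<longleftrightarrow> length w < N" for w :: "nat list" using assms by linarith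
  have ball: "(\<forall>x \<in> {w \<in> S. P w}. Q x) \<longleftrightarrow> (\<forall>x \<in> S. P x \<longrightarrow> Q x)"
    and bex: "(\<exists>x \<in> {w \<in> S. P w}. Q x) \<longleftrightarrow> (\<exists>x \<in> S. P x \<and> Q x)"
    and imp: "(p \<longrightarrow> (\<forall>x \<in> S. Q x)) \<longleftrightarrow> (\<forall>x \<in> S. p \<longrightarrow> Q x)"
    for S :: "nat list set" and P Q p by blast+
  show ?thesis by (simp only: rows_test_def set_words set_words_le le ball bex imp)
qed

lemma decision_correct:
  assumes "admissible_input Sig Gam M M'"
  shows "decision Sig Gam M M' \<longleftrightarrow>
    sem (set Sig) (set Gam) ` nfa_lang M \<in> Rel (set Sig) (set Gam) (nfa_lang M')"
proof -
  define A B where "A = set Sig" and "B = set Gam"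
  obtain tr I F where M: "M = (tr, I, F)" by (metis surj_pair)
  obtain tr' I' F' where M': "M' = (tr', I', F')" by (metis surj_pair)
  define n m where "n = length Sig + length Gam + (length I + 2 * length tr)" and "m = length I' + length tr'"
  note adm = assms[unfolded admissible_input_def Let_def, folded A_def B_def]
  have disj: "A \<inter> B = {}" by (rule adm[THEN conjunct1])
  have S: "nfa_lang M \<subseteq> lists (A \<union> B)" "finite_shiftlag A B (nfa_lang M)"
    by (rule adm[THEN conjunct2, THEN conjunct1])
      (rule adm[THEN conjunct2, THEN conjunct2, THEN conjunct2, THEN conjunct1])
  from adm have "\<exists>U. regular U \<and> U \<subseteq> alt_words A B \<and> alt_prefix_closed A B U \<and>
    nfa_lang M' = {u @ v @ x |u v x. u \<in> U \<and> v \<in> lists A \<and> x \<in> lists B}"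
    by (elim conjE)
  then obtain U where U: "U \<subseteq> alt_words A B" "alt_prefix_closed A B U"
    and T: "nfa_lang M' = {u @ v @ x |u v x. u \<in> U \<and> v \<in> lists A \<and> x \<in> lists B}" by (elim exE conjE)
  define V where "V = prefix_set A B (nfa_lang M')"
  have V_iff: "ps \<in> V \<longleftrightarrow> ps \<in> lists (A \<times> B) \<and> flat ps \<in> U" for ps
    unfolding V_def by (rule prefix_set_correct[OF disj U T])
  have "card (set I \<union> states tr) \<le> length I + (length tr + length tr)"
    unfolding states_def
    by (intro order.trans[OF card_Un_le] add_mono card_length order.trans[OF card_image_le card_length]) simp_all
  then have size: "card (set I \<union> states tr) \<le> n" by (simp add: n_def)
  have cA: "card A \<le> n" and cB: "card B \<le> n"
    using card_length[of Sig] card_length[of Gam] by (simp_all add: A_def B_def n_def)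
  interpret S: finite_shiftlag_nfa A B tr I F n
    by unfold_locales (use disj S cA cB size in \<open>simp_all add: A_def B_def M\<close>)
  have cV: "card ((\<lambda>p. left_quotient p V) ` lists (A \<times> B)) \<le> 2 ^ m" and finite_quotients_V: "finite_quotients V"
    unfolding V_def m_def M' by (rule left_quotient_prefix_set[OF left_quotient_nfa_lang])+
  let ?K = "residual_bound n"
  interpret T: sync_target A B V S.R ?K
  proof
    show "finite A" "finite B" by (simp_all add: A_def B_def)
    show "V \<subseteq> lists (A \<times> B)" using V_iff by blast
    show "us \<in> V" if "us @ [p] \<in> V" for us p
      using that alt_prefix_closedD[OF U(2)] unfolding V_iff by (metis append_in_lists_conv)
    show "x \<in> lists A \<and> y \<in> lists B" if "S.R x y" for x y
      using that by (auto simp: S.R_def sem_def)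
  qed (fact disj S.few_residuals_R finite_quotients_V)+
  have Teq: "T.T = nfa_lang M'"
  proof -
    have "U = flat ` V" using U(1) V_iff unfolding alt_words_eq by blast
    then show ?thesis unfolding T.T_def T by blast
  qed
  have Seq: "{(x, y). S.R x y} = sem A B ` nfa_lang M" unfolding S.R_def M by auto
  have Rt: "rel_test Sig Gam M x y = S.R x y" for x y
    unfolding S.R_def M[symmetric] using rel_test_iff[of Sig Gam M x y] disj S(1) by (simp add: A_def B_def)
  have Vt: "prefix_test Sig Gam M' u \<longleftrightarrow> u \<in> V" if "u \<in> lists (A \<times> B)" for u
    unfolding V_def A_def B_def by (rule prefix_test_iff[OF that[unfolded A_def B_def]])
  have Rut: "residual_test Sig Gam M M' u x y = T.rest_rel u x y"
    if "u \<in> lists (A \<times> B)" "x \<in> lists A" "y \<in> lists B" for u x y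
  proof (cases "x = [] \<or> y = []")
    case False
    then have "u @ [(hd x, hd y)] \<in> lists (A \<times> B)" using that by (cases x; cases y) auto
    then show ?thesis unfolding residual_test_def T.rest_rel_def Rt using Vt False by simp
  qed (auto simp: residual_test_def T.rest_rel_def Rt)
  have rowt: "rows_test Sig Gam M M' (row_length (?K + 2)) (context_bound n (?K + 2)) u \<longleftrightarrow>
      finite (T.row u ` lists A)" if u: "u \<in> lists (A \<times> B)" for u
  proof -
    have pos: "row_length (?K + 2) > 0" by (simp add: row_length_def)
    show ?thesis
      unfolding T.finite_row_iff_bounded[OF u cA] rows_test_iff[OF pos] A_def[symmetric] B_def[symmetric]
      by (intro ball_cong bex_cong imp_cong conj_cong refl) (simp only: Rut[OF u] append_in_lists_conv)
  qed
  have "decision Sig Gam M M' \<longleftrightarrow> Rel_test Sig Gam M M' n m ?K"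
    unfolding decision_def full_test_def M M' fst_conv snd_conv n_def m_def ..
  also have "\<dots> \<longleftrightarrow> ((\<exists>x y. S.R x y) \<longrightarrow> [] \<in> V) \<and>
      (\<forall>u \<in> lists (A \<times> B). length u \<le> ?K * 2 ^ m \<longrightarrow> u \<in> V \<longrightarrow> finite (T.row u ` lists A))"
  proof -
    have 1: "(\<exists>x \<in> set (words_le Sig (2 * ?K)). \<exists>y \<in> set (words_le Gam (2 * ?K)). rel_test Sig Gam M x y)
        \<longleftrightarrow> (\<exists>x y. S.R x y)"
      unfolding T.R_nonempty_iff set_words_le A_def[symmetric] B_def[symmetric] Rt by blast
    have 2: "(\<forall>u \<in> set (words_le (pairs Sig Gam) (?K * 2 ^ m)). prefix_test Sig Gam M' u \<longrightarrow>
        rows_test Sig Gam M M' (row_length (?K + 2)) (context_bound n (?K + 2)) u) \<longleftrightarrow>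
        (\<forall>u \<in> lists (A \<times> B). length u \<le> ?K * 2 ^ m \<longrightarrow> u \<in> V \<longrightarrow> finite (T.row u ` lists A))"
      unfolding set_words_le set_pairs A_def[symmetric] B_def[symmetric] using Vt rowt by blast
    show ?thesis unfolding Rel_test_def 1 2 by (simp only: Vt lists.Nil)
  qed
  \<comment> \<open>By prefix closedness the nonemptiness condition is a single membership
    test.\<close>
  also have "[] \<in> V \<longleftrightarrow> V \<noteq> {}" using T.V_prefix[of "[]"] by auto
  also have "(\<forall>u \<in> lists (A \<times> B). length u \<le> ?K * 2 ^ m \<longrightarrow> u \<in> V \<longrightarrow> finite (T.row u ` lists A))
      \<longleftrightarrow> (\<forall>u \<in> V. finite (T.row u ` lists A))"
  proof (intro iffI ballI impI)
    fix u assume *: "\<forall>u \<in> lists (A \<times> B). length u \<le> ?K * 2 ^ m \<longrightarrow> u \<in> V \<longrightarrow> finite (T.row u ` lists A)"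
      and u: "u \<in> V"
    have "u \<in> lists (A \<times> B)" using u V_iff by blast
    \<comment> \<open>An arbitrary \<open>u\<close> is replaced by a short word of its class, which
      lies in \<open>V\<close> and has the same rows.\<close>
    from T.\<kappa>_short[OF cV this] obtain u' where u': "u' \<in> lists (A \<times> B)" "length u' \<le> ?K * 2 ^ m" "T.\<kappa> u' = T.\<kappa> u"
      by blast
    have "u' \<in> V" using T.\<kappa>_V[OF u'(3)] u by simp
    moreover have "T.row u' = T.row u" using T.\<kappa>_rest_rel[OF u'(3)] by (simp add: T.row_def fun_eq_iff)
    ultimately show "finite (T.row u ` lists A)" using * u'(1,2) by (metis (no_types))
  qed blast
  also have "((\<exists>x y. S.R x y) \<longrightarrow> V \<noteq> {}) \<and> (\<forall>u \<in> V. finite (T.row u ` lists A)) \<longleftrightarrow>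
      {(x, y). S.R x y} \<in> Rel A B T.T"
    by (rule T.Rel_iff[symmetric])
  finally have "decision Sig Gam M M' \<longleftrightarrow> sem A B ` nfa_lang M \<in> Rel A B (nfa_lang M')"
    unfolding Seq Teq .
  then show ?thesis by (simp only: A_def B_def)
qed

theorem mainTheorem20:
  shows "\<exists>M :: recf. \<forall>Sig Gam AS AT. admissible_input Sig Gam AS AT \<longrightarrow>
           eval_recf M [enc_input Sig Gam AS AT]
             (if sem (set Sig) (set Gam) ` nfa_lang AS \<in> Rel (set Sig) (set Gam) (nfa_lang AT)
              then 1 else 0)"
proof -
  obtain r where r: "\<And>c. eval_recf r [c] (if decide_code c then 1 else 0)"
    using computable_decide_code unfolding computable_def by auto
  show ?thesis
  proof (intro exI[of _ r] allI impI)
    fix Sig Gam AS AT assume "admissible_input Sig Gam AS AT"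
    then show "eval_recf r [enc_input Sig Gam AS AT]
        (if sem (set Sig) (set Gam) ` nfa_lang AS \<in> Rel (set Sig) (set Gam) (nfa_lang AT) then 1 else 0)"
      using r[of "enc_input Sig Gam AS AT"] by (simp only: decide_enc_input decision_correct)
  qed
qed

end
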